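(* Let $n\geqslant 1$, $\alpha\in[0,1)$, $0<p,q\leqslant\infty$, $s\in\mathbb{R}$. Then the embedding $$L^\infty(\mathbb{R}^n)\subset M^{s,\alpha}_{p,q}(\mathbb{R}^n)$$ holds if and only if $p=\infty$ and $$s\leqslant (1-\alpha)A(\infty,q),$$ with strict inequality in the last condition when $q<\infty$.
   Context: Convention $1/\infty=0$. For $(p,q)\in(0,\infty]^2$, $A(p,q)=\min\{0,\ n(1-1/p-1/q),\ n(1/p-1/q)\}$. $X\subset Y$ for (quasi-)normed spaces denotes embedding: $X\subset Y$ as sets with $\|f\|_Y\leqslant C\|f\|_X$ for all $f\in X$. Fourier transform: $\mathscr{F}f(\xi)=\hat f(\xi)=\int_{\mathbb{R}^n}f(x)e^{-2\pi i x\cdot\xi}dx$. Write $\langle k\rangle=(1+|k|^2)^{1/2}$. $\alpha$-modulation space: for $\alpha\in[0,1)$, take suitable constants $c,C>0$ and Schwartz functions $\{\eta_k^\alpha\}_{k\in\mathbb{Z}^n}$ such that: $|\eta_k^\alpha(\xi)|\geqslant 1$ if $|\xi-\langle k\rangle^{\frac{\alpha}{1-\alpha}}k|<c\langle k\rangle^{\frac{\alpha}{1-\alpha}}$; $\operatorname{supp}\eta_k^\alpha\subset\{\xi:|\xi-\langle k\rangle^{\frac{\alpha}{1-\alpha}}k|<C\langle k\rangle^{\frac{\alpha}{1-\alpha}}\}$; $\sum_{k\in\mathbb{Z}^n}\eta_k^\alpha(\xi)=1$ for all $\xi\in\mathbb{R}^n$; and for every multi-index $\gamma$ there is $C_{\gamma}$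 with $|\partial^\gamma\eta_k^\alpha(\xi)|\leqslant C_{\gamma}\langle k\rangle^{-\frac{\alpha|\gamma|}{1-\alpha}}$ for all $\xi\in\mathbb{R}^n$, $k\in\mathbb{Z}^n$. Put $\Box_k^\alpha=\mathscr{F}^{-1}\eta_k^\alpha\mathscr{F}$. For $0<p,q\leqslant\infty$, $s\in\mathbb{R}$, $M^{s,\alpha}_{p,q}(\mathbb{R}^n)$ is the set of $f\in\mathscr{S}'(\mathbb{R}^n)$ with $\|f\|_{M^{s,\alpha}_{p,q}}=\big(\sum_{k\in\mathbb{Z}^n}\langle k\rangle^{\frac{sq}{1-\alpha}}\|\Box_k^\alpha f\|_{L^p}^q\big)^{1/q}<\infty$ (supremum over $k$ of $\langle k\rangle^{\frac{s}{1-\alpha}}\|\Box_k^\alpha f\|_{L^p}$ if $q=\infty$). Different choices of $\{\eta_k^\alpha\}$ give the same space with equivalent (quasi-)norms. *)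

theory Defs
  imports "HOL-Probability.Probability"
begin

section \<open>Schwartz functions and tempered distributions\<close>

definition partial_deriv :: "'n::finite \<Rightarrow> (real^'n \<Rightarrow> complex) \<Rightarrow> real^'n \<Rightarrow> complex" where
  "partial_deriv i f x = vector_derivative (\<lambda>t. f (x + t *\<^sub>R axis i 1)) (at 0)"

text \<open>A multi-index \<open>\<gamma>\<close> is given as a list of coordinate directions, with \<open>|\<gamma>|\<close> the length of the
  list; for smooth functions the order of the directions does not matter.\<close>

definition partial_derivs :: "'n::finite list \<Rightarrow> (real^'n \<Rightarrow> complex) \<Rightarrow> real^'n \<Rightarrow> complex" where
  "partial_derivs \<gamma> f = foldr partial_deriv \<gamma> f"

definition smooth :: "(real^'n::finite \<Rightarrow> complex) \<Rightarrow> bool" where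
  "smooth f \<longleftrightarrow> (\<forall>\<gamma>. partial_derivs \<gamma> f differentiable_on UNIV)"

definition schwartz :: "(real^'n::finite \<Rightarrow> complex) set" where
  "schwartz = {f. smooth f \<and>
     (\<forall>N \<gamma>. \<exists>C. \<forall>x. (1 + norm x) ^ N * norm (partial_derivs \<gamma> f x) \<le> C)}"

definition schwartz_seminorm :: "nat \<Rightarrow> 'n::finite list \<Rightarrow> (real^'n \<Rightarrow> complex) \<Rightarrow> real" where
  "schwartz_seminorm N \<gamma> f = (SUP x. (1 + norm x) ^ N * norm (partial_derivs \<gamma> f x))"

definition schwartz_topology :: "(real^'n::finite \<Rightarrow> complex) topology" where
  "schwartz_topology = topology_generated_by
     {{\<psi> \<in> schwartz. schwartz_seminorm N \<gamma> (\<lambda>x. \<psi> x - \<phi> x) < e} | N \<gamma> \<phi> e. \<phi> \<in> schwartz \<and> e > 0}"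

text \<open>A distribution is a functional on Schwartz functions; its values at functions outside
  \<^const>\<open>schwartz\<close> are irrelevant and left unconstrained.\<close>

type_synonym 'n functional = "(real^'n \<Rightarrow> complex) \<Rightarrow> complex"

definition tempered :: "'n::finite functional \<Rightarrow> bool" where
  "tempered u \<longleftrightarrow>
     (\<forall>\<phi>\<in>schwartz. \<forall>\<psi>\<in>schwartz. \<forall>a b. u (\<lambda>x. a * \<phi> x + b * \<psi> x) = a * u \<phi> + b * u \<psi>) \<and>
     continuous_map schwartz_topology euclidean u"

definition represents :: "(real^'n::finite \<Rightarrow> complex) \<Rightarrow> 'n functional \<Rightarrow> bool" where
  "represents g u \<longleftrightarrow> (\<forall>\<phi>\<in>schwartz. integrable lborel (\<lambda>x. g x * \<phi> x) \<and>
     u \<phi> = (\<integral>x. g x * \<phi> x \<partial>lborel))"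


section \<open>Fourier transform and Fourier multipliers\<close>

definition fourier :: "(real^'n::finite \<Rightarrow> complex) \<Rightarrow> real^'n \<Rightarrow> complex" where
  "fourier f \<xi> = (\<integral>x. f x * exp (- 2 * of_real pi * \<i> * of_real (x \<bullet> \<xi>)) \<partial>lborel)"

definition inv_fourier :: "(real^'n::finite \<Rightarrow> complex) \<Rightarrow> real^'n \<Rightarrow> complex" where
  "inv_fourier f x = (\<integral>\<xi>. f \<xi> * exp (2 * of_real pi * \<i> * of_real (x \<bullet> \<xi>)) \<partial>lborel)"

text \<open>The usual extensions to distributions by duality.\<close>

definition fourier_distr :: "'n::finite functional \<Rightarrow> 'n functional" where
  "fourier_distr u \<phi> = u (fourier \<phi>)"

definition inv_fourier_distr :: "'n::finite functional \<Rightarrow> 'n functional" where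
  "inv_fourier_distr u \<phi> = u (inv_fourier \<phi>)"

definition mult_distr :: "(real^'n::finite \<Rightarrow> complex) \<Rightarrow> 'n functional \<Rightarrow> 'n functional" where
  "mult_distr m u \<phi> = u (\<lambda>\<xi>. m \<xi> * \<phi> \<xi>)"

definition fourier_mult :: "(real^'n::finite \<Rightarrow> complex) \<Rightarrow> 'n functional \<Rightarrow> 'n functional" where
  "fourier_mult m u = inv_fourier_distr (mult_distr m (fourier_distr u))"


section \<open>Lebesgue (quasi-)norms\<close>

definition ennreal_powr :: "ennreal \<Rightarrow> real \<Rightarrow> ennreal" where
  "ennreal_powr x r = (if x = \<infinity> then \<infinity> else ennreal (enn2real x powr r))"
  \<comment> \<open>only used with \<open>r > 0\<close>\<close>

definition Lp_norm :: "ennreal \<Rightarrow> (real^'n::finite \<Rightarrow> complex) \<Rightarrow> ennreal" where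
  "Lp_norm p g =
     (if p = \<infinity> then esssup lborel (\<lambda>x. ennreal (norm (g x)))
      else ennreal_powr (\<integral>\<^sup>+x. ennreal (norm (g x) powr enn2real p) \<partial>lborel) (1 / enn2real p))"

text \<open>The \<open>L\<^sup>p\<close> norm of a distribution is that of the (almost everywhere unique) measurable function
  representing it, and \<open>\<infinity>\<close> if there is none. Borel functions suffice, since every Lebesgue
  measurable function agrees with a Borel function almost everywhere.\<close>

definition Lp_distr_norm :: "ennreal \<Rightarrow> 'n::finite functional \<Rightarrow> ennreal" where
  "Lp_distr_norm p u = (INF g \<in> {g \<in> borel_measurable lborel. represents g u}. Lp_norm p g)"

text \<open>\<open>L\<^sup>\<infinity>\<close>, with functions identified with the distributions they represent.\<close>

definition Linf_space :: "'n::finite functional set" where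
  "Linf_space = {u. tempered u \<and> Lp_distr_norm \<infinity> u < \<infinity>}"


section \<open>\<open>\<alpha>\<close>-modulation spaces\<close>

definition lattice_point :: "int^'n::finite \<Rightarrow> real^'n" where
  "lattice_point k = (\<chi> i. real_of_int (k $ i))"

definition japanese :: "int^'n::finite \<Rightarrow> real" where
  "japanese k = sqrt (1 + (norm (lattice_point k))\<^sup>2)"

definition alpha_radius :: "real \<Rightarrow> int^'n::finite \<Rightarrow> real" where
  "alpha_radius \<alpha> k = japanese k powr (\<alpha> / (1 - \<alpha>))"

definition alpha_center :: "real \<Rightarrow> int^'n::finite \<Rightarrow> real^'n" where
  "alpha_center \<alpha> k = alpha_radius \<alpha> k *\<^sub>R lattice_point k"

definition alpha_decomposition :: "real \<Rightarrow> (int^'n::finite \<Rightarrow> real^'n \<Rightarrow> complex) \<Rightarrow> bool" where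
  "alpha_decomposition \<alpha> \<eta> \<longleftrightarrow>
     (\<forall>k. \<eta> k \<in> schwartz) \<and>
     (\<exists>c>0. \<forall>k \<xi>. norm (\<xi> - alpha_center \<alpha> k) < c * alpha_radius \<alpha> k \<longrightarrow> norm (\<eta> k \<xi>) \<ge> 1) \<and>
     (\<exists>C>0. \<forall>k. closure {\<xi>. \<eta> k \<xi> \<noteq> 0} \<subseteq> {\<xi>. norm (\<xi> - alpha_center \<alpha> k) < C * alpha_radius \<alpha> k}) \<and>
     (\<forall>\<xi>. ((\<lambda>k. \<eta> k \<xi>) has_sum 1) UNIV) \<and>
     (\<forall>\<gamma>. \<exists>C. \<forall>\<xi> k. norm (partial_derivs \<gamma> (\<eta> k) \<xi>)
        \<le> C * japanese k powr (- (\<alpha> * real (length \<gamma>) / (1 - \<alpha>))))"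

text \<open>The functions \<open>\<eta> k\<close> are a parameter of the norm; for a fixed \<open>\<alpha>\<close> all families satisfying
  \<^const>\<open>alpha_decomposition\<close> give equivalent norms.\<close>

definition alpha_mod_norm ::
    "(int^'n::finite \<Rightarrow> real^'n \<Rightarrow> complex) \<Rightarrow> real \<Rightarrow> real \<Rightarrow> ennreal \<Rightarrow> ennreal
      \<Rightarrow> 'n functional \<Rightarrow> ennreal" where
  "alpha_mod_norm \<eta> s \<alpha> p q u =
     (if q = \<infinity>
      then (SUP k. ennreal (japanese k powr (s / (1 - \<alpha>))) * Lp_distr_norm p (fourier_mult (\<eta> k) u))
      else ennreal_powr
        (\<Sum>\<^sub>\<infinity>k. ennreal (japanese k powr (s * enn2real q / (1 - \<alpha>))) *
               ennreal_powr (Lp_distr_norm p (fourier_mult (\<eta> k) u)) (enn2real q))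
        (1 / enn2real q))"

definition alpha_mod_space ::
    "(int^'n::finite \<Rightarrow> real^'n \<Rightarrow> complex) \<Rightarrow> real \<Rightarrow> real \<Rightarrow> ennreal \<Rightarrow> ennreal
      \<Rightarrow> 'n functional set" where
  "alpha_mod_space \<eta> s \<alpha> p q = {u. tempered u \<and> alpha_mod_norm \<eta> s \<alpha> p q u < \<infinity>}"


section \<open>Embeddings and the index \<open>A(p,q)\<close>\<close>

definition embeds :: "'a set \<Rightarrow> ('a \<Rightarrow> ennreal) \<Rightarrow> 'a set \<Rightarrow> ('a \<Rightarrow> ennreal) \<Rightarrow> bool" where
  "embeds X norm\<^sub>X Y norm\<^sub>Y \<longleftrightarrow> X \<subseteq> Y \<and> (\<exists>C::real. \<forall>f\<in>X. norm\<^sub>Y f \<le> ennreal C * norm\<^sub>X f)"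

text \<open>In \<^typ>\<open>ennreal\<close>, \<open>1 / \<infinity> = 0\<close>.\<close>

definition index_A :: "nat \<Rightarrow> ennreal \<Rightarrow> ennreal \<Rightarrow> real" where
  "index_A n p q = Min {0, real n * (1 - enn2real (1 / p) - enn2real (1 / q)),
                           real n * (enn2real (1 / p) - enn2real (1 / q))}"

end

theory Submission
  imports Defs
begin

text \<open>
  Write \<open>K\<^sub>k = fourier (\<eta> k)\<close>. On a bounded function \<open>f\<close> the \<open>k\<close>-th frequency piece is the integral
  operator \<open>x \<mapsto> \<integral> f (x + z) K\<^sub>k z dz\<close>, so its norm on \<open>L\<^sup>\<infinity>\<close> is at most the \<open>L\<^sup>1\<close> norm of \<open>K\<^sub>k\<close>. The index
  \<open>A(\<infinity>, q)\<close> equals \<open>- n / q\<close>, hence the condition on \<open>s\<close> says that the weights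
  \<open>japanese k powr (s / (1 - \<alpha>))\<close> are \<open>q\<close>-summable over the lattice, or bounded if \<open>q = \<infinity>\<close>: the sum of
  \<open>japanese k powr (- \<beta>)\<close> converges exactly for \<open>\<beta> > n\<close> (\<open>japanese_sum_bounded\<close>,
  \<open>japanese_sum_unbounded\<close>).

  Sufficiency. The symbols \<open>\<eta> k\<close> are uniformly smooth bumps at the scale \<open>alpha_radius \<alpha> k\<close>. Integration
  by parts bounds \<open>K\<^sub>k\<close> by an integrable function at the inverse scale, with the \<open>L\<^sup>1\<close>-invariant
  normalisation. So the \<open>L\<^sup>1\<close> norms of the kernels are bounded uniformly in \<open>k\<close>
  (\<open>alpha_decomposition_kernels_bounded\<close>), every piece of \<open>f\<close> is bounded by a fixed multiple of the
  norm of \<open>f\<close>, and summability of the weights gives the embedding (\<open>embeds_of_small_s\<close>).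

  Necessity. If \<open>p < \<infinity>\<close>, the constant function \<open>1\<close> has a nonzero constant piece, which is not in \<open>L\<^sup>p\<close>
  (\<open>p_infinite_of_embeds\<close>). If \<open>p = \<infinity>\<close>, there is one function bounded by \<open>1\<close> all of whose pieces have
  norm at least \<open>1 / 2\<close>: it equals the pure frequency \<open>alpha_center \<alpha> k\<close> on a slab that is wide
  compared with the tail of \<open>K\<^sub>k\<close>, the slabs for different \<open>k\<close> being disjoint (\<open>spread_frequencies\<close>). In
  the middle of the slab the piece is \<open>\<eta> k (alpha_center \<alpha> k)\<close> up to a phase and an error of at most
  \<open>1 / 2\<close>, and this value of \<open>\<eta> k\<close> has modulus at least \<open>1\<close>. The embedding thus forces the weights
  themselves to be summable, or bounded (\<open>s_small_of_embeds\<close>).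

  Two facts of harmonic analysis connect this with distributions: Fourier inversion on Schwartz
  functions, which identifies \<open>\<integral> K\<^sub>k z * phase (\<xi> \<bullet> z) dz\<close> with \<open>\<eta> k \<xi>\<close> (\<open>fourier_inversion\<close>), and the
  uniqueness of the function representing a distribution (\<open>represents_unique\<close>), by which the norm of a
  piece may be computed from its integral formula. Both follow from Gaussian averaging.
\<close>

section \<open>Calculus of Schwartz functions\<close>

lemma partial_deriv_eq:
  assumes "(f has_derivative D) (at x)"
  shows "partial_deriv i f x = D (axis i 1)"
proof -
  have "((\<lambda>t::real. x + t *\<^sub>R axis i (1::real)) has_derivative (\<lambda>t. t *\<^sub>R axis i 1)) (at 0)"
    by (auto intro!: derivative_eq_intros)
  then have "((\<lambda>t. f (x + t *\<^sub>R axis i 1)) has_derivative (\<lambda>t. D (t *\<^sub>R axis i 1))) (at 0)"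
    using assms has_derivative_compose[of "\<lambda>t. x + t *\<^sub>R axis i 1" _ 0 UNIV f D] by simp
  moreover have "D (t *\<^sub>R axis i 1) = t *\<^sub>R D (axis i 1)" for t
    using assms by (simp add: has_derivative_def bounded_linear.linear linear_cmul)
  ultimately show ?thesis
    unfolding partial_deriv_def
    by (intro vector_derivative_at) (simp add: has_vector_derivative_def)
qed

lemma partial_deriv_along:
  assumes "f differentiable (at (x + t *\<^sub>R axis i 1))"
  shows "((\<lambda>t. f (x + t *\<^sub>R axis i 1)) has_vector_derivative
           partial_deriv i f (x + t *\<^sub>R axis i 1)) (at t)"
proof -
  from assms obtain D where D: "(f has_derivative D) (at (x + t *\<^sub>R axis i 1))"
    unfolding differentiable_def by blast
  have "((\<lambda>t::real. x + t *\<^sub>R axis i (1::real)) has_derivative (\<lambda>t. t *\<^sub>R axis i 1)) (at t)"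
    by (auto intro!: derivative_eq_intros)
  then have "((\<lambda>t. f (x + t *\<^sub>R axis i 1)) has_derivative (\<lambda>t. D (t *\<^sub>R axis i 1))) (at t)"
    using D has_derivative_compose[of "\<lambda>t. x + t *\<^sub>R axis i 1" _ t UNIV f D] by simp
  moreover have "D (t *\<^sub>R axis i 1) = t *\<^sub>R D (axis i 1)" for t
    using D by (simp add: has_derivative_def bounded_linear.linear linear_cmul)
  ultimately show ?thesis
    using partial_deriv_eq[OF D] by (simp add: has_vector_derivative_def)
qed

lemma partial_deriv_add:
  assumes "f differentiable (at x)" "g differentiable (at x)"
  shows "partial_deriv i (\<lambda>x. f x + g x) x = partial_deriv i f x + partial_deriv i g x"
proof -
  from assms obtain D E where D: "(f has_derivative D) (at x)" and E: "(g has_derivative E) (at x)"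
    unfolding differentiable_def by blast
  show ?thesis
    unfolding partial_deriv_eq[OF D] partial_deriv_eq[OF E]
      partial_deriv_eq[OF has_derivative_add[OF D E]] ..
qed

lemma partial_deriv_mult:
  assumes "f differentiable (at x)" "g differentiable (at x)"
  shows "partial_deriv i (\<lambda>x. f x * g x) x = f x * partial_deriv i g x + partial_deriv i f x * g x"
proof -
  from assms obtain D E where D: "(f has_derivative D) (at x)" and E: "(g has_derivative E) (at x)"
    unfolding differentiable_def by blast
  show ?thesis
    unfolding partial_deriv_eq[OF D] partial_deriv_eq[OF E]
      partial_deriv_eq[OF has_derivative_mult[OF D E]] ..
qed

lemma partial_deriv_cmult:
  assumes "f differentiable (at x)"
  shows "partial_deriv i (\<lambda>x. c * f x) x = c * partial_deriv i f x"
proof -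
  from assms obtain D where D: "(f has_derivative D) (at x)"
    unfolding differentiable_def by blast
  show ?thesis
    unfolding partial_deriv_eq[OF D] partial_deriv_eq[OF has_derivative_mult_right[OF D]] ..
qed

lemma partial_deriv_reflect:
  assumes "f differentiable (at (- x))"
  shows "partial_deriv i (\<lambda>x. f (- x)) x = - partial_deriv i f (- x)"
proof -
  from assms obtain D where D: "(f has_derivative D) (at (- x))"
    unfolding differentiable_def by blast
  have "((\<lambda>x. f (- x)) has_derivative (\<lambda>h. D (- h))) (at x)"
    using has_derivative_compose[of "\<lambda>x. - x" uminus x UNIV f D] D
    by (auto intro!: derivative_eq_intros)
  then have "partial_deriv i (\<lambda>x. f (- x)) x = D (- axis i 1)"
    by (rule partial_deriv_eq)
  also have "\<dots> = - D (axis i 1)"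
    using D by (simp add: has_derivative_def bounded_linear.linear linear_neg)
  finally show ?thesis using partial_deriv_eq[OF D] by simp
qed

definition rapidly_decreasing :: "(real^'n::finite \<Rightarrow> complex) \<Rightarrow> bool" where
  "rapidly_decreasing f \<longleftrightarrow> (\<forall>N. \<exists>C. \<forall>x. (1 + norm x) ^ N * norm (f x) \<le> C)"

text \<open>Since \<^const>\<open>partial_derivs\<close> iterates \<^const>\<open>partial_deriv\<close>, the Schwartz class is the largest class
  of differentiable, rapidly decreasing functions that is closed under first partial derivatives.
  Membership can therefore be proved by exhibiting any such class, so that only first derivatives
  have to be computed.\<close>

lemma schwartz_coinduct:
  assumes "f \<in> F"
    and diff: "\<And>f x. f \<in> F \<Longrightarrow> f differentiable (at x)"
    and step: "\<And>f i. f \<in> F \<Longrightarrow> partial_deriv i f \<in> F"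
    and decay: "\<And>f. f \<in> F \<Longrightarrow> rapidly_decreasing f"
  shows "f \<in> schwartz"
proof -
  have "partial_derivs \<gamma> f \<in> F" for \<gamma>
    using assms by (induction \<gamma>) (auto simp: partial_derivs_def)
  then show ?thesis
    using diff decay unfolding schwartz_def smooth_def rapidly_decreasing_def differentiable_on_def
    by (auto intro: differentiable_at_withinI)
qed

lemma schwartz_differentiable: "f \<in> schwartz \<Longrightarrow> f differentiable (at x)"
  using spec[of "\<lambda>\<gamma>. partial_derivs \<gamma> f differentiable_on UNIV" "[]"]
  by (auto simp: schwartz_def smooth_def partial_derivs_def differentiable_on_def)

lemma schwartz_continuous: "f \<in> schwartz \<Longrightarrow> continuous_on UNIV f"
  by (simp add: continuous_at_imp_continuous_on differentiable_imp_continuous_within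
      schwartz_differentiable)

lemma schwartz_measurable [measurable_dest]: "f \<in> schwartz \<Longrightarrow> f \<in> borel_measurable borel"
  by (intro borel_measurable_continuous_onI schwartz_continuous)

lemma schwartz_partial_deriv: "f \<in> schwartz \<Longrightarrow> partial_deriv i f \<in> schwartz"
proof -
  assume f: "f \<in> schwartz"
  have "partial_derivs \<gamma> (partial_deriv i f) = partial_derivs (\<gamma> @ [i]) f" for \<gamma>
    by (simp add: partial_derivs_def)
  with f show ?thesis
    unfolding schwartz_def smooth_def by simp
qed

lemma schwartz_partial_derivs: "f \<in> schwartz \<Longrightarrow> partial_derivs \<gamma> f \<in> schwartz"
  by (induction \<gamma>) (auto simp: partial_derivs_def schwartz_partial_deriv)

lemma schwartz_rapidly_decreasing: "f \<in> schwartz \<Longrightarrow> rapidly_decreasing f"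
proof -
  assume "f \<in> schwartz"
  then have "\<forall>N. \<exists>C. \<forall>x. (1 + norm x) ^ N * norm (partial_derivs [] f x) \<le> C"
    unfolding schwartz_def by blast
  then show ?thesis by (simp add: partial_derivs_def rapidly_decreasing_def)
qed

lemma rapidly_decreasing_add:
  assumes "rapidly_decreasing f" "rapidly_decreasing g"
  shows "rapidly_decreasing (\<lambda>x. f x + g x)"
  unfolding rapidly_decreasing_def
proof
  fix N
  obtain A B where A: "\<And>x. (1 + norm x) ^ N * norm (f x) \<le> A"
    and B: "\<And>x. (1 + norm x) ^ N * norm (g x) \<le> B"
    using assms unfolding rapidly_decreasing_def by blast
  have "(1 + norm x) ^ N * norm (f x + g x) \<le> A + B" for x
  proof -
    have "(1 + norm x) ^ N * norm (f x + g x) \<le> (1 + norm x) ^ N * (norm (f x) + norm (g x))"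
      by (intro mult_left_mono norm_triangle_ineq) auto
    also have "\<dots> \<le> A + B" using A[of x] B[of x] by (simp add: algebra_simps)
    finally show ?thesis .
  qed
  then show "\<exists>C. \<forall>x. (1 + norm x) ^ N * norm (f x + g x) \<le> C" by blast
qed

text \<open>A factor of polynomial growth costs finitely many powers of \<open>1 + norm x\<close>, which are
  available in any number.\<close>

lemma rapidly_decreasing_mult:
  assumes "rapidly_decreasing f" and g: "\<And>x. norm (g x) \<le> B * (1 + norm x) ^ M"
  shows "rapidly_decreasing (\<lambda>x. g x * f x)"
  unfolding rapidly_decreasing_def
proof
  fix N
  obtain A where A: "\<And>x. (1 + norm x) ^ (N + M) * norm (f x) \<le> A"
    using assms unfolding rapidly_decreasing_def by blast
  have "0 \<le> B" using order_trans[OF norm_ge_zero g[of 0]] by simp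
  have "(1 + norm x) ^ N * norm (g x * f x) \<le> B * A" for x
  proof -
    have "(1 + norm x) ^ N * norm (g x * f x) \<le> (1 + norm x) ^ N * ((B * (1 + norm x) ^ M) * norm (f x))"
      unfolding norm_mult by (intro mult_left_mono mult_right_mono g) auto
    also have "\<dots> = B * ((1 + norm x) ^ (N + M) * norm (f x))" by (simp add: power_add)
    also have "\<dots> \<le> B * A" by (intro mult_left_mono A \<open>0 \<le> B\<close>)
    finally show ?thesis .
  qed
  then show "\<exists>C. \<forall>x. (1 + norm x) ^ N * norm (g x * f x) \<le> C" by blast
qed

lemma rapidly_decreasing_reflect:
  "rapidly_decreasing f \<Longrightarrow> rapidly_decreasing (\<lambda>x. f (- x))"
  unfolding rapidly_decreasing_def by (metis norm_minus_cancel)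

lemma schwartz_add:
  assumes "f \<in> schwartz" "g \<in> schwartz"
  shows "(\<lambda>x. f x + g x) \<in> schwartz"
proof (rule schwartz_coinduct)
  show "(\<lambda>x. f x + g x) \<in> {\<lambda>x. f x + g x | f g. f \<in> schwartz \<and> g \<in> schwartz}"
    using assms by blast
next
  fix h i assume "h \<in> {\<lambda>x. f x + g x | f g. f \<in> schwartz \<and> g \<in> schwartz}"
  then obtain f g where "h = (\<lambda>x. f x + g x)" "f \<in> schwartz" "g \<in> schwartz" by blast
  moreover from this have "partial_deriv i h = (\<lambda>x. partial_deriv i f x + partial_deriv i g x)"
    by (auto simp: partial_deriv_add schwartz_differentiable)
  ultimately show "partial_deriv i h \<in> {\<lambda>x. f x + g x | f g. f \<in> schwartz \<and> g \<in> schwartz}"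
    using schwartz_partial_deriv by blast
qed (auto intro!: differentiable_add rapidly_decreasing_add
    intro: schwartz_differentiable schwartz_rapidly_decreasing)

lemma schwartz_cmult:
  assumes "f \<in> schwartz"
  shows "(\<lambda>x. c * f x) \<in> schwartz"
proof (rule schwartz_coinduct)
  show "(\<lambda>x. c * f x) \<in> {\<lambda>x. c * f x | f. f \<in> schwartz}"
    using assms by blast
next
  fix h i assume "h \<in> {\<lambda>x. c * f x | f. f \<in> schwartz}"
  then obtain f where "h = (\<lambda>x. c * f x)" "f \<in> schwartz" by blast
  moreover from this have "partial_deriv i h = (\<lambda>x. c * partial_deriv i f x)"
    by (auto simp: partial_deriv_cmult schwartz_differentiable)
  ultimately show "partial_deriv i h \<in> {\<lambda>x. c * f x | f. f \<in> schwartz}"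
    using schwartz_partial_deriv by blast
next
  fix h assume "h \<in> {\<lambda>x. c * f x | f. f \<in> schwartz}"
  then obtain f where h: "h = (\<lambda>x. c * f x)" "f \<in> schwartz" by blast
  then show "rapidly_decreasing h"
    using rapidly_decreasing_mult[of f "\<lambda>_. c" "norm c" 0] schwartz_rapidly_decreasing[of f] by simp
qed (auto intro!: differentiable_mult intro: schwartz_differentiable)

lemma schwartz_diff:
  assumes "f \<in> schwartz" "g \<in> schwartz"
  shows "(\<lambda>x. f x - g x) \<in> schwartz"
  using schwartz_add[OF assms(1) schwartz_cmult[OF assms(2), of "-1"]] by simp

lemma schwartz_reflect:
  assumes "f \<in> schwartz"
  shows "(\<lambda>x. f (- x)) \<in> schwartz"
proof (rule schwartz_coinduct)
  show "(\<lambda>x. f (- x)) \<in> {\<lambda>x. f (- x) | f. f \<in> schwartz}"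
    using assms by blast
next
  fix h i assume "h \<in> {\<lambda>x. f (- x) | f. f \<in> schwartz}"
  then obtain f where f: "h = (\<lambda>x. f (- x))" "f \<in> schwartz" by blast
  from f have "partial_deriv i h = (\<lambda>x. (\<lambda>y. -1 * partial_deriv i f y) (- x))"
    by (auto simp: partial_deriv_reflect schwartz_differentiable)
  with schwartz_cmult[OF schwartz_partial_deriv[OF f(2), of i], of "-1"]
  show "partial_deriv i h \<in> {\<lambda>x. f (- x) | f. f \<in> schwartz}"
    by (intro CollectI exI[of _ "\<lambda>y. -1 * partial_deriv i f y"]) auto
next
  fix h x assume "h \<in> {\<lambda>x. f (- x) | f. f \<in> schwartz}"
  then obtain f where h: "h = (\<lambda>x. f (- x))" "f \<in> schwartz" by blast
  from h(2) obtain D where "(f has_derivative D) (at (- x))"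
    using schwartz_differentiable unfolding differentiable_def by blast
  then have "(h has_derivative (\<lambda>y. D (- y))) (at x)"
    unfolding h(1) by (intro has_derivative_compose[of "\<lambda>x. - x" uminus x UNIV f D])
      (auto intro!: derivative_eq_intros)
  then show "h differentiable (at x)" unfolding differentiable_def by blast
qed (auto intro: rapidly_decreasing_reflect schwartz_rapidly_decreasing)

text \<open>The product rule turns one product into a sum of two, so the class that is closed under partial
  derivatives consists of the finite sums of products.\<close>

inductive_set product_sums :: "(real^'n::finite \<Rightarrow> complex) set" where
  "f \<in> schwartz \<Longrightarrow> g \<in> schwartz \<Longrightarrow> (\<lambda>x. f x * g x) \<in> product_sums"
| "f \<in> product_sums \<Longrightarrow> g \<in> product_sums \<Longrightarrow> (\<lambda>x. f x + g x) \<in> product_sums"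

lemma schwartz_bounded: "f \<in> schwartz \<Longrightarrow> \<exists>B. \<forall>x. norm (f x) \<le> B"
proof -
  assume "f \<in> schwartz"
  then have "\<exists>C. \<forall>x. (1 + norm x) ^ 0 * norm (f x) \<le> C"
    using schwartz_rapidly_decreasing unfolding rapidly_decreasing_def by blast
  then show ?thesis by simp
qed

lemma schwartz_mult:
  assumes "f \<in> schwartz" "g \<in> schwartz"
  shows "(\<lambda>x. f x * g x) \<in> schwartz"
proof -
  have diff: "h differentiable (at x)" if "h \<in> product_sums" for h x
    using that by induction (auto intro: differentiable_mult schwartz_differentiable)
  show ?thesis
  proof (rule schwartz_coinduct)
    show "(\<lambda>x. f x * g x) \<in> product_sums"
      using assms by (rule product_sums.intros)
  next
    fix h :: "real^'a \<Rightarrow> complex" and i assume "h \<in> product_sums"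
    then show "partial_deriv i h \<in> product_sums"
    proof induction
      case (1 f g)
      then have "partial_deriv i (\<lambda>x. f x * g x) =
          (\<lambda>x. f x * partial_deriv i g x + partial_deriv i f x * g x)"
        by (auto simp: partial_deriv_mult schwartz_differentiable)
      with 1 show ?case by (auto intro!: product_sums.intros schwartz_partial_deriv)
    next
      case (2 f g)
      then have "partial_deriv i (\<lambda>x. f x + g x) = (\<lambda>x. partial_deriv i f x + partial_deriv i g x)"
        by (auto simp: partial_deriv_add diff)
      with 2 show ?case by (auto intro!: product_sums.intros)
    qed
  next
    fix h :: "real^'a \<Rightarrow> complex" assume "h \<in> product_sums"
    then show "rapidly_decreasing h"
    proof induction
      case (1 f g)
      then obtain B where "\<And>x. norm (f x) \<le> B" using schwartz_bounded by blast
      with rapidly_decreasing_mult[of g f B 0] 1 show ?case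
        by (simp add: schwartz_rapidly_decreasing)
    qed (rule rapidly_decreasing_add)
  qed (rule diff)
qed

lemma coordinate_has_derivative:
  "((\<lambda>x::real^'n::finite. complex_of_real (x $ i)) has_derivative (\<lambda>h. of_real (h $ i))) (at x)"
  by (intro bounded_linear_imp_has_derivative bounded_linear_compose[OF bounded_linear_of_real
        bounded_linear_vec_nth])

lemma coordinate_differentiable:
  "(\<lambda>x::real^'n::finite. complex_of_real (x $ i)) differentiable (at x)"
  using coordinate_has_derivative unfolding differentiable_def by blast

lemma partial_deriv_coordinate:
  "partial_deriv j (\<lambda>x::real^'n::finite. complex_of_real (x $ i)) x = (if i = j then 1 else 0)"
  using partial_deriv_eq[OF coordinate_has_derivative, of j i x] by (simp add: axis_def)

lemma rapidly_decreasing_coordinate: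
  "rapidly_decreasing f \<Longrightarrow> rapidly_decreasing (\<lambda>x. of_real (x $ i) * f x)"
proof (rule rapidly_decreasing_mult[where B = 1 and M = 1])
  fix x :: "real^'a"
  have "\<bar>x $ i\<bar> \<le> norm x" by (rule component_le_norm_cart)
  then show "norm (complex_of_real (x $ i)) \<le> 1 * (1 + norm x) ^ 1" by simp
qed

text \<open>The derivative of \<open>x $ i * f x\<close> is again a coordinate times a Schwartz function plus a Schwartz
  function; the functions of this form are the closed class.\<close>

lemma schwartz_coordinate:
  assumes "f \<in> schwartz"
  shows "(\<lambda>x. of_real (x $ i) * f x) \<in> schwartz"
proof (rule schwartz_coinduct)
  define F where "F = {\<lambda>x. complex_of_real (x $ i) * f x + g x | f g. f \<in> schwartz \<and> g \<in> schwartz}"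
  have "(\<lambda>x. 0 * f x) \<in> schwartz" using assms by (rule schwartz_cmult)
  with assms show "(\<lambda>x. of_real (x $ i) * f x) \<in> F"
    unfolding F_def by (intro CollectI exI[of _ f] exI[of _ "\<lambda>x. 0 * f x"]) auto
  fix h assume "h \<in> F"
  then obtain f g where h: "h = (\<lambda>x. complex_of_real (x $ i) * f x + g x)"
    and fg: "f \<in> schwartz" "g \<in> schwartz" unfolding F_def by blast
  show "h differentiable (at x)" for x
    unfolding h using fg
    by (intro differentiable_add differentiable_mult coordinate_differentiable schwartz_differentiable)
  show "rapidly_decreasing h"
    unfolding h using fg
    by (intro rapidly_decreasing_add rapidly_decreasing_coordinate schwartz_rapidly_decreasing)
  fix j
  have "partial_deriv j h x = of_real (x $ i) * partial_deriv j f x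
      + ((if i = j then 1 else 0) * f x + partial_deriv j g x)" for x
    unfolding h using fg
    by (simp add: partial_deriv_add partial_deriv_mult partial_deriv_coordinate
        differentiable_mult coordinate_differentiable schwartz_differentiable)
  then have "partial_deriv j h = (\<lambda>x. of_real (x $ i) * partial_deriv j f x
      + ((if i = j then 1 else 0) * f x + partial_deriv j g x))" by blast
  moreover have "(\<lambda>x. (if i = j then 1 else 0) * f x + partial_deriv j g x) \<in> schwartz"
    using fg by (intro schwartz_add schwartz_cmult schwartz_partial_deriv)
  ultimately show "partial_deriv j h \<in> F"
    using schwartz_partial_deriv[OF fg(1), of j] unfolding F_def
    by (intro CollectI exI[of _ "partial_deriv j f"]
        exI[of _ "\<lambda>x. (if i = j then 1 else 0) * f x + partial_deriv j g x"] conjI)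
qed

section \<open>Lebesgue integrals on Euclidean space\<close>

lemma
  fixes f :: "'a::euclidean_space \<Rightarrow> real \<Rightarrow> 'b::{real_normed_field,banach,second_countable_topology}"
  assumes f: "\<And>b. b \<in> Basis \<Longrightarrow> integrable lborel (f b)"
  shows integrable_prod_Basis: "integrable lborel (\<lambda>x::'a. \<Prod>b\<in>Basis. f b (x \<bullet> b))" (is ?I)
    and integral_prod_Basis:
      "(\<integral>x. (\<Prod>b\<in>Basis. f b ((x::'a) \<bullet> b)) \<partial>lborel) = (\<Prod>b\<in>Basis. (\<integral>x. f b x \<partial>lborel))" (is ?E)
proof -
  interpret product_sigma_finite "\<lambda>_::'a. lborel :: real measure" by standard
  have [measurable]: "\<And>b. b \<in> Basis \<Longrightarrow> f b \<in> borel_measurable borel"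
    using f[THEN borel_measurable_integrable] by simp
  have eq: "(\<Prod>b\<in>Basis. f b ((\<Sum>b\<in>Basis. g b *\<^sub>R b) \<bullet> b)) = (\<Prod>b\<in>Basis. f b (g b))" for g :: "'a \<Rightarrow> real"
    by (intro prod.cong) auto
  show ?I
    by (subst lborel_eq, subst integrable_distr_eq)
      (auto simp: eq intro!: product_integrable_prod f)
  show ?E
    by (subst lborel_eq, subst integral_distr)
      (auto simp: eq intro!: product_integral_prod f)
qed

lemma
  fixes f :: "'a::euclidean_space \<Rightarrow> 'b::{banach, second_countable_topology}"
  assumes c: "c \<noteq> 0"
  shows integrable_affine: "integrable lborel f \<Longrightarrow> integrable lborel (\<lambda>x. f (t + c *\<^sub>R x))"
    and integral_affine: "f \<in> borel_measurable borel \<Longrightarrow>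
      (\<integral>x. f x \<partial>lborel) = \<bar>c\<bar> ^ DIM('a) *\<^sub>R (\<integral>x. f (t + c *\<^sub>R x) \<partial>lborel)"
proof -
  show "(\<integral>x. f x \<partial>lborel) = \<bar>c\<bar> ^ DIM('a) *\<^sub>R (\<integral>x. f (t + c *\<^sub>R x) \<partial>lborel)"
    if [measurable]: "f \<in> borel_measurable borel"
    by (subst lborel_affine[OF c, of t]) (simp add: integral_density integral_distr)
  assume f: "integrable lborel f"
  then have [measurable]: "f \<in> borel_measurable borel"
    using borel_measurable_integrable by fastforce
  from f have "integrable (density (distr lborel borel (\<lambda>x. t + c *\<^sub>R x)) (\<lambda>_. \<bar>c\<bar>^DIM('a))) f"
    using lborel_affine[OF c, of t] by metis
  then have "integrable lborel (\<lambda>x. \<bar>c\<bar>^DIM('a) *\<^sub>R f (t + c *\<^sub>R x))"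
    by (simp add: integrable_density integrable_distr_eq)
  then have "integrable lborel (\<lambda>x. inverse (\<bar>c\<bar>^DIM('a)) *\<^sub>R (\<bar>c\<bar>^DIM('a) *\<^sub>R f (t + c *\<^sub>R x)))"
    by (rule integrable_scaleR_right)
  moreover have "(\<lambda>x. inverse (\<bar>c\<bar>^DIM('a)) *\<^sub>R (\<bar>c\<bar>^DIM('a) *\<^sub>R f (t + c *\<^sub>R x))) =
      (\<lambda>x. f (t + c *\<^sub>R x))" using c by simp
  ultimately show "integrable lborel (\<lambda>x. f (t + c *\<^sub>R x))" by (simp only:)
qed

lemma integral_translate:
  fixes f :: "'a::euclidean_space \<Rightarrow> 'b::{banach, second_countable_topology}"
  assumes [measurable]: "f \<in> borel_measurable borel"
  shows "(\<integral>x. f (t + x) \<partial>lborel) = (\<integral>x. f x \<partial>lborel)"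
    and "(\<integral>x. f (x - t) \<partial>lborel) = (\<integral>x. f x \<partial>lborel)"
proof -
  have "(\<integral>x. f (t + x) \<partial>lborel) = \<bar>1\<bar> ^ DIM('a) *\<^sub>R (\<integral>x. f (t + 1 *\<^sub>R x) \<partial>lborel)" for t
    by simp
  also have "\<dots> t = (\<integral>x. f x \<partial>lborel)" for t
    by (rule integral_affine[symmetric]) auto
  finally have *: "(\<integral>x. f (t + x) \<partial>lborel) = (\<integral>x. f x \<partial>lborel)" for t .
  show "(\<integral>x. f (t + x) \<partial>lborel) = (\<integral>x. f x \<partial>lborel)" by (rule *)
  show "(\<integral>x. f (x - t) \<partial>lborel) = (\<integral>x. f x \<partial>lborel)" using *[of "- t"] by simp
qed

lemma integrable_pair_mult:
  fixes f :: "'a::euclidean_space \<Rightarrow> complex" and g :: "'b::euclidean_space \<Rightarrow> complex"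
  assumes f: "integrable lborel f" and g: "integrable lborel g"
  shows "integrable (lborel \<Otimes>\<^sub>M lborel) (\<lambda>(x, y). f x * g y)"
proof -
  have [measurable]: "f \<in> borel_measurable borel" "g \<in> borel_measurable borel"
    using f g by (auto dest: borel_measurable_integrable)
  show ?thesis
    using f g by (intro lborel_pair.Fubini_integrable) (auto simp: norm_mult)
qed

text \<open>An integrable majorant with explicit product structure, for all functions that decay like
  \<open>(1 + norm x) ^ (- 2 * DIM)\<close>.\<close>

definition decay_weight :: "'a::euclidean_space \<Rightarrow> real" where
  "decay_weight x = (\<Prod>b\<in>Basis. inverse (1 + (x \<bullet> b)\<^sup>2))"

lemma integrable_decay_weight: "integrable lborel (decay_weight :: 'a::euclidean_space \<Rightarrow> real)"
proof -
  have "integrable lborel (\<lambda>x::real. inverse (1 + x\<^sup>2))"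
    using integrable_inverse_1_plus_square by (simp add: set_integrable_def)
  then show ?thesis
    unfolding decay_weight_def[abs_def] by (rule integrable_prod_Basis)
qed

lemma decay_weight_measurable [measurable]: "decay_weight \<in> borel_measurable borel"
  unfolding decay_weight_def[abs_def] by measurable

lemma one_plus_square_pos: "0 < 1 + (x::real)\<^sup>2"
  by (simp add: add_pos_nonneg)

lemma decay_weight_pos: "0 < decay_weight x"
  unfolding decay_weight_def by (intro prod_pos) (simp add: one_plus_square_pos)

lemma decay_weight_bound: "1 \<le> (1 + norm x) ^ (2 * DIM('a)) * decay_weight (x::'a::euclidean_space)"
proof -
  have "(\<Prod>b\<in>(Basis::'a set). 1 + (x \<bullet> b)\<^sup>2) \<le> (\<Prod>b\<in>(Basis::'a set). (1 + norm x)\<^sup>2)"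
  proof (intro prod_mono conjI)
    fix b :: 'a assume "b \<in> Basis"
    then have "\<bar>x \<bullet> b\<bar> \<le> norm x" by (rule Basis_le_norm)
    then have "\<bar>x \<bullet> b\<bar>\<^sup>2 \<le> (norm x)\<^sup>2" by (intro power_mono) auto
    moreover have "0 \<le> norm x" by simp
    ultimately show "1 + (x \<bullet> b)\<^sup>2 \<le> (1 + norm x)\<^sup>2"
      unfolding power2_sum power2_abs by (simp add: add_increasing2)
  qed simp
  also have "\<dots> = (1 + norm x) ^ (2 * DIM('a))" by (simp add: power_mult)
  finally have "inverse (decay_weight x) \<le> (1 + norm x) ^ (2 * DIM('a))"
    by (simp add: decay_weight_def prod_inversef[symmetric])
  with decay_weight_pos[of x] show ?thesis by (simp add: field_simps)
qed

lemma le_decay_weight: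
  fixes x :: "'a::euclidean_space"
  assumes "(1 + norm x) ^ (2 * DIM('a)) * y \<le> C" "0 \<le> y"
  shows "y \<le> C * decay_weight x"
proof -
  have "y \<le> ((1 + norm x) ^ (2 * DIM('a)) * decay_weight x) * y"
    using mult_right_mono[OF decay_weight_bound[of x] assms(2)] by simp
  also have "\<dots> = ((1 + norm x) ^ (2 * DIM('a)) * y) * decay_weight x" by simp
  also have "\<dots> \<le> C * decay_weight x"
    using assms(1) decay_weight_pos[of x] by (intro mult_right_mono) auto
  finally show ?thesis .
qed

section \<open>The Gaussian\<close>

definition gaussian :: "'a::real_normed_vector \<Rightarrow> real" where
  "gaussian x = exp (- pi * (norm x)\<^sup>2)"

lemma gaussian_pos: "0 < gaussian x" by (simp add: gaussian_def)

lemma gaussian_le_1: "gaussian x \<le> 1" by (simp add: gaussian_def)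

lemma gaussian_minus: "gaussian (- x) = gaussian x" by (simp add: gaussian_def)

lemma gaussian_measurable [measurable]: "gaussian \<in> borel_measurable borel"
  unfolding gaussian_def[abs_def] by measurable

lemma gaussian_fourier_real:
  shows "integrable lborel (\<lambda>x. complex_of_real (gaussian (x::real)) * exp (- 2 * of_real pi * \<i> * of_real (x * \<xi>)))"
    and "(\<integral>x. complex_of_real (gaussian x) * exp (- 2 * of_real pi * \<i> * of_real (x * \<xi>)) \<partial>lborel)
      = of_real (gaussian \<xi>)"
proof -
  define t where "t = - sqrt (2 * pi) * \<xi>"
  let ?f = "\<lambda>x. std_normal_density x *\<^sub>R iexp (t * x)"
  have sq: "sqrt (2 * pi) \<noteq> 0" "(sqrt (2 * pi))\<^sup>2 = 2 * pi" by simp_all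
  have int: "integrable lborel ?f"
  proof (rule Bochner_Integration.integrable_bound)
    show "integrable lborel std_normal_density" using integrable_normal_density[of 1 0] by simp
    show "AE x in lborel. norm (?f x) \<le> norm (std_normal_density x)" by simp
  qed simp
  have "(\<integral>x. ?f x \<partial>lborel) = char std_normal_distribution t"
    unfolding char_def by (subst integral_density) (auto simp: normal_density_nonneg)
  then have val: "(\<integral>x. ?f x \<partial>lborel) = of_real (exp (- (t^2) / 2))"
    by (simp add: char_std_normal_distribution)
  have eq: "sqrt (2 * pi) *\<^sub>R ?f (0 + sqrt (2 * pi) * x)
      = complex_of_real (gaussian x) * exp (- 2 * of_real pi * \<i> * of_real (x * \<xi>))" for x
  proof -
    have "sqrt (2 * pi) * std_normal_density (sqrt (2 * pi) * x) = gaussian x"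
      by (simp add: std_normal_density_def gaussian_def power_mult_distrib)
    moreover have "\<i> * of_real (t * (sqrt (2 * pi) * x)) = - 2 * of_real pi * \<i> * of_real (x * \<xi>)"
    proof -
      have "t * (sqrt (2 * pi) * x) = - ((sqrt (2 * pi))\<^sup>2 * x * \<xi>)"
        by (simp add: t_def power2_eq_square algebra_simps)
      then show ?thesis unfolding sq(2) by simp
    qed
    ultimately show ?thesis
      by (simp only: scaleR_scaleR) (simp add: scaleR_conv_of_real)
  qed
  show "integrable lborel (\<lambda>x. complex_of_real (gaussian (x::real)) * exp (- 2 * of_real pi * \<i> * of_real (x * \<xi>)))"
    unfolding eq[symmetric]
    by (intro integrable_scaleR_right lborel_integrable_real_affine int sq)
  have "(\<integral>x. sqrt (2 * pi) *\<^sub>R ?f (0 + sqrt (2 * pi) * x) \<partial>lborel) = (\<integral>x. ?f x \<partial>lborel)"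
    using lborel_integral_real_affine[OF sq(1), of ?f 0]
    by (subst integral_scaleR_right) simp
  also have "\<dots> = of_real (gaussian \<xi>)"
    unfolding val by (simp add: gaussian_def t_def power_mult_distrib)
  finally show "(\<integral>x. complex_of_real (gaussian x) * exp (- 2 * of_real pi * \<i> * of_real (x * \<xi>)) \<partial>lborel)
      = of_real (gaussian \<xi>)"
    unfolding eq .
qed

lemma gaussian_prod: "gaussian (x::'a::euclidean_space) = (\<Prod>b\<in>Basis. gaussian (x \<bullet> b))"
proof -
  have "(norm x)\<^sup>2 = (\<Sum>b\<in>Basis. (x \<bullet> b)\<^sup>2)"
    by (simp add: norm_eq_sqrt_inner euclidean_inner[of x x] power2_eq_square sum_nonneg)
  then show ?thesis
    by (simp add: gaussian_def exp_sum[symmetric] sum_distrib_left sum_negf)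
qed

lemma
  fixes \<xi> :: "'a::euclidean_space"
  shows integrable_gaussian_exp:
      "integrable lborel (\<lambda>x. complex_of_real (gaussian x) * exp (- 2 * of_real pi * \<i> * of_real (x \<bullet> \<xi>)))"
    and integral_gaussian_exp:
      "(\<integral>x. complex_of_real (gaussian x) * exp (- 2 * of_real pi * \<i> * of_real (x \<bullet> \<xi>)) \<partial>lborel)
      = of_real (gaussian \<xi>)"
proof -
  let ?f = "\<lambda>b x. complex_of_real (gaussian (x::real)) * exp (- 2 * of_real pi * \<i> * of_real (x * (\<xi> \<bullet> b)))"
  have eq: "complex_of_real (gaussian x) * exp (- 2 * of_real pi * \<i> * of_real (x \<bullet> \<xi>)) =
      (\<Prod>b\<in>Basis. ?f b (x \<bullet> b))" for x
    by (subst gaussian_prod, subst euclidean_inner[of x \<xi>])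
      (simp add: prod.distrib exp_sum[symmetric] sum_distrib_left sum_negf)
  show "integrable lborel (\<lambda>x. complex_of_real (gaussian x) * exp (- 2 * of_real pi * \<i> * of_real (x \<bullet> \<xi>)))"
    unfolding eq by (intro integrable_prod_Basis gaussian_fourier_real)
  show "(\<integral>x. complex_of_real (gaussian x) * exp (- 2 * of_real pi * \<i> * of_real (x \<bullet> \<xi>)) \<partial>lborel)
      = of_real (gaussian \<xi>)"
    unfolding eq
    unfolding integral_prod_Basis[of ?f, OF gaussian_fourier_real(1)] gaussian_fourier_real(2)
    by (simp add: gaussian_prod[of \<xi>])
qed

lemma
  shows integrable_gaussian: "integrable lborel (gaussian :: 'a::euclidean_space \<Rightarrow> real)"
    and integral_gaussian: "(\<integral>x. gaussian (x::'a) \<partial>lborel) = 1"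
proof -
  have "gaussian (0::'a) = 1" by (simp add: gaussian_def)
  then have *: "integrable lborel (\<lambda>x::'a. complex_of_real (gaussian x))"
    "(\<integral>x. complex_of_real (gaussian (x::'a)) \<partial>lborel) = 1"
    using integrable_gaussian_exp[of "0::'a"] integral_gaussian_exp[of "0::'a"] by simp_all
  then show "integrable lborel (gaussian :: 'a::euclidean_space \<Rightarrow> real)"
    by (simp add: complex_of_real_integrable_eq)
  show "(\<integral>x. gaussian (x::'a) \<partial>lborel) = 1"
    using *(2) by simp
qed

text \<open>Averaging against a Gaussian of shrinking width recovers the value at a point of continuity.
  Both Fourier inversion and the uniqueness of representing functions rest on this.\<close>

lemma gaussian_average_tendsto:
  fixes f :: "'a::euclidean_space \<Rightarrow> complex"
  assumes [measurable]: "f \<in> borel_measurable borel" and bound: "\<And>x. norm (f x) \<le> B"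
    and cont: "isCont f \<xi>" and \<epsilon>: "\<epsilon> \<longlonglongrightarrow> 0"
  shows "(\<lambda>n. \<integral>w. gaussian w *\<^sub>R f (\<xi> + \<epsilon> n *\<^sub>R w) \<partial>lborel) \<longlonglongrightarrow> f \<xi>"
proof -
  have "(\<lambda>n. \<integral>w. gaussian w *\<^sub>R f (\<xi> + \<epsilon> n *\<^sub>R w) \<partial>lborel) \<longlonglongrightarrow> (\<integral>w. gaussian (w::'a) *\<^sub>R f \<xi> \<partial>lborel)"
  proof (rule integral_dominated_convergence)
    show "integrable lborel (\<lambda>w::'a. gaussian w * B)"
      by (intro integrable_mult_left integrable_gaussian)
    show "AE w in lborel. (\<lambda>n. gaussian w *\<^sub>R f (\<xi> + \<epsilon> n *\<^sub>R w)) \<longlonglongrightarrow> gaussian w *\<^sub>R f \<xi>"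
    proof (intro AE_I2 tendsto_scaleR tendsto_const)
      fix w :: 'a
      have "(\<lambda>n. \<xi> + \<epsilon> n *\<^sub>R w) \<longlonglongrightarrow> \<xi> + 0 *\<^sub>R w" by (intro tendsto_intros \<epsilon>)
      then show "(\<lambda>n. f (\<xi> + \<epsilon> n *\<^sub>R w)) \<longlonglongrightarrow> f \<xi>"
        by (intro isCont_tendsto_compose[OF cont]) simp
    qed
    show "AE w in lborel. norm (gaussian w *\<^sub>R f (\<xi> + \<epsilon> n *\<^sub>R w)) \<le> gaussian w * B" for n
      by (intro AE_I2) (simp add: bound less_imp_le[OF gaussian_pos] abs_of_pos[OF gaussian_pos]
          mult_left_mono)
  qed measurable
  moreover have "(\<integral>w. gaussian (w::'a) *\<^sub>R f \<xi> \<partial>lborel) = f \<xi>"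
    by (subst integral_scaleR_left) (simp_all add: integrable_gaussian integral_gaussian)
  ultimately show ?thesis by (simp only:)
qed

section \<open>Functions orthogonal to all Gaussians\<close>

lemma integrable_box_indicator:
  "integrable lborel (indicator (box l u) :: 'a::euclidean_space \<Rightarrow> complex)"
proof -
  have "integrable lborel (\<lambda>x. complex_of_real (indicator (box l u) (x::'a)))"
    using emeasure_lborel_box_finite[of l u]
    by (intro integrable_of_real integrable_real_indicator) auto
  then show ?thesis by (simp add: of_real_indicator)
qed

text \<open>Integrating the orthogonality relation over all centres \<open>a\<close> in a box shows that \<open>h\<close> is orthogonal
  to the Gaussian averages of the indicator of the box. These tend to the indicator away from the
  boundary of the box, which is a null set.\<close>

lemma box_integral_zero_of_gaussian:
  fixes h :: "'a::euclidean_space \<Rightarrow> complex"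
  assumes h: "integrable lborel h"
    and orth: "\<And>a \<epsilon>. 0 < \<epsilon> \<Longrightarrow> (\<integral>x. h x * of_real (gaussian ((x - a) /\<^sub>R \<epsilon>)) \<partial>lborel) = 0"
  shows "(\<integral>x. h x * indicator (box l u) x \<partial>lborel) = 0"
proof -
  have [measurable]: "h \<in> borel_measurable borel"
    using borel_measurable_integrable[OF h] by simp
  define \<epsilon> where "\<epsilon> n = 1 / real (Suc n)" for n
  have \<epsilon>: "0 < \<epsilon> n" for n by (simp add: \<epsilon>_def)
  have \<epsilon>0: "\<epsilon> \<longlonglongrightarrow> 0" unfolding \<epsilon>_def by (rule LIMSEQ_Suc[OF lim_1_over_n])
  let ?A = "indicator (box l u) :: 'a \<Rightarrow> complex"
  define \<Phi> where "\<Phi> n x = (\<integral>w. gaussian w *\<^sub>R ?A (x + \<epsilon> n *\<^sub>R w) \<partial>lborel)" for n x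
  have [measurable]: "\<Phi> n \<in> borel_measurable borel" for n
    unfolding \<Phi>_def[abs_def] by measurable
  have \<Phi>_le: "norm (\<Phi> n x) \<le> 1" for n x
  proof -
    have "norm (\<Phi> n x) \<le> (\<integral>w. gaussian (w::'a) \<partial>lborel)"
      unfolding \<Phi>_def
      by (intro order_trans[OF integral_norm_bound integral_mono'] integrable_gaussian)
        (auto simp: indicator_def gaussian_pos less_imp_le abs_of_pos)
    then show ?thesis by (simp add: integral_gaussian)
  qed
  have zero: "(\<integral>x. h x * \<Phi> n x \<partial>lborel) = 0" for n
  proof -
    let ?g = "\<lambda>x a. h x * (of_real (gaussian ((x - a) /\<^sub>R \<epsilon> n)) * ?A a)"
    have conv: "\<Phi> n x = of_real (inverse (\<epsilon> n) ^ DIM('a)) *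
        (\<integral>a. of_real (gaussian ((x - a) /\<^sub>R \<epsilon> n)) * ?A a \<partial>lborel)" for x
    proof -
      have "(\<integral>a. of_real (gaussian ((x - a) /\<^sub>R \<epsilon> n)) * ?A a \<partial>lborel) =
        \<bar>\<epsilon> n\<bar> ^ DIM('a) *\<^sub>R (\<integral>w. of_real (gaussian ((x - (x + \<epsilon> n *\<^sub>R w)) /\<^sub>R \<epsilon> n)) * ?A (x + \<epsilon> n *\<^sub>R w) \<partial>lborel)"
        using \<epsilon>[of n] by (intro integral_affine) auto
      also have "\<dots> = \<epsilon> n ^ DIM('a) *\<^sub>R \<Phi> n x"
        using \<epsilon>[of n] unfolding \<Phi>_def by (simp add: gaussian_minus scaleR_conv_of_real)
      finally show ?thesis
        using \<epsilon>[of n] by (simp add: scaleR_conv_of_real field_simps)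
    qed
    have int: "integrable (lborel \<Otimes>\<^sub>M lborel) (\<lambda>(x, a). ?g x a)"
    proof (rule Bochner_Integration.integrable_bound)
      show "integrable (lborel \<Otimes>\<^sub>M lborel) (\<lambda>(x, a). h x * ?A a)"
        by (intro integrable_pair_mult h integrable_box_indicator)
      show "AE z in lborel \<Otimes>\<^sub>M lborel. norm (case z of (x, a) \<Rightarrow> ?g x a) \<le> norm (case z of (x, a) \<Rightarrow> h x * ?A a)"
      proof (rule AE_I2, clarify)
        fix x a
        have "norm (?g x a) = norm (h x * ?A a) * gaussian ((x - a) /\<^sub>R \<epsilon> n)"
          by (simp add: norm_mult gaussian_pos less_imp_le abs_of_pos)
        also have "\<dots> \<le> norm (h x * ?A a)"
          by (intro mult_right_le_one_le gaussian_le_1 less_imp_le gaussian_pos norm_ge_zero)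
        finally show "norm (?g x a) \<le> norm (h x * ?A a)" .
      qed
    qed measurable
    have "(\<integral>x. h x * \<Phi> n x \<partial>lborel) = of_real (inverse (\<epsilon> n) ^ DIM('a)) * (\<integral>x. (\<integral>a. ?g x a \<partial>lborel) \<partial>lborel)"
    proof -
      have "h x * \<Phi> n x = of_real (inverse (\<epsilon> n) ^ DIM('a)) * (\<integral>a. ?g x a \<partial>lborel)" for x
        unfolding conv by simp
      then show ?thesis by (simp only: integral_mult_right_zero)
    qed
    also have "(\<integral>x. (\<integral>a. ?g x a \<partial>lborel) \<partial>lborel) = (\<integral>a. (\<integral>x. ?g x a \<partial>lborel) \<partial>lborel)"
      using lborel_pair.Fubini_integral[OF int] by simp
    also have "(\<lambda>a. \<integral>x. ?g x a \<partial>lborel) = (\<lambda>a. 0)"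
    proof
      fix a
      have "(\<integral>x. ?g x a \<partial>lborel) = (\<integral>x. h x * of_real (gaussian ((x - a) /\<^sub>R \<epsilon> n)) \<partial>lborel) * ?A a"
        by (simp add: mult.assoc[symmetric])
      then show "(\<integral>x. ?g x a \<partial>lborel) = 0" using orth[OF \<epsilon>] by simp
    qed
    finally show ?thesis by simp
  qed
  have "(\<lambda>n. \<integral>x. h x * \<Phi> n x \<partial>lborel) \<longlonglongrightarrow> (\<integral>x. h x * ?A x \<partial>lborel)"
  proof (rule integral_dominated_convergence)
    show "integrable lborel (\<lambda>x. norm (h x))" using h by simp
    show "AE x in lborel. norm (h x * \<Phi> n x) \<le> norm (h x)" for n
      using \<Phi>_le by (auto simp: norm_mult intro!: mult_right_le_one_le)
    have "negligible (cbox l u - box l u)" by (rule negligible_frontier_interval)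
    then have "cbox l u - box l u \<in> null_sets lborel"
      by (simp add: negligible_iff_null_sets null_sets_completion_iff)
    then have "AE x in lborel. x \<notin> cbox l u - box l u"
      by (rule AE_not_in)
    then show "AE x in lborel. (\<lambda>n. h x * \<Phi> n x) \<longlonglongrightarrow> h x * ?A x"
    proof eventually_elim
      case (elim x)
      have "isCont ?A x"
      proof (cases "x \<in> box l u")
        case True
        then have "\<forall>\<^sub>F y in nhds x. y \<in> box l u" by (intro eventually_nhds_in_open) auto
        then have "\<forall>\<^sub>F y in nhds x. ?A y = 1" by eventually_elim simp
        then show ?thesis using isCont_cong[of ?A "\<lambda>_. 1" x] by simp
      next
        case False
        with elim have "x \<in> - cbox l u" by blast
        then have "\<forall>\<^sub>F y in nhds x. y \<in> - cbox l u" by (intro eventually_nhds_in_open) auto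
        then have "\<forall>\<^sub>F y in nhds x. ?A y = 0"
          by eventually_elim (use box_subset_cbox in \<open>auto simp: indicator_def\<close>)
        then show ?thesis using isCont_cong[of ?A "\<lambda>_. 0" x] by simp
      qed
      moreover have "norm (?A y) \<le> 1" for y by (simp add: indicator_def)
      ultimately show ?case
        unfolding \<Phi>_def
        by (intro tendsto_mult tendsto_const gaussian_average_tendsto[where B = 1] \<epsilon>0) auto
    qed
  qed measurable
  then show ?thesis unfolding zero by (simp add: LIMSEQ_const_iff)
qed

text \<open>The boxes are closed under intersection and generate the Borel sets, so by Dynkin's theorem all
  integrals of \<open>h\<close> over Borel sets vanish.\<close>

lemma AE_zero_of_box_integrals:
  fixes h :: "'a::euclidean_space \<Rightarrow> complex"
  assumes h: "integrable lborel h"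
    and box: "\<And>l u. (\<integral>x. h x * indicator (box l u) x \<partial>lborel) = 0"
  shows "AE x in lborel. h x = 0"
proof (rule sigma_finite_measure.density_zero[OF sigma_finite_lborel h])
  have [measurable]: "h \<in> borel_measurable borel"
    using borel_measurable_integrable[OF h] by simp
  have le: "AE x in lborel. norm (h x * indicator A x) \<le> norm (h x)" for A
    by (intro AE_I2) (simp add: norm_mult indicator_def)
  have set: "integrable lborel (\<lambda>x. h x * indicator A x)" if [measurable]: "A \<in> sets borel" for A
    by (rule Bochner_Integration.integrable_bound[OF h _ le]) measurable
  let ?E = "range (\<lambda>(l, u). box l u) :: 'a set set"
  have sets: "sets borel = sigma_sets UNIV ?E"
    by (subst borel_eq_box) simp
  have whole: "(\<integral>x. h x \<partial>lborel) = 0"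
  proof -
    have "(\<lambda>n::nat. \<integral>x. h x * indicator (box (- real n *\<^sub>R One) (real n *\<^sub>R One)) x \<partial>lborel)
        \<longlonglongrightarrow> (\<integral>x. h x \<partial>lborel)"
    proof (rule integral_dominated_convergence)
      show "integrable lborel (\<lambda>x. norm (h x))" using h by simp
      show "AE x in lborel. norm (h x * indicator (box (- real n *\<^sub>R One) (real n *\<^sub>R One)) x) \<le> norm (h x)" for n
        by (rule le)
      show "AE x in lborel. (\<lambda>n. h x * indicator (box (- real n *\<^sub>R One) (real n *\<^sub>R One)) x) \<longlonglongrightarrow> h x"
      proof (rule AE_I2)
        fix x :: 'a
        have "\<forall>\<^sub>F n in sequentially. norm x < real n"
          using filterlim_at_top_dense filterlim_real_sequentially by blast
        then have "\<forall>\<^sub>F n in sequentially. h x * indicator (box (- real n *\<^sub>R One) (real n *\<^sub>R One)) x = h x"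
        proof eventually_elim
          case (elim n)
          have "\<bar>x \<bullet> b\<bar> < real n" if "b \<in> Basis" for b
            using Basis_le_norm[OF that, of x] elim by simp
          then have "x \<in> box (- real n *\<^sub>R One) (real n *\<^sub>R One)"
            by (force simp: mem_box abs_less_iff)
          then show ?case by simp
        qed
        then show "(\<lambda>n. h x * indicator (box (- real n *\<^sub>R One) (real n *\<^sub>R One)) x) \<longlonglongrightarrow> h x"
          by (rule tendsto_eventually)
      qed
    qed measurable
    then show ?thesis unfolding box by (simp add: LIMSEQ_const_iff)
  qed
  have stable: "Int_stable ?E" "?E \<subseteq> Pow UNIV" by (auto simp: Int_stable_def box_Int_box)
  have zero: "(\<integral>x. h x * indicator A x \<partial>lborel) = 0" if "A \<in> sigma_sets UNIV ?E" for A
    using stable that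
  proof (induction A rule: sigma_sets_induct_disjoint)
    case (basic A)
    then show ?case using box by auto
  next
    case empty
    then show ?case by simp
  next
    case (compl A)
    then have "A \<in> sets borel" using sets by simp
    have "(\<lambda>x. h x * indicator (UNIV - A) x) = (\<lambda>x. h x - h x * indicator A x)"
      by (auto simp: indicator_def)
    then show ?case using compl whole set[OF \<open>A \<in> sets borel\<close>] h by simp
  next
    case (union A)
    then have A [measurable]: "A i \<in> sets borel" for i using sets by auto
    have "(\<lambda>n. \<integral>x. h x * indicator (\<Union>i<n. A i) x \<partial>lborel) \<longlonglongrightarrow> (\<integral>x. h x * indicator (\<Union>i. A i) x \<partial>lborel)"
    proof (rule integral_dominated_convergence)
      show "integrable lborel (\<lambda>x. norm (h x))" using h by simp
      show "AE x in lborel. norm (h x * indicator (\<Union>i<n. A i) x) \<le> norm (h x)" for n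
        by (rule le)
      show "AE x in lborel. (\<lambda>n. h x * indicator (\<Union>i<n. A i) x) \<longlonglongrightarrow> h x * indicator (\<Union>i. A i) x"
        by (intro AE_I2 tendsto_mult tendsto_const LIMSEQ_indicator_UN)
    qed measurable
    moreover have "(\<integral>x. h x * indicator (\<Union>i<n. A i) x \<partial>lborel) = 0" for n
    proof -
      have "indicator (\<Union>i<n. A i) x = (\<Sum>i<n. indicator (A i) x :: complex)" for x
        using union(1) by (intro indicator_UN_disjoint) (auto simp: disjoint_family_on_def)
      then have "h x * indicator (\<Union>i<n. A i) x = (\<Sum>i<n. h x * indicator (A i) x)" for x
        by (simp only: sum_distrib_left)
      then show ?thesis
        by (simp only: Bochner_Integration.integral_sum[OF set[OF A]] union(3) sum.neutral_const)
    qed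
    ultimately show ?case by (simp only: LIMSEQ_const_iff)
  qed
  fix A :: "'a set" assume "A \<in> sets lborel"
  then have "A \<in> sigma_sets UNIV ?E" using sets by simp
  note zero[OF this]
  moreover have "indicator A x *\<^sub>R h x = h x * indicator A x" for x
    by (simp add: indicator_def)
  ultimately show "set_lebesgue_integral lborel A h = 0"
    by (simp only: set_lebesgue_integral_def)
qed

section \<open>The Fourier transform on Schwartz functions\<close>

text \<open>The character of \<open>\<real>\<close> in the normalisation of \<^const>\<open>fourier\<close>.\<close>

definition phase :: "real \<Rightarrow> complex" where
  "phase r = exp (2 * of_real pi * \<i> * of_real r)"

lemma phase_cis: "phase r = cis (2 * pi * r)"
  unfolding phase_def cis_conv_exp by (simp add: mult.commute mult.left_commute)

lemma norm_phase [simp]: "norm (phase r) = 1"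
  by (simp add: phase_cis)

lemma phase_0 [simp]: "phase 0 = 1"
  by (simp add: phase_def)

lemma phase_add: "phase (r + s) = phase r * phase s"
  by (simp add: phase_cis cis_mult distrib_left)

lemma phase_diff: "phase (r - s) = phase r * phase (- s)"
  using phase_add[of r "- s"] by simp

lemma phase_measurable [measurable]: "phase \<in> borel_measurable borel"
  unfolding phase_def[abs_def] by measurable

lemma fourier_eq: "fourier f \<xi> = (\<integral>x. f x * phase (- (x \<bullet> \<xi>)) \<partial>lborel)"
  by (simp add: fourier_def phase_def)

lemma inv_fourier_eq: "inv_fourier f x = (\<integral>\<xi>. f \<xi> * phase (x \<bullet> \<xi>) \<partial>lborel)"
  by (simp add: inv_fourier_def phase_def)

lemma inv_fourier_fourier_reflect: "inv_fourier f x = fourier f (- x)"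
  by (simp add: inv_fourier_eq fourier_eq inner_commute)

lemma fourier_measurable [measurable (raw)]:
  assumes [measurable]: "f \<in> borel_measurable borel"
  shows "fourier f \<in> borel_measurable borel"
  unfolding fourier_eq[abs_def] by measurable

lemma integrable_mult_phase:
  assumes f: "integrable lborel f" and [measurable]: "g \<in> borel_measurable lborel"
  shows "integrable lborel (\<lambda>x. f x * phase (g x))"
  using borel_measurable_integrable[OF f]
  by (intro Bochner_Integration.integrable_bound[OF f]) (auto simp: norm_mult)

lemma norm_fourier_le: "norm (fourier f \<xi>) \<le> (\<integral>x. norm (f x) \<partial>lborel)"
  unfolding fourier_eq
  using integral_norm_bound[of lborel "\<lambda>x. f x * phase (- (x \<bullet> \<xi>))"] by (simp add: norm_mult)

lemma rapidly_decreasing_decay: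
  fixes f :: "real^'n::finite \<Rightarrow> complex"
  assumes "rapidly_decreasing f"
  shows "\<exists>C. \<forall>x. norm (f x) \<le> C * decay_weight x"
proof -
  from assms obtain C where "\<And>x. (1 + norm x) ^ (2 * DIM(real^'n)) * norm (f x) \<le> C"
    unfolding rapidly_decreasing_def by blast
  then have "\<And>x. norm (f x) \<le> C * decay_weight x" by (intro le_decay_weight) auto
  then show ?thesis by blast
qed

lemma rapidly_decreasing_integrable:
  fixes f :: "real^'n::finite \<Rightarrow> complex"
  assumes f: "rapidly_decreasing f" and [measurable]: "f \<in> borel_measurable borel"
  shows "integrable lborel f"
proof -
  from f obtain C where C: "\<And>x. norm (f x) \<le> C * decay_weight x"
    using rapidly_decreasing_decay by blast
  show ?thesis
  proof (rule Bochner_Integration.integrable_bound)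
    show "integrable lborel (\<lambda>x::real^'n. C * decay_weight x)"
      by (intro integrable_mult_right integrable_decay_weight)
    show "AE x in lborel. norm (f x) \<le> norm (C * decay_weight x)"
      using C by (auto intro: order_trans[OF _ abs_ge_self])
  qed measurable
qed

lemma schwartz_integrable: "f \<in> schwartz \<Longrightarrow> integrable lborel f"
  by (simp add: rapidly_decreasing_integrable schwartz_rapidly_decreasing schwartz_measurable)

lemma phase_second_order: "norm (phase (- s) - 1 + 2 * of_real pi * \<i> * of_real s) \<le> (2 * pi * s)\<^sup>2 / 2"
proof -
  have "phase (- s) = iexp (- (2 * pi * s))"
    by (simp add: phase_def algebra_simps)
  then show ?thesis
    using iexp_approx1[of "- (2 * pi * s)" 1] by (simp add: algebra_simps power2_eq_square numeral_2_eq_2)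
qed

text \<open>Differentiating under the integral sign. The second-order Taylor remainder of the phase gives
  the full derivative directly, with error at most a constant times \<open>(norm h)\<^sup>2\<close>.\<close>

lemma fourier_has_derivative:
  fixes f :: "real^'n::finite \<Rightarrow> complex"
  assumes f: "f \<in> schwartz"
  shows "(fourier f has_derivative
    (\<lambda>h. \<Sum>i\<in>UNIV. of_real (h $ i) * fourier (\<lambda>x. (- 2 * of_real pi * \<i>) * (of_real (x $ i) * f x)) \<xi>)) (at \<xi>)"
    (is "(_ has_derivative ?D) _")
proof -
  have [measurable]: "f \<in> borel_measurable borel" using f by (rule schwartz_measurable)
  have int_f: "integrable lborel f" using f by (rule schwartz_integrable)
  have int_c: "integrable lborel (\<lambda>x. (- 2 * of_real pi * \<i>) * (of_real (x $ i) * f x))" for i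
    by (intro schwartz_integrable schwartz_cmult schwartz_coordinate f)
  have "rapidly_decreasing (\<lambda>x. complex_of_real ((1 + norm x)\<^sup>2) * f x)"
    by (rule rapidly_decreasing_mult[where B = 1 and M = 2])
      (simp_all only: schwartz_rapidly_decreasing[OF f] norm_of_real, simp)
  then have "integrable lborel (\<lambda>x. complex_of_real ((1 + norm x)\<^sup>2) * f x)"
    by (rule rapidly_decreasing_integrable) measurable
  then have "integrable lborel (\<lambda>x. norm (complex_of_real ((1 + norm x)\<^sup>2) * f x))"
    by (rule integrable_norm)
  then have int2: "integrable lborel (\<lambda>x. (1 + norm x)\<^sup>2 * norm (f x))"
    by (simp only: norm_mult norm_of_real abs_power2)
  define M where "M = (\<integral>x. (2 * pi\<^sup>2) * ((1 + norm x)\<^sup>2 * norm (f x)) \<partial>lborel)"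
  have D: "?D h = (\<integral>x. f x * phase (- (x \<bullet> \<xi>)) * (- 2 * of_real pi * \<i> * of_real (x \<bullet> h)) \<partial>lborel)"
    and int_D: "integrable lborel (\<lambda>x. f x * phase (- (x \<bullet> \<xi>)) * (- 2 * of_real pi * \<i> * of_real (x \<bullet> h)))" for h
  proof -
    have eq: "f x * phase (- (x \<bullet> \<xi>)) * (- 2 * of_real pi * \<i> * of_real (x \<bullet> h)) =
      (\<Sum>i\<in>UNIV. of_real (h $ i) * (((- 2 * of_real pi * \<i>) * (of_real (x $ i) * f x)) * phase (- (x \<bullet> \<xi>))))" for x
      unfolding inner_vec_def[of x h] by (simp add: sum_distrib_left sum_negf ac_simps)
    have int_i: "integrable lborel (\<lambda>x. of_real (h $ i) *
        (((- 2 * of_real pi * \<i>) * (of_real (x $ i) * f x)) * phase (- (x \<bullet> \<xi>))))" for i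
      by (rule integrable_mult_right, rule integrable_mult_phase, rule int_c, measurable)
    show "integrable lborel (\<lambda>x. f x * phase (- (x \<bullet> \<xi>)) * (- 2 * of_real pi * \<i> * of_real (x \<bullet> h)))"
      unfolding eq by (rule Bochner_Integration.integrable_sum[OF int_i])
    show "?D h = (\<integral>x. f x * phase (- (x \<bullet> \<xi>)) * (- 2 * of_real pi * \<i> * of_real (x \<bullet> h)) \<partial>lborel)"
      unfolding eq fourier_eq
      by (subst Bochner_Integration.integral_sum[OF int_i]) (simp only: integral_mult_right_zero)
  qed
  have rem: "norm (fourier f (\<xi> + h) - fourier f \<xi> - ?D h) \<le> M * (norm h)\<^sup>2" for h
  proof -
    let ?r = "\<lambda>x. f x * phase (- (x \<bullet> \<xi>)) * (phase (- (x \<bullet> h)) - 1 + 2 * of_real pi * \<i> * of_real (x \<bullet> h))"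
    have r: "?r x = f x * phase (- (x \<bullet> (\<xi> + h))) - f x * phase (- (x \<bullet> \<xi>))
        - f x * phase (- (x \<bullet> \<xi>)) * (- 2 * of_real pi * \<i> * of_real (x \<bullet> h))" for x
      by (simp add: inner_add_right phase_diff[of "- (x \<bullet> \<xi>)"] algebra_simps)
    have int_p: "integrable lborel (\<lambda>x. f x * phase (- (x \<bullet> \<zeta>)))" for \<zeta>
      using int_f by (rule integrable_mult_phase) measurable
    have "fourier f (\<xi> + h) - fourier f \<xi> - ?D h = (\<integral>x. ?r x \<partial>lborel)"
      unfolding D r by (simp only: fourier_eq int_D
          Bochner_Integration.integral_diff Bochner_Integration.integrable_diff int_p)
    also have "norm \<dots> \<le> (\<integral>x. (norm h)\<^sup>2 * ((2 * pi\<^sup>2) * ((1 + norm x)\<^sup>2 * norm (f x))) \<partial>lborel)"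
    proof (intro order_trans[OF integral_norm_bound integral_mono'] integrable_mult_right int2)
      fix x
      have "norm (?r x) \<le> norm (f x) * ((2 * pi * (x \<bullet> h))\<^sup>2 / 2)"
        unfolding norm_mult norm_phase mult_1_right
        by (intro mult_left_mono phase_second_order norm_ge_zero)
      also have "(2 * pi * (x \<bullet> h))\<^sup>2 / 2 = (2 * pi\<^sup>2) * (x \<bullet> h)\<^sup>2"
        by (simp add: power_mult_distrib)
      also have "norm (f x) * \<dots> \<le> norm (f x) * ((2 * pi\<^sup>2) * ((1 + norm x)\<^sup>2 * (norm h)\<^sup>2))"
      proof (intro mult_left_mono)
        have "\<bar>x \<bullet> h\<bar> \<le> norm x * norm h" by (rule Cauchy_Schwarz_ineq2)
        also have "\<dots> \<le> (1 + norm x) * norm h" by (intro mult_right_mono) auto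
        finally have "\<bar>x \<bullet> h\<bar>\<^sup>2 \<le> ((1 + norm x) * norm h)\<^sup>2" by (intro power_mono) auto
        then show "(x \<bullet> h)\<^sup>2 \<le> (1 + norm x)\<^sup>2 * (norm h)\<^sup>2" by (simp add: power_mult_distrib)
      qed auto
      finally show "norm (?r x) \<le> (norm h)\<^sup>2 * ((2 * pi\<^sup>2) * ((1 + norm x)\<^sup>2 * norm (f x)))"
        by (simp only: ac_simps)
    qed auto
    also have "\<dots> = M * (norm h)\<^sup>2" unfolding M_def by (simp add: mult.commute)
    finally show ?thesis .
  qed
  show ?thesis
    unfolding has_derivative_at
  proof (intro conjI)
    show "bounded_linear ?D"
      by (intro bounded_linear_sum bounded_linear_mult_const bounded_linear_compose[OF bounded_linear_of_real]
          bounded_linear_vec_nth)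
    show "(\<lambda>h. norm (fourier f (\<xi> + h) - fourier f \<xi> - ?D h) / norm h) \<midarrow>0\<rightarrow> 0"
    proof (rule Lim_null_comparison)
      show "\<forall>\<^sub>F h in at 0. norm (norm (fourier f (\<xi> + h) - fourier f \<xi> - ?D h) / norm h) \<le> M * norm h"
        using rem by (intro always_eventually allI) (auto simp: field_simps power2_eq_square divide_le_eq)
      show "((\<lambda>h::real^'n. M * norm h) \<longlongrightarrow> 0) (at 0)"
        by (intro tendsto_mult_right_zero tendsto_norm_zero tendsto_ident_at)
    qed
  qed
qed

lemma partial_deriv_fourier:
  assumes "f \<in> schwartz"
  shows "partial_deriv i (fourier f) = fourier (\<lambda>x. (- 2 * of_real pi * \<i>) * (of_real (x $ i) * f x))"
proof
  fix \<xi>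
  have "partial_deriv i (fourier f) \<xi> = (\<Sum>j\<in>UNIV. of_real (axis i 1 $ j) *
      fourier (\<lambda>x. (- 2 * of_real pi * \<i>) * (of_real (x $ j) * f x)) \<xi>)"
    by (rule partial_deriv_eq[OF fourier_has_derivative[OF assms]])
  also have "\<dots> = (\<Sum>j\<in>UNIV. if j = i then
      fourier (\<lambda>x. (- 2 * of_real pi * \<i>) * (of_real (x $ j) * f x)) \<xi> else 0)"
    by (intro sum.cong) (auto simp: axis_def)
  finally show "partial_deriv i (fourier f) \<xi> = fourier (\<lambda>x. (- 2 * of_real pi * \<i>) * (of_real (x $ i) * f x)) \<xi>"
    by simp
qed

text \<open>By translation invariance every difference quotient of \<open>F\<close> in a coordinate direction integrates to
  zero. The decay of the derivative survives a shift by at most one unit up to a constant, so it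
  dominates all quotients with step at most one and the limit can be taken under the integral.\<close>

lemma integral_partial_deriv_eq_0:
  fixes F :: "real^'n::finite \<Rightarrow> complex"
  assumes diff: "\<And>x. F differentiable (at x)"
    and F: "rapidly_decreasing F" and F': "rapidly_decreasing (partial_deriv i F)"
    and [measurable]: "partial_deriv i F \<in> borel_measurable borel"
  shows "(\<integral>x. partial_deriv i F x \<partial>lborel) = 0"
proof -
  define N where "N = 2 * DIM(real^'n)"
  have "continuous_on UNIV F"
    by (simp add: continuous_at_imp_continuous_on differentiable_imp_continuous_within diff)
  then have [measurable]: "F \<in> borel_measurable borel" by (rule borel_measurable_continuous_onI)
  have int: "integrable lborel F" using F by (rule rapidly_decreasing_integrable) measurable
  from F' obtain C where C: "\<And>x. (1 + norm x) ^ N * norm (partial_deriv i F x) \<le> C"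
    unfolding rapidly_decreasing_def by blast
  define t where "t n = 1 / real (Suc n)" for n
  have t: "0 < t n" "t n \<le> 1" for n by (simp_all add: t_def)
  have t0: "t \<longlonglongrightarrow> 0" unfolding t_def by (rule LIMSEQ_Suc[OF lim_1_over_n])
  let ?e = "axis i 1 :: real^'n"
  define s where "s n x = inverse (t n) *\<^sub>R (F (x + t n *\<^sub>R ?e) - F x)" for n x
  have zero: "(\<integral>x. s n x \<partial>lborel) = 0" for n
  proof -
    have "integrable lborel (\<lambda>x. F (t n *\<^sub>R ?e + 1 *\<^sub>R x))"
      by (rule integrable_affine[OF _ int]) simp
    then have "(\<integral>x. F (x + t n *\<^sub>R ?e) - F x \<partial>lborel) = (\<integral>x. F (t n *\<^sub>R ?e + x) \<partial>lborel) - (\<integral>x. F x \<partial>lborel)"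
      using int by (subst Bochner_Integration.integral_diff) (auto simp: add.commute)
    also have "\<dots> = 0" by (simp add: integral_translate)
    finally show ?thesis unfolding s_def by simp
  qed
  have bound: "norm (s n x) \<le> (2 ^ N * C) * decay_weight x" for n x
  proof -
    have along: "((\<lambda>u. F (x + u *\<^sub>R ?e)) has_derivative (\<lambda>h. h *\<^sub>R partial_deriv i F (x + u *\<^sub>R ?e)))
        (at u within {0..t n})" for u
      using partial_deriv_along[OF diff] unfolding has_vector_derivative_def
      by (rule has_derivative_at_withinI)
    have le: "(1 + norm x) ^ N * norm (partial_deriv i F (x + u *\<^sub>R ?e)) \<le> 2 ^ N * C"
      if "u \<in> {0..t n}" for u
    proof -
      have "norm x \<le> norm (x + u *\<^sub>R ?e) + norm (u *\<^sub>R ?e)"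
        using norm_triangle_ineq4[of "x + u *\<^sub>R ?e" "u *\<^sub>R ?e"] by simp
      moreover have "norm (u *\<^sub>R ?e) \<le> 1" using that t[of n] by (simp add: norm_axis_1)
      ultimately have "1 + norm x \<le> 2 * (1 + norm (x + u *\<^sub>R ?e))"
        using norm_ge_zero[of "x + u *\<^sub>R ?e"] unfolding distrib_left by linarith
      then have "(1 + norm x) ^ N \<le> (2 * (1 + norm (x + u *\<^sub>R ?e))) ^ N"
        by (intro power_mono) auto
      then have "(1 + norm x) ^ N * norm (partial_deriv i F (x + u *\<^sub>R ?e)) \<le>
         2 ^ N * ((1 + norm (x + u *\<^sub>R ?e)) ^ N * norm (partial_deriv i F (x + u *\<^sub>R ?e)))"
        unfolding mult.assoc[symmetric] power_mult_distrib[symmetric]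
        by (rule mult_right_mono) simp
      also have "\<dots> \<le> 2 ^ N * C" by (intro mult_left_mono C) auto
      finally show ?thesis .
    qed
    define B where "B = (2 ^ N * C) / (1 + norm x) ^ N"
    have pos: "0 < (1 + norm x) ^ N" by (simp add: add_pos_nonneg)
    have "norm (F (x + t n *\<^sub>R ?e) - F (x + 0 *\<^sub>R ?e)) \<le> B * norm (t n - 0)"
    proof (rule differentiable_bound[where S = "{0..t n}" and f = "\<lambda>u. F (x + u *\<^sub>R ?e)"])
      fix u assume u: "u \<in> {0..t n}"
      show "onorm (\<lambda>h. h *\<^sub>R partial_deriv i F (x + u *\<^sub>R ?e)) \<le> B"
      proof (rule onorm_le)
        fix h :: real
        have "norm (partial_deriv i F (x + u *\<^sub>R ?e)) \<le> B"
          using le[OF u] pos by (simp add: B_def field_simps)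
        then show "norm (h *\<^sub>R partial_deriv i F (x + u *\<^sub>R ?e)) \<le> B * norm h"
          by (simp add: mult.commute[of B] mult_left_mono)
      qed
    qed (use along t[of n] in auto)
    moreover have "norm (s n x) = norm (F (x + t n *\<^sub>R ?e) - F x) / t n"
      using t(1)[of n] by (simp add: s_def divide_inverse mult.commute)
    ultimately have "norm (s n x) \<le> B"
      using t(1)[of n] by (simp add: pos_divide_le_eq)
    then have "(1 + norm x) ^ N * norm (s n x) \<le> 2 ^ N * C"
      using pos by (simp add: B_def field_simps)
    then show ?thesis unfolding N_def by (rule le_decay_weight) simp
  qed
  have "(\<lambda>n. \<integral>x. s n x \<partial>lborel) \<longlonglongrightarrow> (\<integral>x. partial_deriv i F x \<partial>lborel)"
  proof (rule integral_dominated_convergence)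
    show "integrable lborel (\<lambda>x::real^'n. (2 ^ N * C) * decay_weight x)"
      by (intro integrable_mult_right integrable_decay_weight)
    show "AE x in lborel. (\<lambda>n. s n x) \<longlonglongrightarrow> partial_deriv i F x"
    proof (rule AE_I2)
      fix x
      have "((\<lambda>u. F (x + u *\<^sub>R ?e)) has_vector_derivative partial_deriv i F x) (at 0)"
        using partial_deriv_along[of F x 0 i] diff by simp
      then have "((\<lambda>u. norm (F (x + u *\<^sub>R ?e) - F x - u *\<^sub>R partial_deriv i F x) / norm u) \<longlongrightarrow> 0) (at 0)"
        by (simp add: has_vector_derivative_def has_derivative_at)
      moreover have "\<forall>\<^sub>F u in at 0. norm (F (x + u *\<^sub>R ?e) - F x - u *\<^sub>R partial_deriv i F x) / norm u =
          norm (inverse u *\<^sub>R (F (x + u *\<^sub>R ?e) - F x) - partial_deriv i F x)"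
      proof (rule eventually_at_topological[THEN iffD2], intro exI[of _ UNIV] conjI ballI impI)
        fix u :: real assume u: "u \<noteq> 0"
        have "inverse u *\<^sub>R (F (x + u *\<^sub>R ?e) - F x) - partial_deriv i F x =
            inverse u *\<^sub>R (F (x + u *\<^sub>R ?e) - F x - u *\<^sub>R partial_deriv i F x)"
          using u by (simp add: scaleR_diff_right)
        then show "norm (F (x + u *\<^sub>R ?e) - F x - u *\<^sub>R partial_deriv i F x) / norm u =
          norm (inverse u *\<^sub>R (F (x + u *\<^sub>R ?e) - F x) - partial_deriv i F x)"
          by (simp only: norm_scaleR) (simp add: divide_inverse mult.commute)
      qed auto
      ultimately have "((\<lambda>u. norm (inverse u *\<^sub>R (F (x + u *\<^sub>R ?e) - F x) - partial_deriv i F x)) \<longlongrightarrow> 0) (at 0)"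
        by (rule Lim_transform_eventually)
      then have "((\<lambda>u. inverse u *\<^sub>R (F (x + u *\<^sub>R ?e) - F x)) \<longlongrightarrow> partial_deriv i F x) (at 0)"
        by (rule LIM_zero_cancel[OF tendsto_norm_zero_cancel])
      moreover have "filterlim t (at 0) sequentially"
        using t0 t(1) by (auto simp: filterlim_at intro!: always_eventually less_imp_neq[symmetric])
      ultimately show "(\<lambda>n. s n x) \<longlonglongrightarrow> partial_deriv i F x"
        unfolding s_def by (rule filterlim_compose)
    qed
    show "AE x in lborel. norm (s n x) \<le> (2 ^ N * C) * decay_weight x" for n
      using bound by (intro AE_I2)
  qed (unfold s_def, measurable)
  then show ?thesis unfolding zero by (simp add: LIMSEQ_const_iff)
qed

lemma phase_has_derivative:
  "((\<lambda>x. phase (- (x \<bullet> \<xi>))) has_derivative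
     (\<lambda>h. - 2 * of_real pi * \<i> * of_real (h \<bullet> \<xi>) * phase (- (x \<bullet> \<xi>)))) (at x)"
proof -
  have "((\<lambda>x. 2 * of_real pi * \<i> * complex_of_real (- (x \<bullet> \<xi>))) has_derivative
      (\<lambda>h. 2 * of_real pi * \<i> * complex_of_real (- (h \<bullet> \<xi>)))) (at x)"
    by (intro has_derivative_mult_right has_derivative_of_real has_derivative_minus
        has_derivative_inner_left has_derivative_ident)
  note has_derivative_compose[OF this DERIV_exp[unfolded has_field_derivative_def]]
  then have "((\<lambda>x. exp (2 * of_real pi * \<i> * complex_of_real (- (x \<bullet> \<xi>)))) has_derivative
      (\<lambda>h. (2 * of_real pi * \<i> * complex_of_real (- (h \<bullet> \<xi>))) *
         exp (2 * of_real pi * \<i> * complex_of_real (- (x \<bullet> \<xi>))))) (at x)"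
    by (rule has_derivative_eq_rhs) (rule ext, rule mult.commute)
  then show ?thesis unfolding phase_def by simp
qed

text \<open>Integration by parts: the integral of the partial derivative of \<open>phase (- (x \<bullet> \<xi>)) * f x\<close> is zero.\<close>

lemma fourier_partial_deriv:
  fixes f :: "real^'n::finite \<Rightarrow> complex"
  assumes f: "f \<in> schwartz"
  shows "fourier (partial_deriv i f) \<xi> = 2 * of_real pi * \<i> * of_real (\<xi> $ i) * fourier f \<xi>"
proof -
  let ?p = "\<lambda>x::real^'n. phase (- (x \<bullet> \<xi>))"
  let ?F = "\<lambda>x. ?p x * f x"
  note f' = schwartz_partial_deriv[OF f, of i]
  have [measurable]: "f \<in> borel_measurable borel" "partial_deriv i f \<in> borel_measurable borel"
    using f f' by (auto intro: schwartz_measurable)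
  have p_diff: "?p differentiable (at x)" for x
    using phase_has_derivative unfolding differentiable_def by blast
  have p': "partial_deriv i ?p x = - 2 * of_real pi * \<i> * of_real (\<xi> $ i) * ?p x" for x
    by (subst partial_deriv_eq[OF phase_has_derivative]) (simp add: inner_axis' )
  have F': "partial_deriv i ?F = (\<lambda>x. ?p x * partial_deriv i f x +
      ?p x * (- 2 * of_real pi * \<i> * of_real (\<xi> $ i) * f x))"
    by (rule ext, subst partial_deriv_mult) (auto simp: p_diff schwartz_differentiable f p')
  have rapid: "rapidly_decreasing (\<lambda>x. ?p x * g x)" if "g \<in> schwartz" for g
    using rapidly_decreasing_mult[OF schwartz_rapidly_decreasing[OF that], of ?p 1 0] by simp
  have cf: "(\<lambda>x. - 2 * of_real pi * \<i> * of_real (\<xi> $ i) * f x) \<in> schwartz"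
    by (rule schwartz_cmult[OF f])
  have "(\<integral>x. partial_deriv i ?F x \<partial>lborel) = 0"
  proof (rule integral_partial_deriv_eq_0)
    show "?F differentiable (at x)" for x
      by (intro differentiable_mult p_diff schwartz_differentiable f)
    show "rapidly_decreasing ?F" using f by (rule rapid)
    show "rapidly_decreasing (partial_deriv i ?F)"
      unfolding F' by (intro rapidly_decreasing_add rapid f' cf)
    show "partial_deriv i ?F \<in> borel_measurable borel"
      unfolding F' by measurable
  qed
  also have "(\<integral>x. partial_deriv i ?F x \<partial>lborel) =
      fourier (partial_deriv i f) \<xi> + (- 2 * of_real pi * \<i> * of_real (\<xi> $ i)) * fourier f \<xi>"
  proof -
    have int: "integrable lborel (\<lambda>x. ?p x * g x)" if "g \<in> schwartz" for g
      using integrable_mult_phase[OF schwartz_integrable[OF that], of "\<lambda>x. - (x \<bullet> \<xi>)"]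
      by (simp add: mult.commute)
    have "(\<integral>x. partial_deriv i ?F x \<partial>lborel) = (\<integral>x. ?p x * partial_deriv i f x \<partial>lborel) +
      (\<integral>x. ?p x * (- 2 * of_real pi * \<i> * of_real (\<xi> $ i) * f x) \<partial>lborel)"
      unfolding F' by (intro Bochner_Integration.integral_add int f' cf)
    also have "(\<integral>x. ?p x * (- 2 * of_real pi * \<i> * of_real (\<xi> $ i) * f x) \<partial>lborel) =
      (\<integral>x. (- 2 * of_real pi * \<i> * of_real (\<xi> $ i)) * (f x * ?p x) \<partial>lborel)"
      by (intro Bochner_Integration.integral_cong) (auto simp: ac_simps)
    also have "\<dots> = (- 2 * of_real pi * \<i> * of_real (\<xi> $ i)) * fourier f \<xi>"
      unfolding fourier_eq by (rule integral_mult_right_zero)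
    finally show ?thesis by (simp only: fourier_eq mult.commute)
  qed
  finally show ?thesis by (simp add: add_eq_0_iff algebra_simps)
qed

text \<open>One factor \<open>norm \<xi>\<close>, bounded by the sum of the \<open>\<bar>\<xi> $ i\<bar>\<close>, is paid for by one derivative of \<open>f\<close>;
  hence the induction on \<open>N\<close> runs over all Schwartz functions at once.\<close>

lemma fourier_rapidly_decreasing:
  fixes f :: "real^'n::finite \<Rightarrow> complex"
  assumes "f \<in> schwartz"
  shows "rapidly_decreasing (fourier f)"
  unfolding rapidly_decreasing_def
proof
  fix N
  show "\<exists>C. \<forall>\<xi>. (1 + norm \<xi>) ^ N * norm (fourier f \<xi>) \<le> C"
    using assms
  proof (induction N arbitrary: f)
    case 0
    then show ?case using norm_fourier_le by auto
  next
    case (Suc N)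
    from Suc.IH[OF Suc.prems] obtain A where A: "\<And>\<xi>. (1 + norm \<xi>) ^ N * norm (fourier f \<xi>) \<le> A"
      by blast
    have "\<exists>B. \<forall>i \<xi>. (1 + norm \<xi>) ^ N * norm (fourier (partial_deriv i f) \<xi>) \<le> B i"
      using Suc.IH[OF schwartz_partial_deriv[OF Suc.prems]] by (intro choice allI)
    then obtain B where B: "\<And>i \<xi>. (1 + norm \<xi>) ^ N * norm (fourier (partial_deriv i f) \<xi>) \<le> B i"
      by blast
    have "(1 + norm \<xi>) ^ Suc N * norm (fourier f \<xi>) \<le> A + (\<Sum>i\<in>UNIV. B i)" for \<xi>
    proof -
      have c: "\<bar>\<xi> $ i\<bar> * norm (fourier f \<xi>) \<le> norm (fourier (partial_deriv i f) \<xi>)" for i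
      proof -
        have "1 * (\<bar>\<xi> $ i\<bar> * norm (fourier f \<xi>)) \<le> (2 * pi) * (\<bar>\<xi> $ i\<bar> * norm (fourier f \<xi>))"
          using pi_ge_two by (intro mult_right_mono) auto
        then show ?thesis
          by (simp add: fourier_partial_deriv[OF Suc.prems] norm_mult mult.assoc)
      qed
      have "(1 + norm \<xi>) ^ Suc N * norm (fourier f \<xi>) =
        (1 + norm \<xi>) ^ N * norm (fourier f \<xi>) + (1 + norm \<xi>) ^ N * (norm \<xi> * norm (fourier f \<xi>))"
        by (simp add: algebra_simps)
      also have "norm \<xi> * norm (fourier f \<xi>) \<le> (\<Sum>i\<in>UNIV. \<bar>\<xi> $ i\<bar> * norm (fourier f \<xi>))"
        using norm_le_l1_cart[of \<xi>] by (simp add: sum_distrib_right[symmetric] mult_right_mono)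
      also have "\<dots> \<le> (\<Sum>i\<in>UNIV. norm (fourier (partial_deriv i f) \<xi>))"
        by (intro sum_mono c)
      finally have "(1 + norm \<xi>) ^ Suc N * norm (fourier f \<xi>) \<le> (1 + norm \<xi>) ^ N * norm (fourier f \<xi>)
          + (\<Sum>i\<in>UNIV. (1 + norm \<xi>) ^ N * norm (fourier (partial_deriv i f) \<xi>))"
        by (simp add: sum_distrib_left mult_left_mono)
      also have "\<dots> \<le> A + (\<Sum>i\<in>UNIV. B i)"
        by (intro add_mono sum_mono A B)
      finally show ?thesis .
    qed
    then show ?case by blast
  qed
qed

lemma fourier_schwartz:
  assumes "f \<in> schwartz"
  shows "fourier f \<in> schwartz"
proof (rule schwartz_coinduct)
  show "fourier f \<in> fourier ` schwartz" using assms by blast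
next
  fix h i assume "h \<in> fourier ` (schwartz :: (real^'a \<Rightarrow> complex) set)"
  then obtain g where g: "h = fourier g" "g \<in> schwartz" by blast
  show "partial_deriv i h \<in> fourier ` schwartz"
    unfolding g(1) partial_deriv_fourier[OF g(2)]
    by (intro imageI schwartz_cmult schwartz_coordinate g(2))
next
  fix h x assume "h \<in> fourier ` (schwartz :: (real^'a \<Rightarrow> complex) set)"
  then show "h differentiable (at x)"
    using fourier_has_derivative unfolding differentiable_def by blast
qed (auto intro: fourier_rapidly_decreasing)

lemma inv_fourier_schwartz: "f \<in> schwartz \<Longrightarrow> inv_fourier f \<in> schwartz"
  unfolding inv_fourier_fourier_reflect[abs_def] by (intro schwartz_reflect fourier_schwartz)

section \<open>Fourier inversion and the multiplier kernel\<close>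

lemma gaussian_scaled_fourier:
  fixes y :: "'a::euclidean_space"
  assumes "0 < \<epsilon>"
  shows "integrable lborel (\<lambda>z::'a. complex_of_real (gaussian (\<epsilon> *\<^sub>R z)))"
    and "(\<integral>z. complex_of_real (gaussian (\<epsilon> *\<^sub>R z)) * phase (- (z \<bullet> y)) \<partial>lborel)
      = of_real (inverse \<epsilon> ^ DIM('a) * gaussian (y /\<^sub>R \<epsilon>))"
proof -
  have *: "integrable lborel (\<lambda>z::'a. gaussian (0 + \<epsilon> *\<^sub>R z))"
    using assms by (intro integrable_affine integrable_gaussian) auto
  then show "integrable lborel (\<lambda>z::'a. complex_of_real (gaussian (\<epsilon> *\<^sub>R z)))"
    by (simp add: complex_of_real_integrable_eq)
  have "(\<integral>z. complex_of_real (gaussian (\<epsilon> *\<^sub>R z)) * phase (- (z \<bullet> y)) \<partial>lborel)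
    = \<bar>inverse \<epsilon>\<bar> ^ DIM('a) *\<^sub>R (\<integral>v. complex_of_real (gaussian (\<epsilon> *\<^sub>R (0 + inverse \<epsilon> *\<^sub>R v))) *
        phase (- ((0 + inverse \<epsilon> *\<^sub>R v) \<bullet> y)) \<partial>lborel)"
    using assms by (intro integral_affine) auto
  also have "(\<lambda>v::'a. complex_of_real (gaussian (\<epsilon> *\<^sub>R (0 + inverse \<epsilon> *\<^sub>R v))) * phase (- ((0 + inverse \<epsilon> *\<^sub>R v) \<bullet> y)))
      = (\<lambda>v. complex_of_real (gaussian v) * exp (- 2 * of_real pi * \<i> * of_real (v \<bullet> (y /\<^sub>R \<epsilon>))))"
    using assms by (simp add: phase_def)
  also have "(\<integral>v. complex_of_real (gaussian v) * exp (- 2 * of_real pi * \<i> * of_real (v \<bullet> (y /\<^sub>R \<epsilon>))) \<partial>lborel)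
      = of_real (gaussian (y /\<^sub>R \<epsilon>))"
    by (rule integral_gaussian_exp)
  finally show "(\<integral>z. complex_of_real (gaussian (\<epsilon> *\<^sub>R z)) * phase (- (z \<bullet> y)) \<partial>lborel)
      = of_real (inverse \<epsilon> ^ DIM('a) * gaussian (y /\<^sub>R \<epsilon>))"
    using assms by (simp add: scaleR_conv_of_real)
qed

text \<open>Damping the inversion integral by the Gaussian \<open>gaussian (\<epsilon> z)\<close> turns it into an average of
  \<open>f\<close> over the scale \<open>\<epsilon>\<close>, because the Gaussian is its own Fourier transform.\<close>

lemma damped_inversion:
  fixes f :: "real^'n::finite \<Rightarrow> complex"
  assumes f: "integrable lborel f" and \<epsilon>: "0 < \<epsilon>"
  shows "(\<integral>z. fourier f z * phase (\<xi> \<bullet> z) * of_real (gaussian (\<epsilon> *\<^sub>R z)) \<partial>lborel)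
    = (\<integral>w. gaussian w *\<^sub>R f (\<xi> + \<epsilon> *\<^sub>R w) \<partial>lborel)"
proof -
  have [measurable]: "f \<in> borel_measurable borel"
    using borel_measurable_integrable[OF f] by simp
  let ?g = "\<lambda>z \<zeta>. f \<zeta> * (of_real (gaussian (\<epsilon> *\<^sub>R z)) * phase (- (z \<bullet> (\<zeta> - \<xi>))))"
  have "integrable (lborel \<Otimes>\<^sub>M lborel) (\<lambda>(z::real^'n, \<zeta>). complex_of_real (gaussian (\<epsilon> *\<^sub>R z)) * f \<zeta>)"
    using gaussian_scaled_fourier(1)[OF \<epsilon>] f by (rule integrable_pair_mult)
  then have int: "integrable (lborel \<Otimes>\<^sub>M lborel) (\<lambda>(z, \<zeta>). ?g z \<zeta>)"
    by (rule Bochner_Integration.integrable_bound) (auto simp: norm_mult)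
  have 1: "fourier f z * phase (\<xi> \<bullet> z) * of_real (gaussian (\<epsilon> *\<^sub>R z)) = (\<integral>\<zeta>. ?g z \<zeta> \<partial>lborel)" for z
  proof -
    have "fourier f z * phase (\<xi> \<bullet> z) * of_real (gaussian (\<epsilon> *\<^sub>R z)) =
        fourier f z * (phase (\<xi> \<bullet> z) * of_real (gaussian (\<epsilon> *\<^sub>R z)))"
      by (rule mult.assoc)
    also have "\<dots> =
        (\<integral>\<zeta>. f \<zeta> * phase (- (\<zeta> \<bullet> z)) * (phase (\<xi> \<bullet> z) * of_real (gaussian (\<epsilon> *\<^sub>R z))) \<partial>lborel)"
      by (simp only: fourier_eq integral_mult_left_zero)
    also have "\<dots> = (\<integral>\<zeta>. ?g z \<zeta> \<partial>lborel)"
    proof (rule Bochner_Integration.integral_cong)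
      fix \<zeta> :: "real^'n"
      have "phase (- (z \<bullet> (\<zeta> - \<xi>))) = phase (- (\<zeta> \<bullet> z)) * phase (\<xi> \<bullet> z)"
        unfolding phase_add[symmetric] by (simp add: inner_diff_right inner_commute)
      then show "f \<zeta> * phase (- (\<zeta> \<bullet> z)) * (phase (\<xi> \<bullet> z) * of_real (gaussian (\<epsilon> *\<^sub>R z))) = ?g z \<zeta>"
        by simp
    qed simp
    finally show ?thesis .
  qed
  have 2: "(\<integral>z. ?g z \<zeta> \<partial>lborel) = f \<zeta> * of_real (inverse \<epsilon> ^ DIM(real^'n) * gaussian ((\<zeta> - \<xi>) /\<^sub>R \<epsilon>))" for \<zeta>
    unfolding integral_mult_right_zero gaussian_scaled_fourier(2)[OF \<epsilon>] ..
  have "(\<integral>z. fourier f z * phase (\<xi> \<bullet> z) * of_real (gaussian (\<epsilon> *\<^sub>R z)) \<partial>lborel) =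
      (\<integral>\<zeta>. f \<zeta> * of_real (inverse \<epsilon> ^ DIM(real^'n) * gaussian ((\<zeta> - \<xi>) /\<^sub>R \<epsilon>)) \<partial>lborel)"
    unfolding 1 2[symmetric] by (rule lborel_pair.Fubini_integral[symmetric, OF int])
  also have "\<dots> = \<bar>\<epsilon>\<bar> ^ DIM(real^'n) *\<^sub>R
      (\<integral>w. f (\<xi> + \<epsilon> *\<^sub>R w) * of_real (inverse \<epsilon> ^ DIM(real^'n) * gaussian ((\<xi> + \<epsilon> *\<^sub>R w - \<xi>) /\<^sub>R \<epsilon>)) \<partial>lborel)"
    using \<epsilon> by (intro integral_affine) auto
  also have "\<dots> = (\<integral>w. \<bar>\<epsilon>\<bar> ^ DIM(real^'n) *\<^sub>R
      (f (\<xi> + \<epsilon> *\<^sub>R w) * of_real (inverse \<epsilon> ^ DIM(real^'n) * gaussian ((\<xi> + \<epsilon> *\<^sub>R w - \<xi>) /\<^sub>R \<epsilon>))) \<partial>lborel)"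
    by (rule integral_scaleR_right[symmetric])
  also have "\<dots> = (\<integral>w. gaussian w *\<^sub>R f (\<xi> + \<epsilon> *\<^sub>R w) \<partial>lborel)"
  proof (intro Bochner_Integration.integral_cong refl)
    fix w :: "real^'n"
    have "(\<xi> + \<epsilon> *\<^sub>R w - \<xi>) /\<^sub>R \<epsilon> = w" using \<epsilon> by simp
    then show "\<bar>\<epsilon>\<bar> ^ DIM(real^'n) *\<^sub>R (f (\<xi> + \<epsilon> *\<^sub>R w) *
        of_real (inverse \<epsilon> ^ DIM(real^'n) * gaussian ((\<xi> + \<epsilon> *\<^sub>R w - \<xi>) /\<^sub>R \<epsilon>))) =
        gaussian w *\<^sub>R f (\<xi> + \<epsilon> *\<^sub>R w)"
      using \<epsilon> by (simp add: scaleR_conv_of_real power_inverse del: DIM_cart)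
  qed
  finally show ?thesis .
qed

lemma fourier_inversion:
  fixes f :: "real^'n::finite \<Rightarrow> complex"
  assumes f: "f \<in> schwartz"
  shows "inv_fourier (fourier f) \<xi> = f \<xi>"
proof -
  define \<epsilon> where "\<epsilon> n = 1 / real (Suc n)" for n
  have \<epsilon>: "0 < \<epsilon> n" for n by (simp add: \<epsilon>_def)
  have \<epsilon>0: "\<epsilon> \<longlonglongrightarrow> 0" unfolding \<epsilon>_def by (rule LIMSEQ_Suc[OF lim_1_over_n])
  have [measurable]: "f \<in> borel_measurable borel" using f by (rule schwartz_measurable)
  obtain B where B: "\<And>x. norm (f x) \<le> B" using schwartz_bounded[OF f] by blast
  have "(\<lambda>n. \<integral>z. fourier f z * phase (\<xi> \<bullet> z) * of_real (gaussian (\<epsilon> n *\<^sub>R z)) \<partial>lborel)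
      \<longlonglongrightarrow> (\<integral>z. fourier f z * phase (\<xi> \<bullet> z) * of_real 1 \<partial>lborel)"
  proof (rule integral_dominated_convergence)
    show "integrable lborel (\<lambda>z. norm (fourier f z))"
      by (intro integrable_norm schwartz_integrable fourier_schwartz f)
    show "AE z in lborel. (\<lambda>n. fourier f z * phase (\<xi> \<bullet> z) * of_real (gaussian (\<epsilon> n *\<^sub>R z)))
        \<longlonglongrightarrow> fourier f z * phase (\<xi> \<bullet> z) * of_real 1"
    proof (intro AE_I2 tendsto_mult tendsto_const tendsto_of_real)
      fix z :: "real^'n"
      have "(\<lambda>n. exp (- pi * (norm (\<epsilon> n *\<^sub>R z))\<^sup>2)) \<longlonglongrightarrow> exp (- pi * (norm (0 *\<^sub>R z))\<^sup>2)"
        by (intro tendsto_intros \<epsilon>0)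
      then show "(\<lambda>n. gaussian (\<epsilon> n *\<^sub>R z)) \<longlonglongrightarrow> 1" by (simp add: gaussian_def)
    qed
    show "AE z in lborel. norm (fourier f z * phase (\<xi> \<bullet> z) * of_real (gaussian (\<epsilon> n *\<^sub>R z))) \<le> norm (fourier f z)" for n
      by (intro AE_I2) (simp add: norm_mult abs_of_pos gaussian_pos gaussian_le_1 mult_left_le)
  qed measurable
  moreover have "(\<lambda>n. \<integral>z. fourier f z * phase (\<xi> \<bullet> z) * of_real (gaussian (\<epsilon> n *\<^sub>R z)) \<partial>lborel) \<longlonglongrightarrow> f \<xi>"
    unfolding damped_inversion[OF schwartz_integrable[OF f] \<epsilon>]
    using B schwartz_differentiable[OF f] \<epsilon>0
    by (intro gaussian_average_tendsto) (auto intro: differentiable_imp_continuous_within)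
  ultimately show ?thesis
    unfolding inv_fourier_eq by (simp add: LIMSEQ_unique)
qed

text \<open>By duality \<^const>\<open>fourier_mult\<close> moves the symbol \<open>\<eta>\<close> onto the test function. Exchanging the order of
  the two integrals shows that it acts there as convolution with the kernel \<open>fourier \<eta>\<close>.\<close>

lemma fourier_mult_inv_fourier:
  fixes \<eta> \<phi> :: "real^'n::finite \<Rightarrow> complex"
  assumes \<eta>: "\<eta> \<in> schwartz" and \<phi>: "\<phi> \<in> schwartz"
  shows "fourier (\<lambda>\<xi>. \<eta> \<xi> * inv_fourier \<phi> \<xi>) y = (\<integral>x. \<phi> x * fourier \<eta> (y - x) \<partial>lborel)"
proof -
  have [measurable]: "\<eta> \<in> borel_measurable borel" "\<phi> \<in> borel_measurable borel"
    using \<eta> \<phi> by (auto intro: schwartz_measurable)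
  let ?g = "\<lambda>\<xi> x. \<eta> \<xi> * \<phi> x * phase (- ((y - x) \<bullet> \<xi>))"
  have "integrable (lborel \<Otimes>\<^sub>M lborel) (\<lambda>(\<xi>, x). \<eta> \<xi> * \<phi> x)"
    by (intro integrable_pair_mult schwartz_integrable \<eta> \<phi>)
  then have int: "integrable (lborel \<Otimes>\<^sub>M lborel) (\<lambda>(\<xi>, x). ?g \<xi> x)"
    by (rule Bochner_Integration.integrable_bound) (auto simp: norm_mult)
  have 1: "\<eta> \<xi> * inv_fourier \<phi> \<xi> * phase (- (\<xi> \<bullet> y)) = (\<integral>x. ?g \<xi> x \<partial>lborel)" for \<xi>
  proof -
    have "\<eta> \<xi> * inv_fourier \<phi> \<xi> * phase (- (\<xi> \<bullet> y)) =
        (\<integral>x. \<eta> \<xi> * (\<phi> x * phase (\<xi> \<bullet> x)) * phase (- (\<xi> \<bullet> y)) \<partial>lborel)"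
      unfolding inv_fourier_eq by simp
    also have "\<dots> = (\<integral>x. ?g \<xi> x \<partial>lborel)"
    proof (rule Bochner_Integration.integral_cong)
      fix x :: "real^'n"
      have "phase (- ((y - x) \<bullet> \<xi>)) = phase (\<xi> \<bullet> x) * phase (- (\<xi> \<bullet> y))"
        unfolding phase_add[symmetric] by (simp add: inner_diff_left inner_diff_right inner_commute)
      then show "\<eta> \<xi> * (\<phi> x * phase (\<xi> \<bullet> x)) * phase (- (\<xi> \<bullet> y)) = ?g \<xi> x"
        by (simp only: mult.assoc)
    qed simp
    finally show ?thesis .
  qed
  have 2: "\<phi> x * fourier \<eta> (y - x) = (\<integral>\<xi>. ?g \<xi> x \<partial>lborel)" for x
  proof -
    have "\<phi> x * fourier \<eta> (y - x) = (\<integral>\<xi>. \<phi> x * (\<eta> \<xi> * phase (- (\<xi> \<bullet> (y - x)))) \<partial>lborel)"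
      unfolding fourier_eq by simp
    also have "\<dots> = (\<integral>\<xi>. ?g \<xi> x \<partial>lborel)"
      by (intro Bochner_Integration.integral_cong) (auto simp: inner_commute)
    finally show ?thesis .
  qed
  show ?thesis
    unfolding fourier_eq[of "\<lambda>\<xi>. \<eta> \<xi> * inv_fourier \<phi> \<xi>"] 1 2
    by (rule lborel_pair.Fubini_integral[symmetric, OF int])
qed

section \<open>Distributions represented by functions\<close>

lemma integrable_mult_bounded:
  fixes f g :: "'a::euclidean_space \<Rightarrow> complex"
  assumes f: "integrable lborel f" and [measurable]: "g \<in> borel_measurable borel"
    and g: "\<And>x. norm (g x) \<le> B"
  shows "integrable lborel (\<lambda>x. g x * f x)"
proof (rule Bochner_Integration.integrable_bound)
  have "0 \<le> B" using order_trans[OF norm_ge_zero g] .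
  have [measurable]: "f \<in> borel_measurable borel"
    using borel_measurable_integrable[OF f] by simp
  show "integrable lborel (\<lambda>x. B * norm (f x))"
    using f by simp
  show "AE x in lborel. norm (g x * f x) \<le> norm (B * norm (f x))"
    using \<open>0 \<le> B\<close> g by (intro AE_I2) (simp add: norm_mult mult_right_mono)
  show "(\<lambda>x. g x * f x) \<in> borel_measurable lborel" by measurable
qed

text \<open>The transpose of convolution with \<open>K\<close>: the kernel is evaluated at \<open>y - x\<close>, because the
  convolution has been moved from the test function to \<open>g\<close>.\<close>

definition dual_convolution :: "(real^'n::finite \<Rightarrow> complex) \<Rightarrow> (real^'n \<Rightarrow> complex) \<Rightarrow> real^'n \<Rightarrow> complex" where
  "dual_convolution K g x = (\<integral>y. g y * K (y - x) \<partial>lborel)"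

lemma dual_convolution_measurable [measurable (raw)]:
  assumes [measurable]: "K \<in> borel_measurable borel" "g \<in> borel_measurable borel"
  shows "dual_convolution K g \<in> borel_measurable borel"
  unfolding dual_convolution_def[abs_def] by measurable

lemma integrable_translate:
  fixes K :: "real^'n::finite \<Rightarrow> complex"
  assumes "integrable lborel K"
  shows "integrable lborel (\<lambda>y. K (y - x))"
  using integrable_affine[OF _ assms, of 1 "- x"] by simp

lemma norm_dual_convolution_le:
  assumes K: "integrable lborel K" and [measurable]: "g \<in> borel_measurable borel"
    and g: "\<And>y. norm (g y) \<le> B"
  shows "norm (dual_convolution K g x) \<le> B * (\<integral>y. norm (K y) \<partial>lborel)"
proof -
  have [measurable]: "K \<in> borel_measurable borel"
    using borel_measurable_integrable[OF K] by simp
  have "norm (dual_convolution K g x) \<le> (\<integral>y. norm (g y * K (y - x)) \<partial>lborel)"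
    unfolding dual_convolution_def by (rule integral_norm_bound)
  also have "\<dots> \<le> (\<integral>y. B * norm (K (y - x)) \<partial>lborel)"
    using g by (intro integral_mono integrable_norm integrable_mult_right integrable_mult_bounded
        integrable_translate K) (auto simp: norm_mult mult_right_mono)
  also have "\<dots> = B * (\<integral>y. norm (K y) \<partial>lborel)"
    using integral_translate(2)[of "\<lambda>y. norm (K y)" x] by simp
  finally show ?thesis .
qed

text \<open>On bounded functions, multipliers with Schwartz symbol are integral operators. All later
  estimates of \<open>fourier_mult \<eta> u\<close> go through this kernel.\<close>

lemma represents_fourier_mult:
  fixes g :: "real^'n::finite \<Rightarrow> complex"
  assumes u: "represents g u" and [measurable]: "g \<in> borel_measurable borel"
    and B: "\<And>y. norm (g y) \<le> B" and \<eta>: "\<eta> \<in> schwartz"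
  shows "represents (dual_convolution (fourier \<eta>) g) (fourier_mult \<eta> u)"
  unfolding represents_def
proof (intro ballI conjI)
  fix \<phi> :: "real^'n \<Rightarrow> complex" assume \<phi>: "\<phi> \<in> schwartz"
  let ?K = "fourier \<eta>"
  have K: "integrable lborel ?K"
    by (intro schwartz_integrable fourier_schwartz \<eta>)
  have [measurable]: "\<phi> \<in> borel_measurable borel" "?K \<in> borel_measurable borel"
    using \<phi> \<eta> by (auto intro!: schwartz_measurable fourier_schwartz)
  show "integrable lborel (\<lambda>x. dual_convolution ?K g x * \<phi> x)"
    by (intro integrable_mult_bounded[where B = "B * (\<integral>y. norm (?K y) \<partial>lborel)"]
        norm_dual_convolution_le schwartz_integrable \<phi> K B) measurable
  let ?h = "\<lambda>x y. \<phi> x * (g y * ?K (y - x))"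
  have int: "integrable (lborel \<Otimes>\<^sub>M lborel) (\<lambda>(x, y). ?h x y)"
  proof (rule lborel_pair.Fubini_integrable)
    have gK: "integrable lborel (\<lambda>y. g y * ?K (y - x))" for x
      by (intro integrable_mult_bounded[where B = B] integrable_translate K B) measurable
    show "AE x in lborel. integrable lborel (\<lambda>y. case (x, y) of (x, y) \<Rightarrow> ?h x y)"
      using gK by (intro AE_I2) simp
    have k: "(\<integral>y. norm (g y * ?K (y - x)) \<partial>lborel) \<le> B * (\<integral>y. norm (?K y) \<partial>lborel)" for x
    proof -
      have "(\<integral>y. norm (g y * ?K (y - x)) \<partial>lborel) \<le> (\<integral>y. B * norm (?K (y - x)) \<partial>lborel)"
        using B by (intro integral_mono integrable_norm integrable_mult_right gK integrable_translate K)
          (auto simp: norm_mult mult_right_mono)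
      also have "\<dots> = B * (\<integral>y. norm (?K y) \<partial>lborel)"
        using integral_translate(2)[of "\<lambda>y. norm (?K y)" x] by simp
      finally show ?thesis .
    qed
    have "integrable lborel (\<lambda>x. norm (\<phi> x) * (\<integral>y. norm (g y * ?K (y - x)) \<partial>lborel))"
    proof (rule Bochner_Integration.integrable_bound)
      show "integrable lborel (\<lambda>x. norm (\<phi> x) * (B * (\<integral>y. norm (?K y) \<partial>lborel)))"
        using schwartz_integrable[OF \<phi>] by simp
      show "AE x in lborel. norm (norm (\<phi> x) * (\<integral>y. norm (g y * ?K (y - x)) \<partial>lborel))
          \<le> norm (norm (\<phi> x) * (B * (\<integral>y. norm (?K y) \<partial>lborel)))"
      proof (rule AE_I2)
        fix x
        have "0 \<le> (\<integral>y. norm (g y * ?K (y - x)) \<partial>lborel)" by simp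
        with k[of x] show "norm (norm (\<phi> x) * (\<integral>y. norm (g y * ?K (y - x)) \<partial>lborel))
          \<le> norm (norm (\<phi> x) * (B * (\<integral>y. norm (?K y) \<partial>lborel)))"
          unfolding real_norm_def abs_mult[of "norm (\<phi> x)"] norm_mult
          by (intro mult_left_mono) (linarith, simp)
      qed
    qed measurable
    then show "integrable lborel (\<lambda>x. \<integral>y. norm (case (x, y) of (x, y) \<Rightarrow> ?h x y) \<partial>lborel)"
      by (simp add: norm_mult)
  qed measurable
  have "fourier_mult \<eta> u \<phi> = u (fourier (\<lambda>\<xi>. \<eta> \<xi> * inv_fourier \<phi> \<xi>))"
    by (simp add: fourier_mult_def inv_fourier_distr_def mult_distr_def fourier_distr_def)
  also have "\<dots> = (\<integral>y. g y * fourier (\<lambda>\<xi>. \<eta> \<xi> * inv_fourier \<phi> \<xi>) y \<partial>lborel)"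
    using u fourier_schwartz[OF schwartz_mult[OF \<eta> inv_fourier_schwartz[OF \<phi>]]]
    unfolding represents_def by blast
  also have "\<dots> = (\<integral>y. \<integral>x. ?h x y \<partial>lborel \<partial>lborel)"
    unfolding fourier_mult_inv_fourier[OF \<eta> \<phi>] integral_mult_right_zero[symmetric]
    by (simp only: mult.left_commute)
  also have "\<dots> = (\<integral>x. \<integral>y. ?h x y \<partial>lborel \<partial>lborel)"
    by (rule lborel_pair.Fubini_integral[OF int])
  also have "\<dots> = (\<integral>x. dual_convolution ?K g x * \<phi> x \<partial>lborel)"
    unfolding dual_convolution_def integral_mult_right_zero by (simp only: mult.commute)
  finally show "fourier_mult \<eta> u \<phi> = (\<integral>x. dual_convolution ?K g x * \<phi> x \<partial>lborel)" .
qed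

text \<open>Polynomials times a fixed Gaussian, generated from the Gaussian by multiplication with
  coordinates and linear combinations. Unlike the multiples of the Gaussian alone, this class is
  closed under partial derivatives.\<close>

inductive_set gaussian_polys :: "real^'n::finite \<Rightarrow> real \<Rightarrow> (real^'n \<Rightarrow> complex) set" for a \<epsilon> where
  base: "(\<lambda>x. of_real (gaussian ((x - a) /\<^sub>R \<epsilon>))) \<in> gaussian_polys a \<epsilon>"
| coordinate: "f \<in> gaussian_polys a \<epsilon> \<Longrightarrow> (\<lambda>x. of_real (x $ i) * f x) \<in> gaussian_polys a \<epsilon>"
| cmult: "f \<in> gaussian_polys a \<epsilon> \<Longrightarrow> (\<lambda>x. c * f x) \<in> gaussian_polys a \<epsilon>"
| add: "f \<in> gaussian_polys a \<epsilon> \<Longrightarrow> g \<in> gaussian_polys a \<epsilon> \<Longrightarrow> (\<lambda>x. f x + g x) \<in> gaussian_polys a \<epsilon>"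

lemma gaussian_has_derivative:
  fixes a :: "real^'n::finite"
  shows "((\<lambda>x. complex_of_real (gaussian ((x - a) /\<^sub>R \<epsilon>))) has_derivative
    (\<lambda>h. of_real (- 2 * pi * (inverse \<epsilon>)\<^sup>2 * (h \<bullet> (x - a)) * gaussian ((x - a) /\<^sub>R \<epsilon>)))) (at x)"
proof -
  have eq: "gaussian ((x - a) /\<^sub>R \<epsilon>) = exp (- pi * (inverse \<epsilon>)\<^sup>2 * ((x - a) \<bullet> (x - a)))" for x :: "real^'n"
    by (simp add: gaussian_def power_mult_distrib dot_square_norm power_inverse)
  have "((\<lambda>x. exp (- pi * (inverse \<epsilon>)\<^sup>2 * ((x - a) \<bullet> (x - a)))) has_derivative
    (\<lambda>h. - 2 * pi * (inverse \<epsilon>)\<^sup>2 * (h \<bullet> (x - a)) * exp (- pi * (inverse \<epsilon>)\<^sup>2 * ((x - a) \<bullet> (x - a))))) (at x)"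
    by (auto intro!: derivative_eq_intros simp: inner_commute algebra_simps)
  then show ?thesis
    unfolding eq by (rule has_derivative_of_real)
qed

lemma rapidly_decreasing_gaussian:
  fixes a :: "real^'n::finite"
  assumes \<epsilon>: "0 < \<epsilon>"
  shows "rapidly_decreasing (\<lambda>x. of_real (gaussian ((x - a) /\<^sub>R \<epsilon>)))"
  unfolding rapidly_decreasing_def
proof
  fix N
  \<comment> \<open>With \<open>r\<close> the rescaled distance to \<open>a\<close>: \<open>1 + norm x \<le> K * exp r\<close>, and \<open>N * r - pi * r\<^sup>2 \<le> N\<^sup>2\<close>.\<close>
  define K where "K = 1 + norm a + \<epsilon>"
  have K: "1 \<le> K" using \<epsilon> by (simp add: K_def)
  have "(1 + norm x) ^ N * norm (complex_of_real (gaussian ((x - a) /\<^sub>R \<epsilon>))) \<le> K ^ N * exp ((real N)\<^sup>2)" for x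
  proof -
    define r where "r = norm ((x - a) /\<^sub>R \<epsilon>)"
    have r: "0 \<le> r" by (simp add: r_def)
    have "norm x \<le> norm (x - a) + norm a" using norm_triangle_sub[of x a] by simp
    also have "norm (x - a) = \<epsilon> * r" using \<epsilon> by (simp add: r_def)
    finally have "1 + norm x \<le> 1 + norm a + \<epsilon> * r" by simp
    also have "\<dots> \<le> K * (1 + r)"
      using \<epsilon> r by (simp add: K_def algebra_simps)
    also have "\<dots> \<le> K * exp r"
      using K by (intro mult_left_mono exp_ge_add_one_self) auto
    finally have "(1 + norm x) ^ N \<le> (K * exp r) ^ N" by (intro power_mono) auto
    also have "\<dots> = K ^ N * exp (real N * r)" by (simp add: power_mult_distrib exp_of_nat_mult)
    finally have "(1 + norm x) ^ N * gaussian ((x - a) /\<^sub>R \<epsilon>) \<le> K ^ N * exp (real N * r) * gaussian ((x - a) /\<^sub>R \<epsilon>)"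
      by (intro mult_right_mono less_imp_le[OF gaussian_pos])
    also have "\<dots> = K ^ N * exp (real N * r - pi * r\<^sup>2)"
    proof -
      have "gaussian ((x - a) /\<^sub>R \<epsilon>) = exp (- pi * r\<^sup>2)"
        by (simp only: gaussian_def r_def)
      then show ?thesis by (simp add: mult.assoc exp_add[symmetric])
    qed
    also have "\<dots> \<le> K ^ N * exp ((real N)\<^sup>2)"
    proof -
      have "1 * r\<^sup>2 \<le> pi * r\<^sup>2" using pi_ge_two by (intro mult_right_mono) auto
      moreover have "real N * r \<le> (real N)\<^sup>2 + r\<^sup>2"
        using sum_squares_ge_zero[of "real N" r] sum_squares_bound[of "real N" r]
          mult_nonneg_nonneg[OF of_nat_0_le_iff r, of N] by linarith
      ultimately have "real N * r - pi * r\<^sup>2 \<le> (real N)\<^sup>2" by simp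
      then show ?thesis using K by (intro mult_left_mono) auto
    qed
    finally show ?thesis by (simp add: abs_of_pos gaussian_pos)
  qed
  then show "\<exists>C. \<forall>x. (1 + norm x) ^ N * norm (complex_of_real (gaussian ((x - a) /\<^sub>R \<epsilon>))) \<le> C" by blast
qed

lemma gaussian_schwartz:
  fixes a :: "real^'n::finite"
  assumes \<epsilon>: "0 < \<epsilon>"
  shows "(\<lambda>x. of_real (gaussian ((x - a) /\<^sub>R \<epsilon>))) \<in> schwartz"
proof (rule schwartz_coinduct)
  show "(\<lambda>x. of_real (gaussian ((x - a) /\<^sub>R \<epsilon>))) \<in> gaussian_polys a \<epsilon>" by (rule base)
  have g_diff: "(\<lambda>x. complex_of_real (gaussian ((x - a) /\<^sub>R \<epsilon>))) differentiable (at x)" for x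
    using gaussian_has_derivative unfolding differentiable_def by blast
  show diff: "f differentiable (at x)" if "f \<in> gaussian_polys a \<epsilon>" for f x
    using that
    by induction (auto intro!: differentiable_mult differentiable_add coordinate_differentiable g_diff)
  show "rapidly_decreasing f" if "f \<in> gaussian_polys a \<epsilon>" for f
    using that
  proof induction
    case (cmult f c)
    then show ?case using rapidly_decreasing_mult[of f "\<lambda>_. c" "norm c" 0] by simp
  qed (auto intro: rapidly_decreasing_gaussian[OF \<epsilon>] rapidly_decreasing_coordinate rapidly_decreasing_add)
  show "partial_deriv j f \<in> gaussian_polys a \<epsilon>" if "f \<in> gaussian_polys a \<epsilon>" for f j
    using that
  proof induction
    case base
    let ?g = "\<lambda>x. complex_of_real (gaussian ((x - a) /\<^sub>R \<epsilon>))"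
    let ?c = "complex_of_real (- 2 * pi * (inverse \<epsilon>)\<^sup>2)"
    have "partial_deriv j ?g x = ?c * (of_real (x $ j) * ?g x) + (- ?c * of_real (a $ j)) * ?g x" for x
      by (subst partial_deriv_eq[OF gaussian_has_derivative])
        (simp add: inner_axis' algebra_simps)
    then have "partial_deriv j ?g = (\<lambda>x. ?c * (of_real (x $ j) * ?g x) + (- ?c * of_real (a $ j)) * ?g x)"
      by blast
    then show ?case by (simp only:) (intro gaussian_polys.intros)
  next
    case (coordinate f i)
    have "partial_deriv j (\<lambda>x. of_real (x $ i) * f x) =
        (\<lambda>x. of_real (x $ i) * partial_deriv j f x + (if i = j then 1 else 0) * f x)"
      by (rule ext, subst partial_deriv_mult)
        (auto simp: partial_deriv_coordinate coordinate_differentiable diff coordinate)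
    then show ?case using coordinate by (simp only:) (intro gaussian_polys.intros)
  next
    case (cmult f c)
    then have "partial_deriv j (\<lambda>x. c * f x) = (\<lambda>x. c * partial_deriv j f x)"
      by (auto simp: partial_deriv_cmult diff)
    then show ?case using cmult by (simp only:) (intro gaussian_polys.intros)
  next
    case (add f g)
    then have "partial_deriv j (\<lambda>x. f x + g x) = (\<lambda>x. partial_deriv j f x + partial_deriv j g x)"
      by (auto simp: partial_deriv_add diff)
    then show ?case using add by (simp only:) (intro gaussian_polys.intros)
  qed
qed

text \<open>The test functions are products of two Gaussians. The first factor, centred at the origin with
  unit width, makes the difference \<open>g - g'\<close> integrable; the second one, of arbitrary centre and
  width, localises.\<close>

lemma represents_unique:
  fixes g g' :: "real^'n::finite \<Rightarrow> complex"
  assumes g: "represents g u" and g': "represents g' u"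
  shows "AE x in lborel. g x = g' x"
proof -
  let ?\<gamma> = "\<lambda>x::real^'n. complex_of_real (gaussian x)"
  have \<gamma>: "?\<gamma> \<in> schwartz" using gaussian_schwartz[of 1 "0::real^'n"] by simp
  let ?h = "\<lambda>x. g x * ?\<gamma> x - g' x * ?\<gamma> x"
  have int: "integrable lborel ?h"
    using g g' \<gamma> unfolding represents_def by (intro Bochner_Integration.integrable_diff) auto
  have "AE x in lborel. ?h x = 0"
  proof (rule AE_zero_of_box_integrals[OF int box_integral_zero_of_gaussian[OF int]])
    fix a :: "real^'n" and \<epsilon> :: real assume "0 < \<epsilon>"
    then have \<phi>: "(\<lambda>x. ?\<gamma> x * of_real (gaussian ((x - a) /\<^sub>R \<epsilon>))) \<in> schwartz" (is "?\<phi> \<in> _")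
      by (intro schwartz_mult \<gamma> gaussian_schwartz)
    have "(\<integral>x. ?h x * of_real (gaussian ((x - a) /\<^sub>R \<epsilon>)) \<partial>lborel) = (\<integral>x. g x * ?\<phi> x - g' x * ?\<phi> x \<partial>lborel)"
      by (simp only: left_diff_distrib mult.assoc)
    also have "\<dots> = u ?\<phi> - u ?\<phi>"
      using g g' \<phi> unfolding represents_def by (subst Bochner_Integration.integral_diff) auto
    finally show "(\<integral>x. ?h x * of_real (gaussian ((x - a) /\<^sub>R \<epsilon>)) \<partial>lborel) = 0" by simp
  qed
  then show ?thesis
    by eventually_elim (simp add: left_diff_distrib[symmetric] less_imp_neq[OF gaussian_pos, symmetric])
qed

section \<open>Uniform integrability of the kernels\<close>

lemma partial_derivs_eq_0_on_open:
  assumes U: "open U" and zero: "\<And>x. x \<in> U \<Longrightarrow> f x = 0" and x: "x \<in> U"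
  shows "partial_derivs \<gamma> f x = 0"
  using x
proof (induction \<gamma> arbitrary: x)
  case Nil
  then show ?case by (simp add: partial_derivs_def zero)
next
  case (Cons i \<gamma>)
  have "(partial_derivs \<gamma> f has_derivative (\<lambda>h. 0)) (at x)"
    using Cons by (intro has_derivative_transform_within_open[OF has_derivative_const U]) auto
  then have "partial_deriv i (partial_derivs \<gamma> f) x = 0" by (rule partial_deriv_eq)
  then show ?case by (simp add: partial_derivs_def)
qed

lemma fourier_iterated_partial_deriv:
  assumes "f \<in> schwartz"
  shows "fourier (partial_derivs (replicate N i) f) \<xi> = (2 * of_real pi * \<i> * of_real (\<xi> $ i)) ^ N * fourier f \<xi>"
proof (induction N)
  case 0
  then show ?case by (simp add: partial_derivs_def)
next
  case (Suc N)
  have "partial_derivs (replicate (Suc N) i) f = partial_deriv i (partial_derivs (replicate N i) f)"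
    by (simp add: partial_derivs_def)
  then show ?case
    using fourier_partial_deriv[OF schwartz_partial_derivs[OF assms]] Suc by simp
qed

text \<open>The weight is controlled by a pure power of the largest coordinate, so decay against it can be
  read off from the unmixed derivatives of order \<open>2 * n\<close> of the symbol.\<close>

lemma inverse_decay_weight_le:
  fixes y :: "real^'n::finite"
  obtains i where "inverse (decay_weight y) \<le> 2 ^ CARD('n) * max 1 (\<bar>y $ i\<bar> ^ (2 * CARD('n)))"
proof -
  have "Max (range (\<lambda>j. \<bar>y $ j\<bar>)) \<in> range (\<lambda>j. \<bar>y $ j\<bar>)" by (intro Max_in) auto
  then obtain i where i: "Max (range (\<lambda>j. \<bar>y $ j\<bar>)) = \<bar>y $ i\<bar>" by blast
  have max: "\<bar>y $ j\<bar> \<le> \<bar>y $ i\<bar>" for j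
    unfolding i[symmetric] by (intro Max_ge) auto
  have "inverse (decay_weight y) = (\<Prod>b\<in>Basis. 1 + (y \<bullet> b)\<^sup>2)"
    by (simp add: decay_weight_def prod_inversef[symmetric])
  also have "\<dots> \<le> (\<Prod>b\<in>(Basis::(real^'n) set). 2 * max 1 (\<bar>y $ i\<bar>\<^sup>2))"
  proof (intro prod_mono conjI)
    fix b :: "real^'n" assume "b \<in> Basis"
    then obtain j where "b = axis j 1" by (auto simp: Basis_vec_def)
    then have "(y \<bullet> b)\<^sup>2 = \<bar>y $ j\<bar>\<^sup>2" by (simp add: inner_axis)
    also have "\<dots> \<le> \<bar>y $ i\<bar>\<^sup>2" by (intro power_mono max) auto
    finally show "1 + (y \<bullet> b)\<^sup>2 \<le> 2 * max 1 (\<bar>y $ i\<bar>\<^sup>2)" by (auto simp: max_def)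
  qed simp
  also have "\<dots> = 2 ^ CARD('n) * (max 1 (\<bar>y $ i\<bar>\<^sup>2)) ^ CARD('n)"
    by (simp add: power_mult_distrib)
  also have "(max 1 (\<bar>y $ i\<bar>\<^sup>2)) ^ CARD('n) = max 1 (\<bar>y $ i\<bar> ^ (2 * CARD('n)))"
  proof -
    have "max 1 a ^ m = max 1 (a ^ m)" if "0 \<le> a" for a :: real and m
      using that power_le_one[of a m] one_le_power[of a m] by (auto simp: max_def)
    then show ?thesis by (simp only: power_mult zero_le_power2)
  qed
  finally show ?thesis by (rule that)
qed

text \<open>Bounds on a function at scale \<open>r\<close> that have the right homogeneity in \<open>r\<close> give an
  \<open>L\<^sup>1\<close> bound on its Fourier transform that does not depend on \<open>r\<close> or on the centre \<open>\<xi>\<^sub>0\<close>: the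
  kernel is dominated by \<open>r ^ n * decay_weight (r x)\<close>.\<close>

lemma fourier_L1_bound:
  fixes f :: "real^'n::finite \<Rightarrow> complex"
  assumes f: "f \<in> schwartz" and r: "0 < r" and C: "0 < C" and A: "0 \<le> A"
    and supp: "closure {\<xi>. f \<xi> \<noteq> 0} \<subseteq> {\<xi>. norm (\<xi> - \<xi>\<^sub>0) < C * r}"
    and bound0: "\<And>\<xi>. norm (f \<xi>) \<le> A"
    and boundN: "\<And>i \<xi>. norm (partial_derivs (replicate (2 * CARD('n)) i) f \<xi>) \<le> A / r ^ (2 * CARD('n))"
  shows "(\<integral>x. norm (fourier f x) \<partial>lborel) \<le>
    2 ^ CARD('n) * (A * (unit_ball_vol (real CARD('n)) * C ^ CARD('n))) * (\<integral>x. decay_weight (x::real^'n) \<partial>lborel)"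
proof -
  define n where "n = CARD('n)"
  have n: "DIM(real^'n) = n" by (simp add: n_def)
  define V where "V = unit_ball_vol (real n) * C ^ n"
  have V: "0 \<le> V" using C by (simp add: V_def)
  have zero: "partial_derivs \<gamma> f \<xi> = 0" if "\<xi> \<notin> ball \<xi>\<^sub>0 (C * r)" for \<gamma> \<xi>
  proof (rule partial_derivs_eq_0_on_open)
    show "open (- closure {\<xi>. f \<xi> \<noteq> 0})" by (rule open_Compl) (rule closed_closure)
    show "f x = 0" if "x \<in> - closure {\<xi>. f \<xi> \<noteq> 0}" for x
      using that closure_subset[of "{\<xi>. f \<xi> \<noteq> 0}"] by blast
    have "\<not> norm (\<xi> - \<xi>\<^sub>0) < C * r"
      using that by (simp add: dist_norm norm_minus_commute)
    with supp show "\<xi> \<in> - closure {\<xi>. f \<xi> \<noteq> 0}" by blast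
  qed
  have L1: "(\<integral>\<xi>. norm (partial_derivs \<gamma> f \<xi>) \<partial>lborel) \<le> D * (V * r ^ n)"
    if D: "\<And>\<xi>. norm (partial_derivs \<gamma> f \<xi>) \<le> D" for \<gamma> D
  proof -
    have "(\<integral>\<xi>. norm (partial_derivs \<gamma> f \<xi>) \<partial>lborel) \<le> (\<integral>\<xi>. D * indicator (ball \<xi>\<^sub>0 (C * r)) \<xi> \<partial>lborel)"
    proof (intro integral_mono)
      show "integrable lborel (\<lambda>\<xi>. norm (partial_derivs \<gamma> f \<xi>))"
        by (intro integrable_norm schwartz_integrable schwartz_partial_derivs f)
      show "integrable lborel (\<lambda>\<xi>. D * indicator (ball \<xi>\<^sub>0 (C * r)) \<xi> :: real)"
        using emeasure_lborel_ball_finite[of \<xi>\<^sub>0 "C * r"]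
        by (intro integrable_mult_right integrable_real_indicator) auto
      show "norm (partial_derivs \<gamma> f \<xi>) \<le> D * indicator (ball \<xi>\<^sub>0 (C * r)) \<xi>" for \<xi>
        using D[of \<xi>] zero[of \<xi> \<gamma>] by (cases "\<xi> \<in> ball \<xi>\<^sub>0 (C * r)") auto
    qed
    also have "\<dots> = D * measure lborel (ball \<xi>\<^sub>0 (C * r))" by simp
    also have "\<dots> = D * (V * r ^ n)"
      using C r by (simp add: content_ball V_def n_def power_mult_distrib)
    finally show ?thesis .
  qed
  define M where "M = A * V"
  have M: "0 \<le> M" using A V by (simp add: M_def)
  have b0: "norm (fourier f x) \<le> M * r ^ n" for x
    using order_trans[OF norm_fourier_le L1[of "[]" A]] bound0
    by (simp add: partial_derivs_def M_def mult.assoc)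
  have bN: "\<bar>r * x $ i\<bar> ^ (2 * n) * norm (fourier f x) \<le> M * r ^ n" for x i
  proof -
    have "\<bar>x $ i\<bar> ^ (2 * n) \<le> (2 * pi * \<bar>x $ i\<bar>) ^ (2 * n)"
      using mult_right_mono[of 1 "2 * pi" "\<bar>x $ i\<bar>"] pi_ge_two by (intro power_mono) auto
    then have "\<bar>x $ i\<bar> ^ (2 * n) * norm (fourier f x) \<le> (2 * pi * \<bar>x $ i\<bar>) ^ (2 * n) * norm (fourier f x)"
      by (rule mult_right_mono) simp
    also have "\<dots> = norm (fourier (partial_derivs (replicate (2 * n) i) f) x)"
      unfolding fourier_iterated_partial_deriv[OF f] by (simp add: norm_mult norm_power)
    also have "\<dots> \<le> A / r ^ (2 * n) * (V * r ^ n)"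
      using order_trans[OF norm_fourier_le L1] boundN unfolding n_def by blast
    finally have "r ^ (2 * n) * (\<bar>x $ i\<bar> ^ (2 * n) * norm (fourier f x)) \<le> r ^ (2 * n) * (A / r ^ (2 * n) * (V * r ^ n))"
      using r by (intro mult_left_mono) auto
    also have "\<dots> = M * r ^ n" using r by (simp add: M_def)
    finally show ?thesis
      using r by (simp add: abs_mult power_mult_distrib mult.assoc)
  qed
  have K: "norm (fourier f x) \<le> (2 ^ n * M) * (r ^ n * decay_weight (0 + r *\<^sub>R x))" for x
  proof -
    obtain i where i: "inverse (decay_weight (r *\<^sub>R x)) \<le> 2 ^ n * max 1 (\<bar>(r *\<^sub>R x) $ i\<bar> ^ (2 * n))"
      unfolding n_def by (rule inverse_decay_weight_le)
    have "max 1 (\<bar>(r *\<^sub>R x) $ i\<bar> ^ (2 * n)) * norm (fourier f x) \<le> M * r ^ n"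
      using b0[of x] bN[of x i] by (simp add: max_def)
    then have "2 ^ n * (max 1 (\<bar>(r *\<^sub>R x) $ i\<bar> ^ (2 * n)) * norm (fourier f x)) \<le> 2 ^ n * (M * r ^ n)"
      by (intro mult_left_mono) auto
    moreover have "inverse (decay_weight (r *\<^sub>R x)) * norm (fourier f x) \<le>
        2 ^ n * max 1 (\<bar>(r *\<^sub>R x) $ i\<bar> ^ (2 * n)) * norm (fourier f x)"
      using i by (rule mult_right_mono) simp
    ultimately have "inverse (decay_weight (r *\<^sub>R x)) * norm (fourier f x) \<le> 2 ^ n * (M * r ^ n)"
      by (simp only: mult.assoc)
    then show ?thesis
      using decay_weight_pos[of "r *\<^sub>R x"] by (simp add: field_simps)
  qed
  have int: "integrable lborel (\<lambda>x::real^'n. decay_weight (0 + r *\<^sub>R x))"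
    using r by (intro integrable_affine integrable_decay_weight) auto
  have "(\<integral>x. norm (fourier f x) \<partial>lborel) \<le> (\<integral>x. (2 ^ n * M) * (r ^ n * decay_weight (0 + r *\<^sub>R (x::real^'n))) \<partial>lborel)"
    by (intro integral_mono integrable_norm schwartz_integrable fourier_schwartz f
        integrable_mult_right int K)
  also have "\<dots> = (2 ^ n * M) * (\<integral>x. decay_weight (x::real^'n) \<partial>lborel)"
    using integral_affine[of r "decay_weight :: real^'n \<Rightarrow> real" 0] r n by simp
  finally show ?thesis by (simp add: M_def V_def n_def)
qed

lemma japanese_ge_1: "1 \<le> japanese k"
  by (simp add: japanese_def)

lemma alpha_radius_pos: "0 < alpha_radius \<alpha> k"
  using japanese_ge_1[of k] by (simp add: alpha_radius_def)

lemma alpha_decomposition_kernels_bounded: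
  fixes \<eta> :: "int^'n::finite \<Rightarrow> real^'n \<Rightarrow> complex"
  assumes "alpha_decomposition \<alpha> \<eta>"
  obtains L where "0 < L" and "\<And>k. (\<integral>x. norm (fourier (\<eta> k) x) \<partial>lborel) \<le> L"
proof -
  define N where "N = 2 * CARD('n)"
  from assms have \<eta>: "\<And>k. \<eta> k \<in> schwartz"
    and "\<exists>C>0. \<forall>k. closure {\<xi>. \<eta> k \<xi> \<noteq> 0} \<subseteq> {\<xi>. norm (\<xi> - alpha_center \<alpha> k) < C * alpha_radius \<alpha> k}"
    and bounds: "\<And>\<gamma>. \<exists>C. \<forall>\<xi> k. norm (partial_derivs \<gamma> (\<eta> k) \<xi>)
        \<le> C * japanese k powr (- (\<alpha> * real (length \<gamma>) / (1 - \<alpha>)))"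
    unfolding alpha_decomposition_def by blast+
  then obtain C where C: "0 < C"
    and supp: "\<And>k. closure {\<xi>. \<eta> k \<xi> \<noteq> 0} \<subseteq> {\<xi>. norm (\<xi> - alpha_center \<alpha> k) < C * alpha_radius \<alpha> k}"
    by blast
  from bounds obtain D where D: "\<And>\<gamma> \<xi> k. norm (partial_derivs \<gamma> (\<eta> k) \<xi>)
        \<le> D \<gamma> * japanese k powr (- (\<alpha> * real (length \<gamma>) / (1 - \<alpha>)))"
    by metis
  have D': "norm (partial_derivs \<gamma> (\<eta> k) \<xi>) \<le> \<bar>D \<gamma>\<bar> / alpha_radius \<alpha> k ^ length \<gamma>" for \<gamma> k \<xi>
  proof -
    have "alpha_radius \<alpha> k ^ length \<gamma> = alpha_radius \<alpha> k powr real (length \<gamma>)"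
      using alpha_radius_pos[of \<alpha> k] by (simp add: powr_realpow)
    also have "\<dots> = japanese k powr (\<alpha> * real (length \<gamma>) / (1 - \<alpha>))"
      by (simp add: alpha_radius_def powr_powr)
    finally have eq: "japanese k powr (- (\<alpha> * real (length \<gamma>) / (1 - \<alpha>))) = inverse (alpha_radius \<alpha> k ^ length \<gamma>)"
      by (simp add: powr_minus)
    have "D \<gamma> * japanese k powr (- (\<alpha> * real (length \<gamma>) / (1 - \<alpha>))) \<le> \<bar>D \<gamma>\<bar> * inverse (alpha_radius \<alpha> k ^ length \<gamma>)"
      unfolding eq using alpha_radius_pos[of \<alpha> k] by (intro mult_right_mono) auto
    with D[of \<gamma> k \<xi>] show ?thesis by (simp add: divide_inverse)
  qed
  define A where "A = \<bar>D []\<bar> + (\<Sum>i\<in>UNIV. \<bar>D (replicate N i)\<bar>)"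
  have A: "0 \<le> A" unfolding A_def by (intro add_nonneg_nonneg sum_nonneg) auto
  have A0: "\<bar>D []\<bar> \<le> A" unfolding A_def by (simp add: sum_nonneg)
  have AN: "\<bar>D (replicate N i)\<bar> \<le> A" for i
    using member_le_sum[of i UNIV "\<lambda>i. \<bar>D (replicate N i)\<bar>"] unfolding A_def by simp
  define L where "L = 2 ^ CARD('n) * (A * (unit_ball_vol (real CARD('n)) * C ^ CARD('n))) * (\<integral>x. decay_weight (x::real^'n) \<partial>lborel)"
  have "(\<integral>x. norm (fourier (\<eta> k) x) \<partial>lborel) \<le> L" for k
    unfolding L_def
  proof (rule fourier_L1_bound[OF \<eta> alpha_radius_pos C A supp])
    show "norm (\<eta> k \<xi>) \<le> A" for \<xi>
      using D'[of "[]" k \<xi>] A0 by (simp add: partial_derivs_def)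
    show "norm (partial_derivs (replicate (2 * CARD('n)) i) (\<eta> k) \<xi>) \<le> A / alpha_radius \<alpha> k ^ (2 * CARD('n))" for i \<xi>
      using D'[of "replicate N i" k \<xi>] divide_right_mono[OF AN[of i], of "alpha_radius \<alpha> k ^ N"]
        alpha_radius_pos[of \<alpha> k] by (simp add: N_def)
  qed
  then have "(\<integral>x. norm (fourier (\<eta> k) x) \<partial>lborel) \<le> max 1 L" for k by (simp add: le_max_iff_disj)
  moreover have "0 < max 1 L" by simp
  ultimately show ?thesis using that by blast
qed

section \<open>Lattice sums\<close>

lemma sum_prod_box:
  fixes c :: "int \<Rightarrow> 'a::comm_semiring_1"
  assumes "finite I"
  shows "finite {k::int^'n::finite. \<forall>i. k $ i \<in> I}"
    and "(\<Sum>k\<in>{k::int^'n. \<forall>i. k $ i \<in> I}. \<Prod>i\<in>UNIV. c (k $ i)) = (\<Sum>m\<in>I. c m) ^ CARD('n)"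
proof -
  let ?P = "Pi\<^sub>E (UNIV::'n set) (\<lambda>_. I)"
  have im: "{k::int^'n. \<forall>i. k $ i \<in> I} = vec_lambda ` ?P"
  proof (intro set_eqI iffI)
    fix k :: "int^'n" assume "k \<in> {k. \<forall>i. k $ i \<in> I}"
    then have "vec_nth k \<in> ?P" by auto
    then show "k \<in> vec_lambda ` ?P" by (rule rev_image_eqI) (simp add: vec_lambda_eta)
  qed auto
  have fin: "finite ?P" using assms by (intro finite_PiE) auto
  then show "finite {k::int^'n. \<forall>i. k $ i \<in> I}" unfolding im by simp
  have inj: "inj_on vec_lambda ?P" by (intro inj_onI) (simp add: vec_lambda_inject)
  have "(\<Sum>m\<in>I. c m) ^ CARD('n) = (\<Prod>i\<in>(UNIV::'n set). \<Sum>m\<in>I. c m)" by simp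
  also have "\<dots> = (\<Sum>g\<in>?P. \<Prod>i\<in>UNIV. c (g i))"
    using assms by (intro prod_sum_PiE) auto
  also have "\<dots> = (\<Sum>k\<in>{k::int^'n. \<forall>i. k $ i \<in> I}. \<Prod>i\<in>UNIV. c (k $ i))"
    unfolding im by (subst sum.reindex[OF inj]) simp
  finally show "(\<Sum>k\<in>{k::int^'n. \<forall>i. k $ i \<in> I}. \<Prod>i\<in>UNIV. c (k $ i)) = (\<Sum>m\<in>I. c m) ^ CARD('n)" ..
qed

lemma card_int_box:
  assumes "finite I"
  shows "card {k::int^'n::finite. \<forall>i. k $ i \<in> I} = card I ^ CARD('n)"
  using sum_prod_box(2)[OF assms, of "\<lambda>_. 1::nat"] by simp

text \<open>Since \<open>1 + \<bar>k $ i\<bar> \<le> 2 * japanese k\<close> for every \<open>i\<close>, the sum is dominated by the \<open>n\<close>-th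
  power of a one-dimensional sum with exponent \<open>- \<beta> / n < - 1\<close>.\<close>

lemma japanese_sum_bounded:
  assumes \<beta>: "real CARD('n) < \<beta>"
  obtains B where "0 \<le> B" and "\<And>F. finite F \<Longrightarrow> (\<Sum>k\<in>F. japanese (k::int^'n::finite) powr (- \<beta>)) \<le> B"
proof -
  define n where "n = CARD('n)"
  have n: "0 < n" by (simp add: n_def)
  define \<delta> where "\<delta> = \<beta> / real n"
  have \<delta>: "1 < \<delta>" using \<beta> n by (simp add: \<delta>_def n_def)
  define c where "c m = (1 + \<bar>real_of_int m\<bar>) powr (- \<delta>)" for m :: int
  have c_nonneg: "0 \<le> c m" for m by (simp add: c_def)
  define S where "S = (\<Sum>j. real (Suc j) powr (- \<delta>))"
  have "summable (\<lambda>j. real j powr (- \<delta>))" using \<delta> by (simp add: summable_real_powr_iff)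
  then have summable: "summable (\<lambda>j. real (Suc j) powr (- \<delta>))" by (subst summable_Suc_iff)
  have S: "0 \<le> S" unfolding S_def by (intro suminf_nonneg summable) simp
  have one_dim: "(\<Sum>m\<in>{- int M..int M}. c m) \<le> 2 * S" for M
  proof -
    have nat_sum: "(\<Sum>j\<le>M. real (Suc j) powr (- \<delta>)) \<le> S"
      unfolding S_def by (intro sum_le_suminf summable) auto
    have sub: "{- int M..int M} \<subseteq> int ` {..M} \<union> (\<lambda>j. - int j) ` {..M}"
    proof
      fix m assume m: "m \<in> {- int M..int M}"
      show "m \<in> int ` {..M} \<union> (\<lambda>j. - int j) ` {..M}"
      proof (cases "0 \<le> m")
        case True
        with m have "m = int (nat m)" "nat m \<in> {..M}" by auto
        then show ?thesis by blast
      next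
        case False
        with m have "m = - int (nat (- m))" "nat (- m) \<in> {..M}" by auto
        then show ?thesis by blast
      qed
    qed
    have "(\<Sum>m\<in>{- int M..int M}. c m) \<le> (\<Sum>m\<in>int ` {..M} \<union> (\<lambda>j. - int j) ` {..M}. c m)"
      by (intro sum_mono2 sub) (auto simp: c_nonneg)
    also have "\<dots> \<le> (\<Sum>m\<in>int ` {..M}. c m) + (\<Sum>m\<in>(\<lambda>j. - int j) ` {..M}. c m)"
      using sum.union_inter[of "int ` {..M}" "(\<lambda>j. - int j) ` {..M}" c]
        sum_nonneg[of "int ` {..M} \<inter> (\<lambda>j. - int j) ` {..M}" c] c_nonneg by simp
    also have "\<dots> = (\<Sum>j\<le>M. real (Suc j) powr (- \<delta>)) + (\<Sum>j\<le>M. real (Suc j) powr (- \<delta>))"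
      by (simp add: sum.reindex inj_on_def c_def add.commute)
    finally show ?thesis using nat_sum by simp
  qed
  have le: "japanese k powr (- \<beta>) \<le> 2 powr \<beta> * (\<Prod>i\<in>UNIV. c (k $ i))" for k :: "int^'n"
  proof -
    have comp: "1 + \<bar>real_of_int (k $ i)\<bar> \<le> 2 * japanese k" for i
    proof -
      have "\<bar>real_of_int (k $ i)\<bar> \<le> norm (lattice_point k)"
        using component_le_norm_cart[of "lattice_point k" i] by (simp add: lattice_point_def)
      also have "\<dots> \<le> japanese k" unfolding japanese_def by (intro real_le_rsqrt) simp
      finally show ?thesis using japanese_ge_1[of k] by simp
    qed
    have "(2 * japanese k) powr (- \<beta>) = (\<Prod>i\<in>(UNIV::'n set). (2 * japanese k) powr (- \<delta>))"
      using japanese_ge_1[of k] n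
      by (simp add: powr_realpow[symmetric] powr_powr n_def[symmetric] \<delta>_def)
    also have "\<dots> \<le> (\<Prod>i\<in>UNIV. c (k $ i))"
      unfolding c_def using comp \<delta> by (intro prod_mono conjI powr_mono2') auto
    finally have "2 powr \<beta> * (2 * japanese k) powr (- \<beta>) \<le> 2 powr \<beta> * (\<Prod>i\<in>UNIV. c (k $ i))"
      by (intro mult_left_mono) auto
    moreover have "2 powr \<beta> * (2 * japanese k) powr (- \<beta>) = japanese k powr (- \<beta>)"
      using japanese_ge_1[of k] by (simp add: powr_mult powr_minus)
    ultimately show ?thesis by simp
  qed
  have "(\<Sum>k\<in>F. japanese k powr (- \<beta>)) \<le> 2 powr \<beta> * (2 * S) ^ n" if F: "finite F" for F :: "(int^'n) set"
  proof -
    define M where "M = nat (Max (insert 0 ((\<lambda>(k, i). \<bar>k $ i\<bar>) ` (F \<times> UNIV))))"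
    let ?I = "{- int M..int M}"
    have sub: "F \<subseteq> {k. \<forall>i. k $ i \<in> ?I}"
    proof (intro subsetI CollectI allI)
      fix k i assume k: "k \<in> F"
      have "\<bar>k $ i\<bar> \<le> Max (insert 0 ((\<lambda>(k, i). \<bar>k $ i\<bar>) ` (F \<times> (UNIV::'n set))))"
        using k F by (intro Max_ge) (auto intro!: image_eqI[of _ _ "(k, i)"])
      then show "k $ i \<in> ?I" unfolding M_def by auto
    qed
    have "(\<Sum>k\<in>F. japanese k powr (- \<beta>)) \<le> (\<Sum>k\<in>{k::int^'n. \<forall>i. k $ i \<in> ?I}. japanese k powr (- \<beta>))"
      by (intro sum_mono2 sub sum_prod_box) auto
    also have "\<dots> \<le> (\<Sum>k\<in>{k::int^'n. \<forall>i. k $ i \<in> ?I}. 2 powr \<beta> * (\<Prod>i\<in>UNIV. c (k $ i)))"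
      by (intro sum_mono le)
    also have "\<dots> = 2 powr \<beta> * (\<Sum>m\<in>?I. c m) ^ n"
      unfolding n_def by (subst sum_prod_box(2)[symmetric]) (simp_all add: sum_distrib_left)
    also have "\<dots> \<le> 2 powr \<beta> * (2 * S) ^ n"
      by (intro mult_left_mono power_mono one_dim sum_nonneg c_nonneg) auto
    finally show ?thesis .
  qed
  moreover have "0 \<le> 2 powr \<beta> * (2 * S) ^ n" using S by simp
  ultimately show ?thesis using that by blast
qed

text \<open>Each dyadic cube \<open>{2 ^ j..<2 ^ (j + 1)}\<close>, taken in every coordinate, contributes at least a
  fixed amount.\<close>

lemma japanese_sum_unbounded:
  assumes \<beta>: "\<beta> \<le> real CARD('n)"
  shows "\<exists>F. finite F \<and> B \<le> (\<Sum>k\<in>F. japanese (k::int^'n::finite) powr (- \<beta>))"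
proof -
  define n where "n = CARD('n)"
  define F where "F j = {k::int^'n. \<forall>i. k $ i \<in> {2 ^ j..<2 ^ Suc j}}" for j :: nat
  have fin: "finite (F j)" for j unfolding F_def by (rule sum_prod_box) simp
  have card: "card (F j) = (2 ^ j) ^ n" for j
    unfolding F_def n_def by (subst card_int_box) (simp_all add: nat_power_eq)
  have disj: "F j \<inter> F l = {}" if "j < l" for j l
  proof -
    have "k \<notin> F l" if "k \<in> F j" for k
    proof
      assume "k \<in> F l"
      fix i :: 'n
      have "(2::int) ^ Suc j \<le> 2 ^ l" using \<open>j < l\<close> by (intro power_increasing) auto
      moreover have "k $ i < 2 ^ Suc j" "2 ^ l \<le> k $ i"
        using \<open>k \<in> F j\<close> \<open>k \<in> F l\<close> by (auto simp: F_def)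
      ultimately show False by simp
    qed
    then show ?thesis by blast
  qed
  \<comment> \<open>On \<open>F j\<close> one has \<open>japanese k \<le> 2 * (1 + n) * 2 ^ j\<close>, and \<open>F j\<close> has \<open>(2 ^ j) ^ n\<close> elements.\<close>
  define c where "c = (2 * (1 + real n)) powr (- real n)"
  have c: "0 < c" by (simp add: c_def)
  have block: "c \<le> (\<Sum>k\<in>F j. japanese k powr (- \<beta>))" for j
  proof -
    have lower: "c * (1 / 2 ^ j) ^ n \<le> japanese k powr (- \<beta>)" if k: "k \<in> F j" for k
    proof -
      have "norm (lattice_point k) \<le> (\<Sum>i\<in>UNIV. \<bar>lattice_point k $ i\<bar>)" by (rule norm_le_l1_cart)
      also have "\<dots> \<le> (\<Sum>i\<in>(UNIV::'n set). 2 ^ Suc j)"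
      proof (intro sum_mono)
        fix i
        have "0 \<le> k $ i" "k $ i \<le> 2 ^ Suc j"
          using k by (auto simp: F_def intro: order_trans[OF _ less_imp_le] order_trans[of 0 "2 ^ j"])
        then have "real_of_int (k $ i) \<le> real_of_int (2 ^ Suc j)" by (simp only: of_int_le_iff)
        with \<open>0 \<le> k $ i\<close> show "\<bar>lattice_point k $ i\<bar> \<le> 2 ^ Suc j" by (simp add: lattice_point_def)
      qed
      also have "\<dots> = real n * 2 ^ Suc j" by (simp add: n_def)
      finally have N: "norm (lattice_point k) \<le> real n * 2 ^ Suc j" .
      have "japanese k \<le> 1 + norm (lattice_point k)"
        unfolding japanese_def by (intro real_le_lsqrt) (auto simp: power2_sum)
      also have "\<dots> \<le> 2 ^ Suc j + real n * 2 ^ Suc j"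
        using N one_le_power[of "2::real" "Suc j"] by simp
      also have "\<dots> = (2 * (1 + real n)) * 2 ^ j" by (simp add: algebra_simps)
      finally have J: "japanese k \<le> (2 * (1 + real n)) * 2 ^ j" .
      have "c * (1 / 2 ^ j) ^ n = ((2 * (1 + real n)) * 2 ^ j) powr (- real n)"
        unfolding c_def by (simp add: powr_mult powr_minus powr_realpow divide_inverse power_inverse)
      also have "\<dots> \<le> japanese k powr (- real n)"
        using J japanese_ge_1[of k] by (intro powr_mono2') auto
      also have "\<dots> \<le> japanese k powr (- \<beta>)"
        using \<beta> japanese_ge_1[of k] by (intro powr_mono) (auto simp: n_def)
      finally show ?thesis .
    qed
    have "c = (\<Sum>k\<in>F j. c * (1 / 2 ^ j) ^ n)"
      by (simp add: card power_divide)
    also have "\<dots> \<le> (\<Sum>k\<in>F j. japanese k powr (- \<beta>))" by (intro sum_mono lower)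
    finally show ?thesis .
  qed
  obtain m :: nat where m: "B / c \<le> real m" using real_arch_simple by blast
  have "B \<le> real m * c" using m c by (simp add: pos_divide_le_eq)
  also have "\<dots> = (\<Sum>j<m. c)" by simp
  also have "\<dots> \<le> (\<Sum>j<m. \<Sum>k\<in>F j. japanese k powr (- \<beta>))" by (intro sum_mono block)
  also have "\<dots> = (\<Sum>k\<in>(\<Union>j<m. F j). japanese k powr (- \<beta>))"
  proof (rule sum.UNION_disjoint[symmetric])
    show "\<forall>j\<in>{..<m}. \<forall>l\<in>{..<m}. j \<noteq> l \<longrightarrow> F j \<inter> F l = {}"
    proof (intro ballI impI)
      fix j l :: nat assume "j \<noteq> l"
      then consider "j < l" | "l < j" by linarith
      then show "F j \<inter> F l = {}" using disj[of j l] disj[of l j] by cases auto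
    qed
  qed (auto simp: fin)
  finally show ?thesis using fin by (intro exI[of _ "\<Union>j<m. F j"]) auto
qed

section \<open>Norms of represented distributions\<close>

lemma represents_AE_cong:
  assumes g: "represents g u" and [measurable]: "g \<in> borel_measurable borel" "g' \<in> borel_measurable borel"
    and eq: "AE x in lborel. g x = g' x"
  shows "represents g' u"
  unfolding represents_def
proof (intro ballI conjI)
  fix \<phi> :: "real^'a \<Rightarrow> complex" assume \<phi>: "\<phi> \<in> schwartz"
  then have [measurable]: "\<phi> \<in> borel_measurable borel" by (rule schwartz_measurable)
  have AE: "AE x in lborel. g x * \<phi> x = g' x * \<phi> x" using eq by eventually_elim simp
  have "integrable lborel (\<lambda>x. g x * \<phi> x)" "u \<phi> = (\<integral>x. g x * \<phi> x \<partial>lborel)"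
    using g \<phi> unfolding represents_def by blast+
  moreover have "integrable lborel (\<lambda>x. g x * \<phi> x) \<longleftrightarrow> integrable lborel (\<lambda>x. g' x * \<phi> x)"
    using AE by (intro integrable_cong_AE) auto
  moreover have "(\<integral>x. g x * \<phi> x \<partial>lborel) = (\<integral>x. g' x * \<phi> x \<partial>lborel)"
    using AE by (intro integral_cong_AE) auto
  ultimately show "integrable lborel (\<lambda>x. g' x * \<phi> x)" "u \<phi> = (\<integral>x. g' x * \<phi> x \<partial>lborel)" by auto
qed

lemma Lp_norm_cong_AE:
  assumes [measurable]: "g \<in> borel_measurable borel" "g' \<in> borel_measurable borel"
    and eq: "AE x in lborel. g x = g' x"
  shows "Lp_norm p g = Lp_norm p g'"
proof -
  have "esssup lborel (\<lambda>x. ennreal (norm (g x))) = esssup lborel (\<lambda>x. ennreal (norm (g' x)))"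
    using eq by (intro esssup_AE_cong) auto
  moreover have "(\<integral>\<^sup>+x. ennreal (norm (g x) powr enn2real p) \<partial>lborel) = (\<integral>\<^sup>+x. ennreal (norm (g' x) powr enn2real p) \<partial>lborel)"
    using eq by (intro nn_integral_cong_AE) auto
  ultimately show ?thesis by (simp add: Lp_norm_def)
qed

text \<open>All representing functions agree almost everywhere, so the infimum in the definition is taken
  over a single value. In particular lower bounds need to be checked for one representative only.\<close>

lemma Lp_distr_norm_eq:
  assumes g: "represents g u" and m: "g \<in> borel_measurable borel"
  shows "Lp_distr_norm p u = Lp_norm p g"
proof -
  have eq: "Lp_norm p g' = Lp_norm p g" if "g' \<in> {g \<in> borel_measurable lborel. represents g u}" for g'
  proof (rule Lp_norm_cong_AE)
    show "AE x in lborel. g' x = g x" using that by (intro represents_unique[OF _ g]) simp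
  qed (use that m in simp_all)
  have "(INF h \<in> {g \<in> borel_measurable lborel. represents g u}. Lp_norm p h) =
      (INF h \<in> {g \<in> borel_measurable lborel. represents g u}. Lp_norm p g)"
    by (rule INF_cong[OF refl eq])
  also have "\<dots> = Lp_norm p g" by (rule cINF_const) (use g m in auto)
  finally show ?thesis by (simp only: Lp_distr_norm_def)
qed

lemma Lp_norm_infinity_le:
  assumes [measurable]: "g \<in> borel_measurable borel" and "\<And>x. norm (g x) \<le> B"
  shows "Lp_norm \<infinity> g \<le> ennreal B"
  using assms(2) by (auto simp: Lp_norm_def intro!: esssup_I ennreal_leI)

text \<open>Cutting a representative off where it exceeds its essential supremum changes it on a null set
  only, and makes the bound hold at every point.\<close>

lemma Linf_space_bounded_representative:
  fixes u :: "'n::finite functional"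
  assumes "u \<in> Linf_space"
  shows "\<exists>g B. represents g u \<and> g \<in> borel_measurable borel \<and> (\<forall>x. norm (g x) \<le> B) \<and>
    0 \<le> B \<and> Lp_distr_norm \<infinity> u = ennreal B"
proof -
  from assms have "Lp_distr_norm \<infinity> u < \<infinity>" by (simp add: Linf_space_def)
  then obtain h where h: "represents h u" and [measurable]: "h \<in> borel_measurable borel"
    by (auto simp: Lp_distr_norm_def INF_less_iff)
  define B where "B = enn2real (Lp_distr_norm \<infinity> u)"
  have B: "Lp_distr_norm \<infinity> u = ennreal B"
    using \<open>Lp_distr_norm \<infinity> u < \<infinity>\<close> by (simp add: B_def)
  have "0 \<le> B" by (simp add: B_def)
  define g where "g x = (if norm (h x) \<le> B then h x else 0)" for x
  have [measurable]: "g \<in> borel_measurable borel" unfolding g_def[abs_def] by measurable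
  have "ennreal B = esssup lborel (\<lambda>x. ennreal (norm (h x)))"
    unfolding B[symmetric] by (subst Lp_distr_norm_eq[OF h]) (auto simp: Lp_norm_def)
  then have "AE x in lborel. ennreal (norm (h x)) \<le> ennreal B"
    using esssup_AE[of "\<lambda>x. ennreal (norm (h x))" lborel] by simp
  then have "AE x in lborel. h x = g x"
    by eventually_elim (simp add: g_def \<open>0 \<le> B\<close>)
  then have "represents g u" by (intro represents_AE_cong[OF h]) auto
  moreover have "\<forall>x. norm (g x) \<le> B" using \<open>0 \<le> B\<close> by (simp add: g_def)
  moreover have "g \<in> borel_measurable borel" by measurable
  ultimately show ?thesis using B \<open>0 \<le> B\<close> by blast
qed

lemma Linf_multiplier_bound:
  assumes u: "u \<in> Linf_space" and \<eta>: "\<eta> \<in> schwartz" and L: "(\<integral>x. norm (fourier \<eta> x) \<partial>lborel) \<le> L"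
  shows "Lp_distr_norm \<infinity> (fourier_mult \<eta> u) \<le> ennreal L * Lp_distr_norm \<infinity> u"
proof -
  obtain g B where g: "represents g u" and [measurable]: "g \<in> borel_measurable borel"
    and B: "\<And>x. norm (g x) \<le> B" "0 \<le> B" "Lp_distr_norm \<infinity> u = ennreal B"
    using Linf_space_bounded_representative[OF u] by blast
  let ?G = "dual_convolution (fourier \<eta>) g"
  have [measurable]: "fourier \<eta> \<in> borel_measurable borel"
    by (intro schwartz_measurable fourier_schwartz \<eta>)
  have "norm (?G x) \<le> B * L" for x
    using order_trans[OF norm_dual_convolution_le[OF schwartz_integrable[OF fourier_schwartz[OF \<eta>]]]
        mult_left_mono[OF L]] B by simp
  then have "Lp_norm \<infinity> ?G \<le> ennreal (B * L)"
    by (intro Lp_norm_infinity_le) auto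
  also have "\<dots> = ennreal L * Lp_distr_norm \<infinity> u"
    unfolding B(3) using B(2) order_trans[OF integral_nonneg_AE L]
    by (simp add: ennreal_mult mult.commute)
  finally show ?thesis
    using Lp_distr_norm_eq[OF represents_fourier_mult[OF g _ B(1) \<eta>]] by simp
qed

lemma Lp_norm_const_infinite:
  fixes c :: complex
  assumes p: "p \<noteq> \<infinity>" and c: "c \<noteq> 0"
  shows "Lp_norm p (\<lambda>x::real^'n::finite. c) = \<infinity>"
proof -
  have "(\<integral>\<^sup>+x. ennreal (norm c powr enn2real p) \<partial>(lborel :: (real^'n) measure)) = \<infinity>"
    using c by (simp add: ennreal_mult_top emeasure_lborel_UNIV)
  then show ?thesis using p by (simp add: Lp_norm_def ennreal_powr_def)
qed

text \<open>A lower bound on a nonempty open set is seen by the essential supremum, since such a set is not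
  a null set.\<close>

lemma le_Lp_norm_infinity_of_open:
  fixes G :: "real^'n::finite \<Rightarrow> complex"
  assumes [measurable]: "G \<in> borel_measurable borel" and S: "open S" "S \<noteq> {}"
    and G: "\<And>x. x \<in> S \<Longrightarrow> c \<le> norm (G x)"
  shows "ennreal c \<le> Lp_norm \<infinity> G"
proof (rule ccontr)
  assume "\<not> ennreal c \<le> Lp_norm \<infinity> G"
  then have less: "Lp_norm \<infinity> G < ennreal c" by simp
  have "AE x in lborel. ennreal (norm (G x)) \<le> Lp_norm \<infinity> G"
    using esssup_AE[of "\<lambda>x. ennreal (norm (G x))" lborel] by (simp add: Lp_norm_def)
  then have "AE x in lborel. x \<notin> S"
  proof eventually_elim
    case (elim x)
    from elim less have "ennreal (norm (G x)) < ennreal c" by (rule le_less_trans)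
    then have "norm (G x) < c" by (simp add: ennreal_less_iff)
    with G[of x] show ?case by auto
  qed
  then have "S \<in> null_sets lborel"
    using S(1) by (subst (asm) AE_iff_null_sets[symmetric]) auto
  then have "negligible S"
    using S(1) by (simp add: negligible_iff_null_sets null_sets_completionI)
  with S open_not_negligible show False by blast
qed

section \<open>Bounded functions are tempered distributions\<close>

lemma schwartz_seminorm_upper:
  assumes "\<phi> \<in> schwartz"
  shows "(1 + norm x) ^ N * norm (\<phi> x) \<le> schwartz_seminorm N [] \<phi>"
proof -
  obtain C where "\<And>x. (1 + norm x) ^ N * norm (\<phi> x) \<le> C"
    using schwartz_rapidly_decreasing[OF assms] unfolding rapidly_decreasing_def by blast
  then have "bdd_above (range (\<lambda>x. (1 + norm x) ^ N * norm (\<phi> x)))" by (intro bdd_aboveI) auto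
  then have "(1 + norm x) ^ N * norm (\<phi> x) \<le> (SUP x. (1 + norm x) ^ N * norm (\<phi> x))"
    by (intro cSUP_upper) auto
  then show ?thesis
    by (simp add: schwartz_seminorm_def partial_derivs_def)
qed

lemma schwartz_ball_open:
  fixes \<phi> :: "real^'n::finite \<Rightarrow> complex"
  assumes "\<phi> \<in> schwartz" "0 < e"
  shows "openin schwartz_topology {\<psi> \<in> schwartz. schwartz_seminorm N \<gamma> (\<lambda>x. \<psi> x - \<phi> x) < e}"
  unfolding schwartz_topology_def
  using assms by (intro topology_generated_by_Basis) blast

lemma schwartz_ball_centre:
  assumes "\<phi> \<in> schwartz" "0 < e"
  shows "\<phi> \<in> {\<psi> \<in> schwartz. schwartz_seminorm N [] (\<lambda>x. \<psi> x - \<phi> x) < e}"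
  using assms by (simp add: schwartz_seminorm_def partial_derivs_def)

lemma topspace_schwartz_topology: "topspace schwartz_topology = (schwartz :: (real^'n::finite \<Rightarrow> complex) set)"
proof
  show "topspace schwartz_topology \<subseteq> (schwartz :: (real^'n \<Rightarrow> complex) set)"
    unfolding schwartz_topology_def topology_generated_by_topspace by auto
  show "(schwartz :: (real^'n \<Rightarrow> complex) set) \<subseteq> topspace schwartz_topology"
  proof
    fix \<phi> :: "real^'n \<Rightarrow> complex" assume "\<phi> \<in> schwartz"
    then show "\<phi> \<in> topspace schwartz_topology"
      using openin_subset[OF schwartz_ball_open[of \<phi> 1 0 "[]"]] schwartz_ball_centre[of \<phi> 1 0] by auto
  qed
qed

text \<open>Integration against a bounded \<open>g\<close> is continuous already for the single seminorm of order zero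
  with weight exponent \<open>2 * n\<close>, because that seminorm dominates the \<open>L\<^sup>1\<close> norm.\<close>

lemma bounded_function_distribution:
  fixes g :: "real^'n::finite \<Rightarrow> complex"
  assumes [measurable]: "g \<in> borel_measurable borel" and B: "\<And>x. norm (g x) \<le> B"
  defines "u \<equiv> \<lambda>\<phi>. \<integral>x. g x * \<phi> x \<partial>lborel"
  shows "represents g u" and "u \<in> Linf_space" and "Lp_distr_norm \<infinity> u \<le> ennreal B"
proof -
  have int: "integrable lborel (\<lambda>x. g x * \<phi> x)" if "\<phi> \<in> schwartz" for \<phi>
    using that B by (intro integrable_mult_bounded schwartz_integrable) auto
  then show rep: "represents g u" by (simp add: represents_def u_def)
  then show norm: "Lp_distr_norm \<infinity> u \<le> ennreal B"
    using Lp_norm_infinity_le[of g B] B by (simp add: Lp_distr_norm_eq)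
  have linear: "u (\<lambda>x. a * \<phi> x + b * \<psi> x) = a * u \<phi> + b * u \<psi>"
    if "\<phi> \<in> schwartz" "\<psi> \<in> schwartz" for \<phi> \<psi> a b
  proof -
    have "u (\<lambda>x. a * \<phi> x + b * \<psi> x) = (\<integral>x. a * (g x * \<phi> x) + b * (g x * \<psi> x) \<partial>lborel)"
      unfolding u_def by (intro Bochner_Integration.integral_cong) (auto simp: algebra_simps)
    also have "\<dots> = a * u \<phi> + b * u \<psi>"
      unfolding u_def using int that by simp
    finally show ?thesis .
  qed
  define N where "N = 2 * DIM(real^'n)"
  define M where "M = B * (\<integral>x. decay_weight (x::real^'n) \<partial>lborel)"
  have "0 \<le> B" using order_trans[OF norm_ge_zero B] .
  then have M: "0 \<le> M"
    unfolding M_def by (intro mult_nonneg_nonneg integral_nonneg) (auto simp: less_imp_le decay_weight_pos)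
  have bound: "norm (u \<theta>) \<le> M * schwartz_seminorm N [] \<theta>" if \<theta>: "\<theta> \<in> schwartz" for \<theta>
  proof -
    have "norm (u \<theta>) \<le> (\<integral>x. norm (g x * \<theta> x) \<partial>lborel)"
      unfolding u_def by (rule integral_norm_bound)
    also have "\<dots> \<le> (\<integral>x. B * (schwartz_seminorm N [] \<theta> * decay_weight (x::real^'n)) \<partial>lborel)"
    proof (rule integral_mono)
      show "integrable lborel (\<lambda>x. norm (g x * \<theta> x))"
        by (rule integrable_norm[OF int[OF \<theta>]])
      show "integrable lborel (\<lambda>x::real^'n. B * (schwartz_seminorm N [] \<theta> * decay_weight x))"
        by (intro integrable_mult_right integrable_decay_weight)
      fix x
      have "norm (g x * \<theta> x) \<le> B * norm (\<theta> x)"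
        unfolding norm_mult by (intro mult_right_mono B) simp
      also have "norm (\<theta> x) \<le> schwartz_seminorm N [] \<theta> * decay_weight x"
        using schwartz_seminorm_upper[OF \<theta>, of x N] unfolding N_def by (rule le_decay_weight) simp
      then have "B * norm (\<theta> x) \<le> B * (schwartz_seminorm N [] \<theta> * decay_weight x)"
        using \<open>0 \<le> B\<close> by (rule mult_left_mono)
      finally show "norm (g x * \<theta> x) \<le> B * (schwartz_seminorm N [] \<theta> * decay_weight x)" .
    qed
    also have "\<dots> = M * schwartz_seminorm N [] \<theta>" by (simp add: M_def)
    finally show ?thesis .
  qed
  have "continuous_map schwartz_topology euclidean u"
    unfolding continuous_map_def
  proof (intro conjI allI impI)
    fix U :: "complex set" assume "openin euclidean U"
    then have U: "open U" by simp
    show "openin schwartz_topology {\<phi> \<in> topspace schwartz_topology. u \<phi> \<in> U}"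
    proof (subst openin_subopen, intro ballI)
      fix \<phi> assume "\<phi> \<in> {\<phi> \<in> topspace schwartz_topology. u \<phi> \<in> U}"
      then have \<phi>: "\<phi> \<in> schwartz" "u \<phi> \<in> U" by (auto simp: topspace_schwartz_topology)
      with U obtain e where e: "0 < e" "ball (u \<phi>) e \<subseteq> U" by (meson open_contains_ball)
      define d where "d = e / (M + 1)"
      have d: "0 < d" using e M by (simp add: d_def)
      let ?T = "{\<psi> \<in> schwartz. schwartz_seminorm N [] (\<lambda>x. \<psi> x - \<phi> x) < d}"
      have "u \<psi> \<in> U" if \<psi>: "\<psi> \<in> ?T" for \<psi>
      proof -
        have "u \<psi> - u \<phi> = u (\<lambda>x. \<psi> x - \<phi> x)"
          using linear[of \<psi> \<phi> 1 "-1"] \<psi> \<phi> by simp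
        also have "norm \<dots> \<le> M * schwartz_seminorm N [] (\<lambda>x. \<psi> x - \<phi> x)"
          using \<psi> \<phi> by (intro bound schwartz_diff) auto
        also have "\<dots> \<le> M * d" using \<psi> M by (intro mult_left_mono) auto
        also have "\<dots> < e" using M e by (simp add: d_def field_simps)
        finally have "u \<psi> \<in> ball (u \<phi>) e" by (simp add: dist_norm norm_minus_commute)
        with e show ?thesis by blast
      qed
      then show "\<exists>T. openin schwartz_topology T \<and> \<phi> \<in> T \<and> T \<subseteq> {\<phi> \<in> topspace schwartz_topology. u \<phi> \<in> U}"
        using schwartz_ball_open[OF \<phi>(1) d, of N "[]"] schwartz_ball_centre[OF \<phi>(1) d, of N]
        by (intro exI[of _ ?T]) (auto simp: topspace_schwartz_topology)
    qed
  qed simp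
  with linear have "tempered u" by (simp add: tempered_def)
  then show "u \<in> Linf_space"
    using le_less_trans[OF norm] by (simp add: Linf_space_def)
qed

section \<open>A bounded function that meets every frequency\<close>

lemma small_tail:
  fixes K :: "real^'n::finite \<Rightarrow> complex"
  assumes K: "integrable lborel K"
  shows "\<exists>R\<ge>0. (\<integral>z. norm (K z) * indicator {z. R \<le> \<bar>z $ i\<bar>} z \<partial>lborel) < 1 / 4"
proof -
  have [measurable]: "K \<in> borel_measurable borel" using borel_measurable_integrable[OF K] by simp
  have "(\<lambda>m. \<integral>z. norm (K z) * indicator {z. real m \<le> \<bar>z $ i\<bar>} z \<partial>lborel) \<longlonglongrightarrow> (\<integral>z. 0 \<partial>(lborel :: (real^'n) measure))"
  proof (rule integral_dominated_convergence)
    show "integrable lborel (\<lambda>z. norm (K z))" using K by simp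
    show "AE z in lborel. (\<lambda>m. norm (K z) * indicator {z. real m \<le> \<bar>z $ i\<bar>} z) \<longlonglongrightarrow> 0"
    proof (rule AE_I2)
      fix z :: "real^'n"
      have "\<forall>\<^sub>F m in sequentially. \<bar>z $ i\<bar> < real m"
        using filterlim_at_top_dense filterlim_real_sequentially by blast
      then have "\<forall>\<^sub>F m in sequentially. norm (K z) * indicator {z. real m \<le> \<bar>z $ i\<bar>} z = 0"
        by eventually_elim simp
      then show "(\<lambda>m. norm (K z) * indicator {z. real m \<le> \<bar>z $ i\<bar>} z) \<longlonglongrightarrow> 0"
        by (rule tendsto_eventually)
    qed
    show "AE z in lborel. norm (norm (K z) * indicator {z. real m \<le> \<bar>z $ i\<bar>} z) \<le> norm (K z)" for m
      by (intro AE_I2) (simp add: indicator_def)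
  qed measurable
  then have "\<forall>\<^sub>F m in sequentially. (\<integral>z. norm (K z) * indicator {z. real m \<le> \<bar>z $ i\<bar>} z \<partial>lborel) < 1 / 4"
    by (intro order_tendstoD) auto
  then obtain m where "(\<integral>z. norm (K z) * indicator {z. real m \<le> \<bar>z $ i\<bar>} z \<partial>lborel) < 1 / 4"
    by (auto simp: eventually_sequentially)
  then show ?thesis by (intro exI[of _ "real m"]) auto
qed

lemma dual_convolution_translate:
  assumes [measurable]: "K \<in> borel_measurable borel" "g \<in> borel_measurable borel"
  shows "dual_convolution K g x = (\<integral>z. g (x + z) * K z \<partial>lborel)"
  unfolding dual_convolution_def
  using integral_translate(2)[of "\<lambda>z. g (x + z) * K z" x] by simp

text \<open>If \<open>g\<close> is the pure frequency \<open>\<xi>\<close> on the slab of half-width \<open>R\<close> around \<open>x\<close>, then at \<open>x\<close> the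
  multiplier acts as multiplication by \<open>\<eta> \<xi>\<close>, up to twice the tail of its kernel.\<close>

lemma multiplier_on_pure_frequency:
  fixes \<eta> g :: "real^'n::finite \<Rightarrow> complex"
  assumes \<eta>: "\<eta> \<in> schwartz" and [measurable]: "g \<in> borel_measurable borel"
    and g: "\<And>y. norm (g y) \<le> 1"
    and tail: "(\<integral>z. norm (fourier \<eta> z) * indicator {z. R \<le> \<bar>z $ i\<bar>} z \<partial>lborel) < 1 / 4"
    and slab: "\<And>z. \<bar>z $ i\<bar> < R \<Longrightarrow> g (x + z) = phase ((x + z) \<bullet> \<xi>)"
  shows "norm (\<eta> \<xi>) - 1 / 2 \<le> norm (dual_convolution (fourier \<eta>) g x)"
proof -
  let ?K = "fourier \<eta>"
  have K: "integrable lborel ?K" by (intro schwartz_integrable fourier_schwartz \<eta>)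
  have [measurable]: "?K \<in> borel_measurable borel"
    by (intro schwartz_measurable fourier_schwartz \<eta>)
  have int_g: "integrable lborel (\<lambda>z. g (x + z) * ?K z)"
    using g K by (intro integrable_mult_bounded[where B = 1]) auto
  have int_p: "integrable lborel (\<lambda>z. phase ((x + z) \<bullet> \<xi>) * ?K z)"
    using K by (intro integrable_mult_bounded[where B = 1]) auto
  have pure: "(\<integral>z. phase ((x + z) \<bullet> \<xi>) * ?K z \<partial>lborel) = phase (x \<bullet> \<xi>) * \<eta> \<xi>"
  proof -
    have "phase ((x + z) \<bullet> \<xi>) * ?K z = phase (x \<bullet> \<xi>) * (?K z * phase (\<xi> \<bullet> z))" for z
      by (simp add: inner_add_left inner_add_right phase_add inner_commute)
    then have "(\<integral>z. phase ((x + z) \<bullet> \<xi>) * ?K z \<partial>lborel) = phase (x \<bullet> \<xi>) * inv_fourier ?K \<xi>"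
      by (simp only: inv_fourier_eq integral_mult_right_zero)
    then show ?thesis by (simp add: fourier_inversion[OF \<eta>])
  qed
  have "norm ((\<integral>z. phase ((x + z) \<bullet> \<xi>) * ?K z \<partial>lborel) - (\<integral>z. g (x + z) * ?K z \<partial>lborel)) =
      norm (\<integral>z. phase ((x + z) \<bullet> \<xi>) * ?K z - g (x + z) * ?K z \<partial>lborel)"
    using int_p int_g by simp
  also have "\<dots> \<le> (\<integral>z. norm (phase ((x + z) \<bullet> \<xi>) * ?K z - g (x + z) * ?K z) \<partial>lborel)"
    by (rule integral_norm_bound)
  also have "\<dots> \<le> (\<integral>z. 2 * (norm (?K z) * indicator {z. R \<le> \<bar>z $ i\<bar>} z) \<partial>lborel)"
  proof (intro integral_mono integrable_norm
      Bochner_Integration.integrable_diff int_p int_g integrable_mult_right)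
    show "integrable lborel (\<lambda>z. norm (?K z) * indicator {z. R \<le> \<bar>z $ i\<bar>} z)"
      by (rule Bochner_Integration.integrable_bound[OF integrable_norm[OF K]])
        (measurable, simp add: indicator_def)
    fix z :: "real^'n"
    show "norm (phase ((x + z) \<bullet> \<xi>) * ?K z - g (x + z) * ?K z) \<le> 2 * (norm (?K z) * indicator {z. R \<le> \<bar>z $ i\<bar>} z)"
    proof (cases "R \<le> \<bar>z $ i\<bar>")
      case True
      have "norm (phase ((x + z) \<bullet> \<xi>) - g (x + z)) \<le> 1 + 1"
        by (rule order_trans[OF norm_triangle_ineq4 add_mono]) (auto simp: g)
      then have "norm (phase ((x + z) \<bullet> \<xi>) - g (x + z)) * norm (?K z) \<le> 2 * norm (?K z)"
        by (intro mult_right_mono) auto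
      with True show ?thesis by (simp add: left_diff_distrib[symmetric] norm_mult)
    next
      case False
      with slab[of z] show ?thesis by simp
    qed
  qed
  also have "\<dots> \<le> 1 / 2" using tail by simp
  finally have "norm (phase (x \<bullet> \<xi>) * \<eta> \<xi> - dual_convolution ?K g x) \<le> 1 / 2"
    unfolding pure by (simp add: dual_convolution_translate)
  moreover have "norm (phase (x \<bullet> \<xi>) * \<eta> \<xi>) = norm (\<eta> \<xi>)" by (simp add: norm_mult)
  ultimately show ?thesis
    using norm_triangle_ineq2[of "phase (x \<bullet> \<xi>) * \<eta> \<xi>" "dual_convolution ?K g x"] by linarith
qed

text \<open>A single bounded function can show every frequency \<open>\<xi> k\<close> at full strength: cut space into slabs
  orthogonal to one axis, one for each \<open>k\<close>, and let the function oscillate with frequency \<open>\<xi> k\<close> on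
  the slab of \<open>k\<close>. The slab is chosen so wide that the kernel of the \<open>k\<close>-th piece, centred in its
  middle, hardly sees the other slabs.\<close>

lemma spread_frequencies:
  fixes \<eta> :: "int^'n::finite \<Rightarrow> real^'n \<Rightarrow> complex" and \<xi> :: "int^'n \<Rightarrow> real^'n"
  assumes \<eta>: "\<And>k. \<eta> k \<in> schwartz" and large: "\<And>k. 1 \<le> norm (\<eta> k (\<xi> k))"
  obtains u where "u \<in> Linf_space" "\<And>k. ennreal (1 / 2) \<le> Lp_distr_norm \<infinity> (fourier_mult (\<eta> k) u)"
proof -
  define i where "i = (SOME i::'n. True)"
  define \<kappa> where "\<kappa> j = (from_nat j :: int^'n)" for j
  have "\<exists>R. \<forall>k. 0 \<le> R k \<and> (\<integral>z. norm (fourier (\<eta> k) z) * indicator {z. R k \<le> \<bar>z $ i\<bar>} z \<partial>lborel) < 1 / 4"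
    using small_tail[OF schwartz_integrable[OF fourier_schwartz[OF \<eta>]]]
    by (intro choice allI) blast
  then obtain R where R: "\<And>k. 0 \<le> R k"
    and tail: "\<And>k. (\<integral>z. norm (fourier (\<eta> k) z) * indicator {z. R k \<le> \<bar>z $ i\<bar>} z \<partial>lborel) < 1 / 4"
    by blast
  \<comment> \<open>The slab of \<open>\<kappa> j\<close> is \<open>a j \<le> y $ i < a (Suc j)\<close>. Beyond the tail radius it has a margin of one
    unit on either side, so that the lower bound holds on an open slab.\<close>
  define a where "a j = (\<Sum>l<j. 2 * (R (\<kappa> l) + 1))" for j
  have a_Suc: "a (Suc j) = a j + 2 * (R (\<kappa> j) + 1)" for j by (simp add: a_def)
  have a_mono: "a j \<le> a l" if "j \<le> l" for j l
    unfolding a_def using that R by (intro sum_mono2) auto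
  define slot where "slot y = (LEAST j. y $ i < a (Suc j))" for y :: "real^'n"
  have slot: "slot y = j" if "a j \<le> y $ i" "y $ i < a (Suc j)" for y j
    unfolding slot_def
  proof (rule Least_equality[where P = "\<lambda>j. y $ i < a (Suc j)", OF that(2)])
    fix l assume "y $ i < a (Suc l)"
    then show "j \<le> l" using that(1) a_mono[of "Suc l" j] by (intro leI) auto
  qed
  have [measurable]: "slot \<in> borel \<rightarrow>\<^sub>M count_space UNIV"
    unfolding slot_def[abs_def] by measurable
  define f where "f y = phase (y \<bullet> \<xi> (\<kappa> (slot y)))" for y
  have [measurable]: "f \<in> borel_measurable borel"
    unfolding f_def[abs_def]
    by (rule measurable_compose_countable[where f = "\<lambda>j y. phase (y \<bullet> \<xi> (\<kappa> j))" and g = slot]) measurable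
  have f: "norm (f y) \<le> 1" for y by (simp add: f_def)
  define u where "u \<phi> = (\<integral>x. f x * \<phi> x \<partial>lborel)" for \<phi>
  have u: "represents f u" "u \<in> Linf_space"
    using bounded_function_distribution[of f 1] f unfolding u_def[abs_def] by auto
  have "ennreal (1 / 2) \<le> Lp_distr_norm \<infinity> (fourier_mult (\<eta> k) u)" for k
  proof -
    obtain j where j: "\<kappa> j = k" unfolding \<kappa>_def using from_nat_to_nat by blast
    let ?G = "dual_convolution (fourier (\<eta> k)) f"
    have [measurable]: "fourier (\<eta> k) \<in> borel_measurable borel"
      by (intro schwartz_measurable fourier_schwartz \<eta>)
    define S where "S = {x::real^'n. a j + R k < x $ i \<and> x $ i < a j + R k + 2}"
    have "1 / 2 \<le> norm (?G x)" if x: "x \<in> S" for x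
    proof -
      have "norm (\<eta> k (\<xi> k)) - 1 / 2 \<le> norm (?G x)"
      proof (rule multiplier_on_pure_frequency[OF \<eta> _ f tail])
        fix z :: "real^'n" assume "\<bar>z $ i\<bar> < R k"
        then have "slot (x + z) = j" using x j by (intro slot) (auto simp: S_def a_Suc)
        then show "f (x + z) = phase ((x + z) \<bullet> \<xi> k)" by (simp add: f_def j)
      qed simp
      with large[of k] show ?thesis by linarith
    qed
    moreover have "open S"
      unfolding S_def by (intro open_Collect_conj open_Collect_less continuous_intros)
    moreover have "S \<noteq> {}"
    proof -
      have "axis i (a j + R k + 1) \<in> S" by (simp add: S_def)
      then show ?thesis by blast
    qed
    ultimately have "ennreal (1 / 2) \<le> Lp_norm \<infinity> ?G"
      by (intro le_Lp_norm_infinity_of_open) auto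
    then show ?thesis
      using Lp_distr_norm_eq[OF represents_fourier_mult[OF u(1) _ f \<eta>[of k]], of \<infinity>] by simp
  qed
  with u(2) show ?thesis by (rule that)
qed

section \<open>The embedding\<close>

lemma ennreal_powr_top: "ennreal_powr \<infinity> r = \<infinity>"
  by (simp add: ennreal_powr_def)

lemma ennreal_powr_ennreal: "0 \<le> x \<Longrightarrow> ennreal_powr (ennreal x) r = ennreal (x powr r)"
  by (simp add: ennreal_powr_def)

lemma ennreal_powr_mono:
  assumes "x \<le> y" "0 \<le> r"
  shows "ennreal_powr x r \<le> ennreal_powr y r"
proof (cases y)
  case (real b)
  with assms(1) have "x < \<infinity>" by (auto simp: less_top[symmetric] top_unique)
  then obtain a where a: "x = ennreal a" "0 \<le> a" by (cases x) auto
  with real assms show ?thesis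
    by (auto simp: ennreal_powr_ennreal intro!: ennreal_leI powr_mono2)
qed (simp add: ennreal_powr_def)

lemma index_A_infinity:
  assumes "0 < q"
  shows "index_A n \<infinity> q = (if q = \<infinity> then 0 else - real n / enn2real q)"
proof (cases q)
  case (real r)
  with assms have "0 < r" by simp
  then have "1 / q = ennreal (1 / r)"
    using divide_ennreal[of 1 r] real by simp
  then have "enn2real (1 / q) = 1 / r"
    using \<open>0 < r\<close> by simp
  then have "index_A n \<infinity> q = - real n / r"
    using \<open>0 < r\<close> by (simp add: index_A_def min_def divide_le_0_iff algebra_simps)
  with real show ?thesis by simp
qed (simp add: index_A_def)

lemma alpha_mod_norm_partial_sum_le:
  fixes \<eta> :: "int^'n::finite \<Rightarrow> real^'n \<Rightarrow> complex"
  assumes "q \<noteq> \<infinity>" "finite F"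
  shows "ennreal_powr (\<Sum>k\<in>F. ennreal (japanese k powr (s * enn2real q / (1 - \<alpha>))) *
      ennreal_powr (Lp_distr_norm p (fourier_mult (\<eta> k) u)) (enn2real q)) (1 / enn2real q)
    \<le> alpha_mod_norm \<eta> s \<alpha> p q u"
  unfolding alpha_mod_norm_def if_not_P[OF assms(1)]
  by (subst nonneg_infsum_complete) (auto intro!: ennreal_powr_mono SUP_upper assms)

lemma alpha_mod_norm_infinity_term_le:
  fixes \<eta> :: "int^'n::finite \<Rightarrow> real^'n \<Rightarrow> complex"
  shows "ennreal (japanese k powr (s / (1 - \<alpha>))) * Lp_distr_norm p (fourier_mult (\<eta> k) u)
    \<le> alpha_mod_norm \<eta> s \<alpha> p \<infinity> u"
  unfolding alpha_mod_norm_def if_P[OF refl] by (rule SUP_upper) simp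

text \<open>Every piece of a bounded function is bounded by the same multiple of its norm, so the embedding
  holds as soon as the weights are bounded (\<open>q = \<infinity>\<close>) or have a convergent sum (\<open>q < \<infinity>\<close>).\<close>

lemma embeds_of_small_s:
  fixes \<eta> :: "int^'n::finite \<Rightarrow> real^'n \<Rightarrow> complex"
  assumes \<alpha>: "\<alpha> < 1" and q: "0 < q" and dec: "alpha_decomposition \<alpha> \<eta>"
    and s: "if q = \<infinity> then s \<le> 0 else s * enn2real q / (1 - \<alpha>) < - real CARD('n)"
  shows "embeds Linf_space (Lp_distr_norm \<infinity>) (alpha_mod_space \<eta> s \<alpha> \<infinity> q) (alpha_mod_norm \<eta> s \<alpha> \<infinity> q)"
proof -
  obtain L where L: "0 < L" "\<And>k. (\<integral>x. norm (fourier (\<eta> k) x) \<partial>lborel) \<le> L"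
    using alpha_decomposition_kernels_bounded[OF dec] by blast
  have \<eta>: "\<eta> k \<in> schwartz" for k using dec by (simp add: alpha_decomposition_def)
  have piece: "Lp_distr_norm \<infinity> (fourier_mult (\<eta> k) u) \<le> ennreal L * Lp_distr_norm \<infinity> u"
    if "u \<in> Linf_space" for u k
    using Linf_multiplier_bound[OF that \<eta> L(2)] .
  obtain D where D: "\<And>u. u \<in> Linf_space \<Longrightarrow> alpha_mod_norm \<eta> s \<alpha> \<infinity> q u \<le> ennreal D * Lp_distr_norm \<infinity> u"
  proof (cases "q = \<infinity>")
    case True
    have "alpha_mod_norm \<eta> s \<alpha> \<infinity> q u \<le> ennreal L * Lp_distr_norm \<infinity> u" if u: "u \<in> Linf_space" for u
    proof -
      have "ennreal (japanese k powr (s / (1 - \<alpha>))) * Lp_distr_norm \<infinity> (fourier_mult (\<eta> k) u)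
          \<le> 1 * (ennreal L * Lp_distr_norm \<infinity> u)" for k
      proof (rule mult_mono[OF _ piece[OF u]])
        have "s / (1 - \<alpha>) \<le> 0" using s True \<alpha> by (simp add: divide_nonpos_pos)
        then have "japanese k powr (s / (1 - \<alpha>)) \<le> japanese k powr 0"
          using japanese_ge_1[of k] by (rule powr_mono)
        then show "ennreal (japanese k powr (s / (1 - \<alpha>))) \<le> 1"
          using japanese_ge_1[of k] by (simp add: ennreal_le_1)
      qed auto
      then show ?thesis using True by (auto simp: alpha_mod_norm_def intro!: SUP_least)
    qed
    then show ?thesis by (rule that)
  next
    case False
    define r where "r = enn2real q"
    have r: "0 < r" using q False by (simp add: r_def enn2real_positive_iff less_top)
    define \<beta> where "\<beta> = - (s * r / (1 - \<alpha>))"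
    have "real CARD('n) < \<beta>" using s False by (simp add: \<beta>_def r_def)
    then obtain B where B: "0 \<le> B"
      "\<And>F. finite F \<Longrightarrow> (\<Sum>k\<in>F. japanese (k::int^'n) powr (- \<beta>)) \<le> B"
      using japanese_sum_bounded by blast
    have "alpha_mod_norm \<eta> s \<alpha> \<infinity> q u \<le> ennreal (B powr (1 / r) * L) * Lp_distr_norm \<infinity> u"
      if u: "u \<in> Linf_space" for u
    proof -
      obtain b where b: "0 \<le> b" "Lp_distr_norm \<infinity> u = ennreal b"
        using Linf_space_bounded_representative[OF u] by blast
      let ?t = "\<lambda>k. ennreal (japanese k powr (s * enn2real q / (1 - \<alpha>))) *
          ennreal_powr (Lp_distr_norm \<infinity> (fourier_mult (\<eta> k) u)) (enn2real q)"
      have t: "?t k \<le> ennreal (japanese k powr (- \<beta>) * (L * b) powr r)" for k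
      proof -
        have "ennreal_powr (Lp_distr_norm \<infinity> (fourier_mult (\<eta> k) u)) r \<le> ennreal_powr (ennreal (L * b)) r"
          using piece[OF u, of k] r L(1) b(1) unfolding b(2)
          by (intro ennreal_powr_mono) (auto simp: ennreal_mult)
        also have "\<dots> = ennreal ((L * b) powr r)" using L(1) b(1) by (simp add: ennreal_powr_ennreal)
        finally show ?thesis
          unfolding r_def[symmetric] \<beta>_def by (simp add: ennreal_mult mult_left_mono)
      qed
      have "(\<Sum>\<^sub>\<infinity>k. ?t k) \<le> ennreal (B * (L * b) powr r)"
      proof (rule infsum_le_finite_sums[OF nonneg_summable_on_complete])
        fix F :: "(int^'n) set" assume F: "finite F"
        have "(\<Sum>k\<in>F. ?t k) \<le> (\<Sum>k\<in>F. ennreal (japanese k powr (- \<beta>) * (L * b) powr r))"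
          by (intro sum_mono t)
        also have "\<dots> = ennreal ((\<Sum>k\<in>F. japanese k powr (- \<beta>)) * (L * b) powr r)"
          by (subst sum_ennreal) (simp_all add: sum_distrib_right)
        also have "\<dots> \<le> ennreal (B * (L * b) powr r)"
          using B(2)[OF F] by (intro ennreal_leI mult_right_mono) auto
        finally show "(\<Sum>k\<in>F. ?t k) \<le> ennreal (B * (L * b) powr r)" .
      qed simp
      then have "alpha_mod_norm \<eta> s \<alpha> \<infinity> q u \<le> ennreal_powr (ennreal (B * (L * b) powr r)) (1 / r)"
        using False r by (auto simp: alpha_mod_norm_def r_def intro!: ennreal_powr_mono)
      also have "\<dots> = ennreal ((B * (L * b) powr r) powr (1 / r))"
        using B(1) by (simp add: ennreal_powr_ennreal)
      also have "(B * (L * b) powr r) powr (1 / r) = B powr (1 / r) * L * b"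
        using B(1) L(1) b(1) r by (simp add: powr_mult powr_powr)
      finally show ?thesis
        using B(1) L(1) b(1) unfolding b(2) by (simp add: ennreal_mult)
    qed
    then show ?thesis by (rule that)
  qed
  have "alpha_mod_norm \<eta> s \<alpha> \<infinity> q u < \<infinity>" if u: "u \<in> Linf_space" for u
  proof -
    have "Lp_distr_norm \<infinity> u < \<infinity>" using u by (simp add: Linf_space_def)
    then have "ennreal D * Lp_distr_norm \<infinity> u < \<infinity>" by (simp add: ennreal_mult_less_top)
    with D[OF u] show ?thesis by (rule le_less_trans)
  qed
  then have "Linf_space \<subseteq> alpha_mod_space \<eta> s \<alpha> \<infinity> q"
    by (auto simp: alpha_mod_space_def Linf_space_def)
  with D show ?thesis unfolding embeds_def by blast
qed

text \<open>The constant function \<open>1\<close> is bounded, and its piece of index \<open>0\<close> is the constant \<open>\<eta> 0 0\<close>, which is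
  not zero: the lower bound on \<open>\<eta> 0\<close> holds around the centre \<open>0\<close>. A nonzero constant lies in no
  \<open>L\<^sup>p\<close> with \<open>p < \<infinity>\<close>.\<close>

lemma p_infinite_of_embeds:
  fixes \<eta> :: "int^'n::finite \<Rightarrow> real^'n \<Rightarrow> complex"
  assumes q: "0 < q" and dec: "alpha_decomposition \<alpha> \<eta>"
    and sub: "Linf_space \<subseteq> alpha_mod_space \<eta> s \<alpha> p q"
  shows "p = \<infinity>"
proof (rule ccontr)
  assume p: "p \<noteq> \<infinity>"
  have \<eta>: "\<eta> k \<in> schwartz" for k using dec by (simp add: alpha_decomposition_def)
  define u :: "'n functional" where "u \<phi> = (\<integral>x. 1 * \<phi> x \<partial>lborel)" for \<phi>
  have u: "represents (\<lambda>_. 1) u" "u \<in> Linf_space"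
    using bounded_function_distribution[of "\<lambda>_. 1" 1] unfolding u_def[abs_def] by auto
  have "alpha_center \<alpha> (0::int^'n) = 0"
    by (simp add: alpha_center_def lattice_point_def vec_eq_iff)
  moreover obtain c where "0 < c" "\<And>k \<xi>. norm (\<xi> - alpha_center \<alpha> k) < c * alpha_radius \<alpha> k \<Longrightarrow> 1 \<le> norm (\<eta> k \<xi>)"
    using dec unfolding alpha_decomposition_def by blast
  ultimately have "1 \<le> norm (\<eta> 0 0)"
    using alpha_radius_pos[of \<alpha> "0::int^'n"] by simp
  then have nz: "\<eta> 0 0 \<noteq> 0" by auto
  have [measurable]: "fourier (\<eta> 0) \<in> borel_measurable borel"
    by (intro schwartz_measurable fourier_schwartz \<eta>)
  have "dual_convolution (fourier (\<eta> 0)) (\<lambda>_. 1) = (\<lambda>_. \<eta> 0 0)"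
    using fourier_inversion[OF \<eta>[of 0], of 0]
    by (auto simp: dual_convolution_translate inv_fourier_eq)
  then have "represents (\<lambda>_. \<eta> 0 0) (fourier_mult (\<eta> 0) u)"
    using represents_fourier_mult[OF u(1) _ _ \<eta>[of 0], of 1] by simp
  then have top: "Lp_distr_norm p (fourier_mult (\<eta> 0) u) = \<infinity>"
    using Lp_norm_const_infinite[OF p nz] by (subst Lp_distr_norm_eq) auto
  have J: "japanese (0::int^'n) = 1"
    by (simp add: japanese_def lattice_point_def zero_vec_def[symmetric])
  have "alpha_mod_norm \<eta> s \<alpha> p q u = \<infinity>"
  proof (cases "q = \<infinity>")
    case True
    from alpha_mod_norm_infinity_term_le[of 0 s \<alpha> p \<eta> u] show ?thesis
      unfolding True top J by (simp add: top_unique)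
  next
    case False
    from alpha_mod_norm_partial_sum_le[OF False, of "{0}" s \<alpha> p \<eta> u] show ?thesis
      by (simp add: J top[simplified] ennreal_powr_top[simplified] top_unique)
  qed
  moreover have "alpha_mod_norm \<eta> s \<alpha> p q u < \<infinity>"
    using u(2) sub by (auto simp: alpha_mod_space_def)
  ultimately show False by simp
qed

text \<open>For a bounded function all of whose pieces have norm at least \<open>1 / 2\<close>, finiteness of the norm
  is a condition on the weights alone: they must be bounded, respectively summable.\<close>

lemma s_small_of_embeds:
  fixes \<eta> :: "int^'n::finite \<Rightarrow> real^'n \<Rightarrow> complex"
  assumes \<alpha>: "\<alpha> < 1" and q: "0 < q" and dec: "alpha_decomposition \<alpha> \<eta>"
    and sub: "Linf_space \<subseteq> alpha_mod_space \<eta> s \<alpha> \<infinity> q"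
  shows "if q = \<infinity> then s \<le> 0 else s * enn2real q / (1 - \<alpha>) < - real CARD('n)"
proof -
  have \<eta>: "\<eta> k \<in> schwartz" for k using dec by (simp add: alpha_decomposition_def)
  obtain c where "0 < c" "\<And>k \<xi>. norm (\<xi> - alpha_center \<alpha> k) < c * alpha_radius \<alpha> k \<Longrightarrow> 1 \<le> norm (\<eta> k \<xi>)"
    using dec unfolding alpha_decomposition_def by blast
  then have "1 \<le> norm (\<eta> k (alpha_center \<alpha> k))" for k
    using alpha_radius_pos[of \<alpha> k] by simp
  then obtain u where u: "u \<in> Linf_space"
    and half: "\<And>k. ennreal (1 / 2) \<le> Lp_distr_norm \<infinity> (fourier_mult (\<eta> k) u)"
    using spread_frequencies[of \<eta> "alpha_center \<alpha>"] \<eta> by blast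
  have "alpha_mod_norm \<eta> s \<alpha> \<infinity> q u < \<infinity>"
    using u sub by (auto simp: alpha_mod_space_def)
  then obtain M where M: "0 \<le> M" "alpha_mod_norm \<eta> s \<alpha> \<infinity> q u = ennreal M"
    by (cases "alpha_mod_norm \<eta> s \<alpha> \<infinity> q u") auto
  show ?thesis
  proof (cases "q = \<infinity>")
    case True
    have bound: "japanese k powr (s / (1 - \<alpha>)) \<le> 2 * M" for k :: "int^'n"
    proof -
      have "ennreal (japanese k powr (s / (1 - \<alpha>)) * (1 / 2)) =
          ennreal (japanese k powr (s / (1 - \<alpha>))) * ennreal (1 / 2)"
        by (rule ennreal_mult) auto
      also have "\<dots> \<le> ennreal (japanese k powr (s / (1 - \<alpha>))) * Lp_distr_norm \<infinity> (fourier_mult (\<eta> k) u)"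
        by (intro mult_left_mono half) simp
      also have "\<dots> \<le> alpha_mod_norm \<eta> s \<alpha> \<infinity> q u"
        unfolding True by (rule alpha_mod_norm_infinity_term_le)
      finally have "ennreal (japanese k powr (s / (1 - \<alpha>)) * (1 / 2)) \<le> ennreal M" by (simp only: M(2))
      then show ?thesis using M(1) by (simp add: ennreal_le_iff)
    qed
    have "s \<le> 0"
    proof (rule ccontr)
      assume "\<not> s \<le> 0"
      define e where "e = s / (1 - \<alpha>)"
      have e: "0 < e" using \<alpha> \<open>\<not> s \<le> 0\<close> by (simp add: e_def)
      \<comment> \<open>A lattice point so large that its weight exceeds the bound \<open>2 * M\<close>.\<close>
      define m where "m = nat \<lceil>(2 * M + 1) powr (1 / e)\<rceil>"
      let ?k = "(\<chi> i. int m) :: int^'n"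
      have "(2 * M + 1) powr (1 / e) \<le> real m"
        unfolding m_def by (rule real_nat_ceiling_ge)
      also have "real m \<le> norm (lattice_point ?k)"
        using component_le_norm_cart[of "lattice_point ?k"] by (simp add: lattice_point_def)
      also have "\<dots> \<le> japanese ?k" unfolding japanese_def by (intro real_le_rsqrt) simp
      finally have "((2 * M + 1) powr (1 / e)) powr e \<le> japanese ?k powr e"
        using e by (intro powr_mono2) auto
      then have "2 * M + 1 \<le> japanese ?k powr e"
        using e M(1) by (simp add: powr_powr)
      with bound[of ?k] show False by (simp add: e_def)
    qed
    with True show ?thesis by simp
  next
    case False
    define r where "r = enn2real q"
    have r: "0 < r" using q False by (simp add: r_def enn2real_positive_iff less_top)
    define \<beta> where "\<beta> = - (s * r / (1 - \<alpha>))"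
    have bound: "(\<Sum>k\<in>F. japanese (k::int^'n) powr (- \<beta>)) * (1 / 2) powr r \<le> M powr r" if F: "finite F" for F
    proof -
      let ?S = "(\<Sum>k\<in>F. japanese k powr (- \<beta>)) * (1 / 2) powr r"
      have S: "0 \<le> ?S" by (intro mult_nonneg_nonneg sum_nonneg) auto
      have "ennreal ?S = (\<Sum>k\<in>F. ennreal (japanese k powr (- \<beta>)) * ennreal ((1 / 2) powr r))"
        by (simp add: sum_distrib_right sum_ennreal[symmetric] ennreal_mult del: sum_ennreal)
      also have "\<dots> \<le> (\<Sum>k\<in>F. ennreal (japanese k powr (- \<beta>)) *
          ennreal_powr (Lp_distr_norm \<infinity> (fourier_mult (\<eta> k) u)) r)"
      proof (intro sum_mono mult_left_mono)
        fix k
        have "ennreal_powr (ennreal (1 / 2)) r \<le> ennreal_powr (Lp_distr_norm \<infinity> (fourier_mult (\<eta> k) u)) r"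
          using r by (intro ennreal_powr_mono half) simp
        then show "ennreal ((1 / 2) powr r) \<le> ennreal_powr (Lp_distr_norm \<infinity> (fourier_mult (\<eta> k) u)) r"
          by (subst (asm) ennreal_powr_ennreal) simp_all
      qed simp
      finally have "ennreal_powr (ennreal ?S) (1 / r) \<le> ennreal_powr (\<Sum>k\<in>F. ennreal (japanese k powr (- \<beta>)) *
          ennreal_powr (Lp_distr_norm \<infinity> (fourier_mult (\<eta> k) u)) r) (1 / r)"
        using r by (intro ennreal_powr_mono) auto
      also have "\<dots> \<le> alpha_mod_norm \<eta> s \<alpha> \<infinity> q u"
        using alpha_mod_norm_partial_sum_le[OF False F, of s \<alpha> \<infinity> \<eta> u] by (simp add: \<beta>_def r_def)
      finally have "ennreal (?S powr (1 / r)) \<le> ennreal M"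
        unfolding M(2) ennreal_powr_ennreal[OF S] .
      then have "?S powr (1 / r) \<le> M" using M(1) by (simp add: ennreal_le_iff)
      then have "(?S powr (1 / r)) powr r \<le> M powr r" using r by (intro powr_mono2) auto
      then show ?thesis using S r by (simp add: powr_powr)
    qed
    have "real CARD('n) < \<beta>"
    proof (rule ccontr)
      assume "\<not> real CARD('n) < \<beta>"
      then have "\<beta> \<le> real CARD('n)" by simp
      from japanese_sum_unbounded[OF this, of "(M powr r + 1) / (1 / 2) powr r"]
      obtain F where F: "finite F"
        and large: "(M powr r + 1) / (1 / 2) powr r \<le> (\<Sum>k\<in>F. japanese (k::int^'n) powr (- \<beta>))"
        by blast
      have "M powr r + 1 \<le> (\<Sum>k\<in>F. japanese k powr (- \<beta>)) * (1 / 2) powr r"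
        using large by (subst (asm) pos_divide_le_eq) auto
      with bound[OF F] show False by simp
    qed
    with False show ?thesis by (simp add: \<beta>_def r_def)
  qed
qed

theorem theorem1p5:
  fixes \<alpha> s :: real and p q :: ennreal
    and \<eta> :: "int^'n::finite \<Rightarrow> real^'n \<Rightarrow> complex"
  assumes "0 \<le> \<alpha>" and "\<alpha> < 1" and "0 < p" and "0 < q"
    and "alpha_decomposition \<alpha> \<eta>"
  shows "embeds Linf_space (Lp_distr_norm \<infinity>)
           (alpha_mod_space \<eta> s \<alpha> p q) (alpha_mod_norm \<eta> s \<alpha> p q) \<longleftrightarrow>
         p = \<infinity> \<and> s \<le> (1 - \<alpha>) * index_A CARD('n) \<infinity> q \<and>
         (q < \<infinity> \<longrightarrow> s < (1 - \<alpha>) * index_A CARD('n) \<infinity> q)"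
proof -
  let ?embeds = "embeds Linf_space (Lp_distr_norm \<infinity>)
    (alpha_mod_space \<eta> s \<alpha> p q) (alpha_mod_norm \<eta> s \<alpha> p q)"
  let ?s = "s \<le> (1 - \<alpha>) * index_A CARD('n) \<infinity> q \<and>
    (q < \<infinity> \<longrightarrow> s < (1 - \<alpha>) * index_A CARD('n) \<infinity> q)"
  have s: "?s \<longleftrightarrow> (if q = \<infinity> then s \<le> 0 else s * enn2real q / (1 - \<alpha>) < - real CARD('n))"
  proof (cases "q = \<infinity>")
    case True
    then show ?thesis using assms(2) unfolding index_A_infinity[OF assms(4)] by simp
  next
    case False
    then have "0 < enn2real q"
      using assms by (simp add: enn2real_positive_iff less_top)
    then have "s < (1 - \<alpha>) * (- real CARD('n) / enn2real q) \<longleftrightarrow> s * enn2real q / (1 - \<alpha>) < - real CARD('n)"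
      using assms(2) by (simp add: field_simps)
    with False show ?thesis
      unfolding index_A_infinity[OF assms(4)] by (auto simp: less_top)
  qed
  show ?thesis
  proof
    assume ?embeds
    then have sub: "Linf_space \<subseteq> alpha_mod_space \<eta> s \<alpha> p q" by (simp add: embeds_def)
    then have "p = \<infinity>" using assms by (intro p_infinite_of_embeds)
    with sub s_small_of_embeds[of \<alpha> q \<eta> s] assms show "p = \<infinity> \<and> ?s"
      unfolding s by simp
  next
    assume "p = \<infinity> \<and> ?s"
    then show ?embeds
      using embeds_of_small_s[of \<alpha> q \<eta> s] assms unfolding s by simp
  qed
qed

end
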